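(* Let $(G,L)$ be a $(G,L)$-pair. The set of double cosets $\Gamma_\infty=L^\Xi\setminus G/L^\Xi$ admits a natural structure of a semigroup (the mantle of the pair $(G,L)$), with product $\mathfrak g\circ\mathfrak h$ equal to the eventual value of $L^\Xi\, g\,\Theta^{[\Xi]}_m h\,L^\Xi$ as $m\to\infty$, $g\in\mathfrak g$, $h\in\mathfrak h$; and for every unitary representation $\rho$ of the pair $(G,L)$ the map $\overline\rho_{\Xi,\Xi}$ is a representation of the semigroup $\Gamma_\infty$.
   Context: Classical groups. A matrix $g$ over $\mathbb R,\mathbb C$ or $\mathbb H$ with rows and columns indexed by a countable basis is finite if $g-1$ has only finitely many nonzero entries. All groups below consist of finite invertible matrices satisfying the usual identities. The irreducible classical groups and their maximal heavy subgroups are: $\mathrm{GL}(\infty,\mathbb R)\supset \mathrm O(\infty)$; $\mathrm{GL}(\infty,\mathbb C)\supset \mathrm U(\infty)$; $\mathrm{GL}(\infty,\mathbb H)\supset\mathrm{Sp}(\infty)$; $\mathrm U(\infty,\infty)\supset \mathrm U(\infty)\times \mathrm U(\infty)$; $\mathrm{Sp}(2\infty,\mathbb R)\supset \mathrm U(\infty)$; $\mathrm{Sp}(2\infty,\mathbb C)\supset\mathrm{Sp}(\infty)$; $\mathrm{Sp}(\infty,\infty)\supset\mathrm{Sp}(\infty)\times\mathrm{Sp}(\infty)$; $\mathrm O(\infty,\infty)\supset\mathrm O(\infty)\times\mathrm O(\infty)$; $\mathrm O(\infty,\mathbb C)\supset\mathrm O(\infty)$; $\mathrm{SO}^*(2\infty)\supset\mathrm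 U(\infty)$; $\mathrm U(p,\infty)\supset\mathrm U(\infty)$; $\mathrm O(p,\infty)\supset\mathrm O(\infty)$; $\mathrm{Sp}(p,\infty)\supset\mathrm{Sp}(\infty)$ with $0\le p<\infty$ (for $p=0$: the groups $\mathrm U(\infty),\mathrm O(\infty),\mathrm{Sp}(\infty)$ themselves). Here $\mathrm{Sp}(\infty)$ is the quaternionic unitary group. A classical group is a finite product of irreducible ones; its maximal heavy subgroup $K$ is the product of the maximal heavy subgroups of the factors. A heavy group is a finite product of groups $\mathrm O(\infty),\mathrm U(\infty),\mathrm{Sp}(\infty)$ (called irreducible heavy groups). Straight homomorphisms. Trivial homomorphisms between irreducible heavy groups are: the identity maps, elementwise complex conjugation of $\mathrm U(\infty)$, and the obvious maps $\mathrm O(\infty)\to\mathrm U(\infty)$, $\mathrm O(\infty)\to\mathrm{Sp}(\infty)$, $\mathrm U(\infty)\to\mathrm{Sp}(\infty)$, $\mathrm U(\infty)\to\mathrm O(2\infty)$, $\mathrm{Sp}(\infty)\to\mathrm O(4\infty)$, $\mathrm{Sp}(\infty)\to\mathrm U(2\infty)$. For $L=L_1\times\dots\times L_p$ heavy and $K$ irreducible heavy, a homomorphism $L\to K$ is straight if it has the block diagonal form $(g_1,\dots,g_p)\mapsto\mathrm{diag}(1_a,\tau_1(g_{m_1}),\dots,\tau_N(g_{m_N}))$ with $\tau_j$ trivial, $0<N<\infty$, $a\in\{0,1,2,\dots,\infty\}$ (not required to be faithful). For $K=K_1\times\dots\times K_q$, a straight homomorphism $L\to K$ is a product of straight homomorphisms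 $L\to K_i$. A $(G,L)$-pair consists of a classical group $G$ with maximal heavy subgroup $K$ and a heavy group $L$ straightly embedded in $K$. A unitary representation of the pair $(G,L)$ is a unitary representation $\rho$ of $G$ in a Hilbert space $H$ whose restriction to $L$ is continuous (with respect to the weak operator topology on $L$). Let $L=L_1\times\dots\times L_p$, where $L_j$ acts in a space $\ell_2=\ell_2(\mathbb N)$. For each $j$ split $\mathbb N=\Xi_j\sqcup\Omega_j$ into two infinite (countable) subsets. Let $L^\Xi\subset L$ be the product of the stabilizers in $L_j$ of all basis vectors with indices in $\Xi_j$. Enumerate $\Omega_j=\{\omega_{j,1},\omega_{j,2},\dots\}$ and, for a multi-index $m=(m_1,\dots,m_p)$, let $\Theta^{[\Xi]}_m\in L^\Xi$ be the element whose $j$-th component is the permutation matrix swapping the basis vectors $\omega_{j,i}$ and $\omega_{j,m_j+i}$, $1\le i\le m_j$, and fixing all others. "$m\to\infty$" means all $m_j\to\infty$. $H^{[\Xi]}$ is the space of $L^\Xi$-fixed vectors in $H$, $P^{[\Xi]}$ is the orthogonal projection onto it, and $\overline\rho_{\Xi,\Xi}(g)=P^{[\Xi]}\rho(g):H^{[\Xi]}\to H^{[\Xi]}$, which depends only on the double coset $L^\Xi gL^\Xi$. *)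

theory Defs
  imports "HOL-Analysis.Analysis" "HOL-Algebra.Product_Groups"
begin

section \<open>Quaternions\<close>

datatype quat = Quat (qRe: real) (qI: real) (qJ: real) (qK: real)

lemma quat_eq_iff: "x = y \<longleftrightarrow> qRe x = qRe y \<and> qI x = qI y \<and> qJ x = qJ y \<and> qK x = qK y"
  by (cases x; cases y) auto

instantiation quat :: ring_1
begin

definition "0 = Quat 0 0 0 0"
definition "1 = Quat 1 0 0 0"
definition "- x = Quat (- qRe x) (- qI x) (- qJ x) (- qK x)"
definition "x + y = Quat (qRe x + qRe y) (qI x + qI y) (qJ x + qJ y) (qK x + qK y)"
definition "x - y = Quat (qRe x - qRe y) (qI x - qI y) (qJ x - qJ y) (qK x - qK y)" for x y :: quat
definition "x * y = Quat
  (qRe x * qRe y - qI x * qI y - qJ x * qJ y - qK x * qK y)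
  (qRe x * qI y + qI x * qRe y + qJ x * qK y - qK x * qJ y)
  (qRe x * qJ y - qI x * qK y + qJ x * qRe y + qK x * qI y)
  (qRe x * qK y + qI x * qJ y - qJ x * qI y + qK x * qRe y)"

instance
proof
  fix a b c :: quat
  show "a * b * c = a * (b * c)"
    unfolding quat_eq_iff times_quat_def by (simp add: algebra_simps)
qed (simp_all add: quat_eq_iff zero_quat_def one_quat_def uminus_quat_def plus_quat_def
      minus_quat_def times_quat_def algebra_simps)

end

lemma quat_sel [simp]:
  "qRe 0 = 0" "qI 0 = 0" "qJ 0 = 0" "qK 0 = 0"
  "qRe 1 = 1" "qI 1 = 0" "qJ 1 = 0" "qK 1 = 0"
  "qRe (- x) = - qRe x" "qI (- x) = - qI x" "qJ (- x) = - qJ x" "qK (- x) = - qK x"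
  "qRe (x + y) = qRe x + qRe y" "qI (x + y) = qI x + qI y"
  "qJ (x + y) = qJ x + qJ y" "qK (x + y) = qK x + qK y"
  "qRe (x - y) = qRe x - qRe y" "qI (x - y) = qI x - qI y"
  "qJ (x - y) = qJ x - qJ y" "qK (x - y) = qK x - qK y"
  by (simp_all add: zero_quat_def one_quat_def uminus_quat_def plus_quat_def minus_quat_def)

lemma quat_sel_mult:
  "qRe (x * y) = qRe x * qRe y - qI x * qI y - qJ x * qJ y - qK x * qK y"
  "qI (x * y) = qRe x * qI y + qI x * qRe y + qJ x * qK y - qK x * qJ y"
  "qJ (x * y) = qRe x * qJ y - qI x * qK y + qJ x * qRe y + qK x * qI y"
  "qK (x * y) = qRe x * qK y + qI x * qJ y - qJ x * qI y + qK x * qRe y"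
  by (simp_all add: times_quat_def)

instantiation quat :: real_vector
begin

definition "scaleR r x = Quat (r * qRe x) (r * qI x) (r * qJ x) (r * qK x)"

instance
  by standard (simp_all add: quat_eq_iff scaleR_quat_def algebra_simps)

end

lemma quat_sel_scaleR [simp]:
  "qRe (r *\<^sub>R x) = r * qRe x" "qI (r *\<^sub>R x) = r * qI x"
  "qJ (r *\<^sub>R x) = r * qJ x" "qK (r *\<^sub>R x) = r * qK x"
  by (simp_all add: scaleR_quat_def)

instantiation quat :: real_inner
begin

definition inner_quat_def: "inner x y = qRe x * qRe y + qI x * qI y + qJ x * qJ y + qK x * qK y"
definition "norm x = sqrt (inner x x)" for x :: quat
definition "sgn x = x /\<^sub>R norm x" for x :: quat
definition "dist x y = norm (x - y)" for x y :: quat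
definition [code del]:
  "(uniformity :: (quat \<times> quat) filter) = (INF e\<in>{0 <..}. principal {(x, y). dist x y < e})"
definition [code del]:
  "open (U :: quat set) \<longleftrightarrow> (\<forall>x\<in>U. eventually (\<lambda>(x', y). x' = x \<longrightarrow> y \<in> U) uniformity)"

instance
proof
  fix x y z :: quat and r s :: real
  show "inner x x = 0 \<longleftrightarrow> x = 0"
    by (simp add: inner_quat_def quat_eq_iff add_nonneg_eq_0_iff)
  show "norm x = sqrt (inner x x)"
    by (simp add: norm_quat_def)
  show "0 \<le> inner x x"
    by (simp add: inner_quat_def)
qed (simp_all add: inner_quat_def sgn_quat_def dist_quat_def uniformity_quat_def open_quat_def
      algebra_simps)

end

instance quat :: real_algebra_1
  by standard (auto simp: quat_eq_iff quat_sel_mult algebra_simps)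

definition qcnj :: "quat \<Rightarrow> quat" where
  "qcnj x = Quat (qRe x) (- qI x) (- qJ x) (- qK x)"


section \<open>Finite matrices\<close>

text \<open>
  Matrices over the reals, the complex numbers and the quaternions are all represented by
  quaternionic matrices, with \<open>\<real> \<subset> \<complex> = \<real> + \<real>i \<subset> \<bbbH>\<close>; the countable basis is indexed by \<open>nat\<close>.
  On complex entries \<^const>\<open>qcnj\<close> is complex conjugation.
\<close>

datatype scalars = Scal_R | Scal_C | Scal_H

primrec scalar_set :: "scalars \<Rightarrow> quat set" where
  "scalar_set Scal_R = {x. qI x = 0 \<and> qJ x = 0 \<and> qK x = 0}"
| "scalar_set Scal_C = {x. qJ x = 0 \<and> qK x = 0}"
| "scalar_set Scal_H = UNIV"

type_synonym mat = "nat \<Rightarrow> nat \<Rightarrow> quat"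

definition mat_one :: mat where
  "mat_one = (\<lambda>x y. if x = y then 1 else 0)"

text \<open>The product is the usual one for row-finite matrices, the only ones multiplied below.\<close>

definition mat_mult :: "mat \<Rightarrow> mat \<Rightarrow> mat"  (infixl "*\<^sub>m" 70) where
  "A *\<^sub>m B = (\<lambda>x y. \<Sum>k | A x k \<noteq> 0. A x k * B k y)"

definition mat_vec :: "mat \<Rightarrow> (nat \<Rightarrow> quat) \<Rightarrow> nat \<Rightarrow> quat" where
  "mat_vec A v = (\<lambda>x. \<Sum>k | A x k \<noteq> 0. A x k * v k)"

definition basis_vec :: "nat \<Rightarrow> nat \<Rightarrow> quat" where
  "basis_vec n = (\<lambda>x. if x = n then 1 else 0)"

definition mat_transpose :: "mat \<Rightarrow> mat" where
  "mat_transpose A = (\<lambda>x y. A y x)"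

definition mat_cnj :: "mat \<Rightarrow> mat" where
  "mat_cnj A = (\<lambda>x y. qcnj (A x y))"

definition mat_adjoint :: "mat \<Rightarrow> mat" where
  "mat_adjoint A = (\<lambda>x y. qcnj (A y x))"

definition mat_diag :: "(nat \<Rightarrow> quat) \<Rightarrow> mat" where
  "mat_diag d = (\<lambda>x y. if x = y then d x else 0)"

definition finite_mats :: "scalars \<Rightarrow> mat set" where
  "finite_mats F =
     {A. (\<forall>x y. A x y \<in> scalar_set F) \<and> finite {(x, y). A x y \<noteq> mat_one x y}}"

definition mat_monoid :: "mat set \<Rightarrow> mat monoid" where
  "mat_monoid S = \<lparr>carrier = S, monoid.mult = mat_mult, one = mat_one\<rparr>"

definition general_linear :: "scalars \<Rightarrow> mat set" where
  "general_linear F = Units (mat_monoid (finite_mats F))"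

definition block_diag :: "nat \<Rightarrow> (nat \<Rightarrow> nat \<Rightarrow> nat) \<Rightarrow> (nat \<Rightarrow> mat) \<Rightarrow> mat" where
  \<comment> \<open>Block-diagonal matrix: the \<open>j\<close>-th block (\<open>j < N\<close>) is \<open>B j\<close>, placed on the basis vectors
     \<open>\<beta> j 0, \<beta> j 1, \<dots>\<close>; the remaining basis vectors carry the identity block \<open>1\<^sub>a\<close>.\<close>
  "block_diag N \<beta> B = (\<lambda>x y.
     if \<exists>j<N. x \<in> range (\<beta> j) \<and> y \<in> range (\<beta> j)
     then let j = (THE j. j < N \<and> x \<in> range (\<beta> j)) in B j (inv_into UNIV (\<beta> j) x) (inv_into UNIV (\<beta> j) y)
     else mat_one x y)"

definition disjoint_blocks :: "nat \<Rightarrow> (nat \<Rightarrow> nat \<Rightarrow> nat) \<Rightarrow> bool" where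
  "disjoint_blocks N \<beta> \<longleftrightarrow>
     (\<forall>j<N. inj (\<beta> j)) \<and> disjoint_family_on (\<lambda>j. range (\<beta> j)) {..<N}"

text \<open>
  Restriction of scalars. \<open>realify n\<close> replaces each entry \<open>q\<close> by the real \<open>n \<times> n\<close> matrix of
  \<open>h \<mapsto> q h\<close> in the basis \<open>1, i\<close> (\<open>n = 2\<close>) or \<open>1, i, j, k\<close> (\<open>n = 4\<close>); \<open>complexify\<close> replaces
  \<open>q = z + w j\<close> by the rows \<open>(z, w)\<close>, \<open>(- cnj w, cnj z)\<close>.
\<close>

definition qbasis :: "nat \<Rightarrow> quat" where
  "qbasis t = [Quat 1 0 0 0, Quat 0 1 0 0, Quat 0 0 1 0, Quat 0 0 0 1] ! t"

definition qcoord :: "nat \<Rightarrow> quat \<Rightarrow> real" where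
  "qcoord s q = [qRe q, qI q, qJ q, qK q] ! s"

definition realify :: "nat \<Rightarrow> mat \<Rightarrow> mat" where
  "realify n A = (\<lambda>x y. of_real (qcoord (x mod n) (A (x div n) (y div n) * qbasis (y mod n))))"

definition complexify :: "mat \<Rightarrow> mat" where
  "complexify A = (\<lambda>x y.
     let q = A (x div 2) (y div 2); z = Quat (qRe q) (qI q) 0 0; w = Quat (qJ q) (qK q) 0 0
     in if even x then (if even y then z else w) else (if even y then - qcnj w else qcnj z))"


section \<open>Heavy groups\<close>

datatype heavy = O_inf | U_inf | Sp_inf

primrec heavy_scalars :: "heavy \<Rightarrow> scalars" where
  "heavy_scalars O_inf = Scal_R"
| "heavy_scalars U_inf = Scal_C"
| "heavy_scalars Sp_inf = Scal_H"

definition irr_heavy_group :: "heavy \<Rightarrow> mat monoid" where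
  "irr_heavy_group h =
     mat_monoid {A \<in> general_linear (heavy_scalars h). mat_adjoint A *\<^sub>m A = mat_one}"

definition heavy_group :: "heavy list \<Rightarrow> (nat \<Rightarrow> mat) monoid" where
  "heavy_group L = product_group {..<length L} (\<lambda>j. irr_heavy_group (L ! j))"

text \<open>
  The weak operator topology: the coarsest topology making all matrix elements
  \<open>g \<mapsto> \<langle>g v, w\<rangle>\<close>, with \<open>v\<close>, \<open>w\<close> in \<open>\<ell>\<^sub>2\<close> over the respective scalars, continuous.
\<close>

definition ell2 :: "scalars \<Rightarrow> (nat \<Rightarrow> quat) set" where
  "ell2 F = {v. (\<forall>x. v x \<in> scalar_set F) \<and> summable (\<lambda>x. (norm (v x))\<^sup>2)}"

definition ell2_inner :: "(nat \<Rightarrow> quat) \<Rightarrow> (nat \<Rightarrow> quat) \<Rightarrow> quat" where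
  "ell2_inner v w = (\<Sum>x. qcnj (w x) * v x)"

definition irr_heavy_topology :: "heavy \<Rightarrow> mat topology" where
  "irr_heavy_topology h =
     (let E = ell2 (heavy_scalars h) in
      pullback_topology (carrier (irr_heavy_group h))
        (\<lambda>g. \<lambda>(v, w)\<in>E \<times> E. ell2_inner (mat_vec g v) w)
        (product_topology (\<lambda>_. euclidean) (E \<times> E)))"

definition heavy_topology :: "heavy list \<Rightarrow> (nat \<Rightarrow> mat) topology" where
  "heavy_topology L = product_topology (\<lambda>j. irr_heavy_topology (L ! j)) {..<length L}"


section \<open>Classical groups and their maximal heavy subgroups\<close>

datatype classical =
    GL_R | GL_C | GL_H                          \<comment> \<open>\<open>GL(\<infinity>,\<real>)\<close>, \<open>GL(\<infinity>,\<complex>)\<close>, \<open>GL(\<infinity>,\<bbbH>)\<close>\<close>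
  | U_inf_inf | Sp_2inf_R | Sp_2inf_C | Sp_inf_inf | O_inf_inf | O_inf_C
  | SO_star                                     \<comment> \<open>\<open>SO\<^sup>*(2\<infinity>)\<close>\<close>
  | U_fin_inf nat | O_fin_inf nat | Sp_fin_inf nat   \<comment> \<open>\<open>U(p,\<infinity>)\<close>, \<open>O(p,\<infinity>)\<close>, \<open>Sp(p,\<infinity>)\<close>\<close>

text \<open>
  Gram matrices of the forms: \<open>(\<infinity>,\<infinity>)\<close> has sign \<open>+\<close> on even and \<open>-\<close> on odd basis vectors,
  \<open>(p,\<infinity>)\<close> has sign \<open>-\<close> on the first \<open>p\<close>. The symplectic form pairs the basis vectors \<open>2k\<close> and
  \<open>2k + 1\<close>. \<open>SO\<^sup>*(2\<infinity>)\<close> preserves the quaternionic skew-Hermitian form with matrix \<open>i\<cdot>1\<close>.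
\<close>

definition sig_inf_inf :: mat where
  "sig_inf_inf = mat_diag (\<lambda>x. if even x then 1 else -1)"

definition sig_fin_inf :: "nat \<Rightarrow> mat" where
  "sig_fin_inf p = mat_diag (\<lambda>x. if x < p then -1 else 1)"

definition symplectic_form :: mat where
  "symplectic_form = (\<lambda>x y. if even x \<and> y = x + 1 then 1 else if even y \<and> x = y + 1 then -1 else 0)"

definition skew_form :: mat where
  "skew_form = mat_diag (\<lambda>_. Quat 0 1 0 0)"

definition sesquilinear_isometries :: "scalars \<Rightarrow> mat \<Rightarrow> mat set" where
  "sesquilinear_isometries F J = {A \<in> general_linear F. mat_adjoint A *\<^sub>m J *\<^sub>m A = J}"

definition bilinear_isometries :: "scalars \<Rightarrow> mat \<Rightarrow> mat set" where
  "bilinear_isometries F J = {A \<in> general_linear F. mat_transpose A *\<^sub>m J *\<^sub>m A = J}"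

primrec irr_classical_carrier :: "classical \<Rightarrow> mat set" where
  "irr_classical_carrier GL_R = general_linear Scal_R"
| "irr_classical_carrier GL_C = general_linear Scal_C"
| "irr_classical_carrier GL_H = general_linear Scal_H"
| "irr_classical_carrier U_inf_inf = sesquilinear_isometries Scal_C sig_inf_inf"
| "irr_classical_carrier Sp_2inf_R = bilinear_isometries Scal_R symplectic_form"
| "irr_classical_carrier Sp_2inf_C = bilinear_isometries Scal_C symplectic_form"
| "irr_classical_carrier Sp_inf_inf = sesquilinear_isometries Scal_H sig_inf_inf"
| "irr_classical_carrier O_inf_inf = bilinear_isometries Scal_R sig_inf_inf"
| "irr_classical_carrier O_inf_C = bilinear_isometries Scal_C mat_one"
| "irr_classical_carrier SO_star = sesquilinear_isometries Scal_H skew_form"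
| "irr_classical_carrier (U_fin_inf p) = sesquilinear_isometries Scal_C (sig_fin_inf p)"
| "irr_classical_carrier (O_fin_inf p) = bilinear_isometries Scal_R (sig_fin_inf p)"
| "irr_classical_carrier (Sp_fin_inf p) = sesquilinear_isometries Scal_H (sig_fin_inf p)"

definition classical_group :: "classical list \<Rightarrow> (nat \<Rightarrow> mat) monoid" where
  "classical_group G =
     product_group {..<length G} (\<lambda>i. mat_monoid (irr_classical_carrier (G ! i)))"

primrec irr_max_heavy :: "classical \<Rightarrow> heavy list" where
  "irr_max_heavy GL_R = [O_inf]"
| "irr_max_heavy GL_C = [U_inf]"
| "irr_max_heavy GL_H = [Sp_inf]"
| "irr_max_heavy U_inf_inf = [U_inf, U_inf]"
| "irr_max_heavy Sp_2inf_R = [U_inf]"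
| "irr_max_heavy Sp_2inf_C = [Sp_inf]"
| "irr_max_heavy Sp_inf_inf = [Sp_inf, Sp_inf]"
| "irr_max_heavy O_inf_inf = [O_inf, O_inf]"
| "irr_max_heavy O_inf_C = [O_inf]"
| "irr_max_heavy SO_star = [U_inf]"
| "irr_max_heavy (U_fin_inf p) = [U_inf]"
| "irr_max_heavy (O_fin_inf p) = [O_inf]"
| "irr_max_heavy (Sp_fin_inf p) = [Sp_inf]"

definition interleave_blocks :: "(nat \<Rightarrow> mat) \<Rightarrow> mat" where
  "interleave_blocks k = block_diag 2 (\<lambda>j r. 2 * r + j) k"

definition shift_block :: "nat \<Rightarrow> (nat \<Rightarrow> mat) \<Rightarrow> mat" where
  "shift_block p k = block_diag 1 (\<lambda>_ r. r + p) k"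

text \<open>The inclusion of the maximal heavy subgroup; \<open>k 0\<close> (and \<open>k 1\<close>) are the components of its argument.\<close>

primrec irr_max_heavy_incl :: "classical \<Rightarrow> (nat \<Rightarrow> mat) \<Rightarrow> mat" where
  "irr_max_heavy_incl GL_R k = k 0"
| "irr_max_heavy_incl GL_C k = k 0"
| "irr_max_heavy_incl GL_H k = k 0"
| "irr_max_heavy_incl U_inf_inf k = interleave_blocks k"
| "irr_max_heavy_incl Sp_2inf_R k = realify 2 (k 0)"
| "irr_max_heavy_incl Sp_2inf_C k = complexify (k 0)"
| "irr_max_heavy_incl Sp_inf_inf k = interleave_blocks k"
| "irr_max_heavy_incl O_inf_inf k = interleave_blocks k"
| "irr_max_heavy_incl O_inf_C k = k 0"
| "irr_max_heavy_incl SO_star k = k 0"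
| "irr_max_heavy_incl (U_fin_inf p) k = shift_block p k"
| "irr_max_heavy_incl (O_fin_inf p) k = shift_block p k"
| "irr_max_heavy_incl (Sp_fin_inf p) k = shift_block p k"

definition max_heavy :: "classical list \<Rightarrow> heavy list" where
  "max_heavy G = concat (map irr_max_heavy G)"

definition max_heavy_incl :: "classical list \<Rightarrow> (nat \<Rightarrow> mat) \<Rightarrow> (nat \<Rightarrow> mat)" where
  \<comment> \<open>The components of \<open>k\<close> belonging to the \<open>i\<close>-th factor start at position
     \<open>length (max_heavy (take i G))\<close>.\<close>
  "max_heavy_incl G k =
     (\<lambda>i\<in>{..<length G}.
        irr_max_heavy_incl (G ! i) (\<lambda>r. k (length (max_heavy (take i G)) + r)))"


section \<open>Straight homomorphisms and \<open>(G,L)\<close>-pairs\<close>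

text \<open>
  As real and complex matrices are particular quaternionic ones, \<open>O(\<infinity>) \<rightarrow> U(\<infinity>)\<close>,
  \<open>O(\<infinity>) \<rightarrow> Sp(\<infinity>)\<close> and \<open>U(\<infinity>) \<rightarrow> Sp(\<infinity>)\<close> are given by \<^const>\<open>id\<close>.
\<close>

fun trivial_homs :: "heavy \<Rightarrow> heavy \<Rightarrow> (mat \<Rightarrow> mat) set" where
  "trivial_homs O_inf O_inf = {id}"
| "trivial_homs O_inf U_inf = {id}"
| "trivial_homs O_inf Sp_inf = {id}"
| "trivial_homs U_inf O_inf = {realify 2}"
| "trivial_homs U_inf U_inf = {id, mat_cnj}"
| "trivial_homs U_inf Sp_inf = {id}"
| "trivial_homs Sp_inf O_inf = {realify 4}"
| "trivial_homs Sp_inf U_inf = {complexify}"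
| "trivial_homs Sp_inf Sp_inf = {id}"

definition straight_hom_irr :: "heavy list \<Rightarrow> heavy \<Rightarrow> ((nat \<Rightarrow> mat) \<Rightarrow> mat) \<Rightarrow> bool" where
  "straight_hom_irr L h \<sigma> \<longleftrightarrow>
     (\<exists>N \<beta> m \<tau>. 0 < N \<and> disjoint_blocks N \<beta> \<and>
        (\<forall>j<N. m j < length L \<and> \<tau> j \<in> trivial_homs (L ! m j) h) \<and>
        (\<forall>g\<in>carrier (heavy_group L). \<sigma> g = block_diag N \<beta> (\<lambda>j. \<tau> j (g (m j)))))"

definition straight_hom :: "heavy list \<Rightarrow> heavy list \<Rightarrow> ((nat \<Rightarrow> mat) \<Rightarrow> nat \<Rightarrow> mat) \<Rightarrow> bool" where
  "straight_hom L K \<sigma> \<longleftrightarrow>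
     (\<forall>i<length K. straight_hom_irr L (K ! i) (\<lambda>g. \<sigma> g i)) \<and>
     (\<forall>g\<in>carrier (heavy_group L). \<sigma> g \<in> extensional {..<length K})"

text \<open>\<open>L\<close> is embedded in the maximal heavy subgroup, so the straight homomorphism is injective.\<close>

definition GL_pair :: "classical list \<Rightarrow> heavy list \<Rightarrow> ((nat \<Rightarrow> mat) \<Rightarrow> nat \<Rightarrow> mat) \<Rightarrow> bool" where
  "GL_pair G L \<sigma> \<longleftrightarrow>
     straight_hom L (max_heavy G) \<sigma> \<and> inj_on \<sigma> (carrier (heavy_group L))"

definition pair_incl ::
  "classical list \<Rightarrow> ((nat \<Rightarrow> mat) \<Rightarrow> nat \<Rightarrow> mat) \<Rightarrow> (nat \<Rightarrow> mat) \<Rightarrow> (nat \<Rightarrow> mat)" where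
  "pair_incl G \<sigma> l = max_heavy_incl G (\<sigma> l)"


section \<open>The mantle\<close>

definition heavy_stabilizer :: "heavy list \<Rightarrow> (nat \<Rightarrow> nat set) \<Rightarrow> (nat \<Rightarrow> mat) set" where
  "heavy_stabilizer L \<Xi> =
     {l \<in> carrier (heavy_group L).
        \<forall>j<length L. \<forall>\<xi>\<in>\<Xi> j. mat_vec (l j) (basis_vec \<xi>) = basis_vec \<xi>}"

definition block_swap :: "(nat \<Rightarrow> nat) \<Rightarrow> nat \<Rightarrow> nat \<Rightarrow> nat" where
  "block_swap \<omega> m x =
     (if x \<in> \<omega> ` {1..m} then \<omega> (m + inv_into {1..} \<omega> x)
      else if x \<in> \<omega> ` {m+1..2*m} then \<omega> (inv_into {1..} \<omega> x - m)
      else x)"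

definition perm_mat :: "(nat \<Rightarrow> nat) \<Rightarrow> mat" where
  "perm_mat s = (\<lambda>x y. if x = s y then 1 else 0)"

definition Theta :: "heavy list \<Rightarrow> (nat \<Rightarrow> nat \<Rightarrow> nat) \<Rightarrow> (nat \<Rightarrow> nat) \<Rightarrow> (nat \<Rightarrow> mat)" where
  "Theta L \<omega> m = (\<lambda>j\<in>{..<length L}. perm_mat (block_swap (\<omega> j) (m j)))"

text \<open>The filter of multi-indices \<open>m = (m\<^sub>0, \<dots>, m\<^sub>p\<^sub>-\<^sub>1)\<close> all of whose entries tend to infinity.\<close>

definition multi_at_top :: "nat \<Rightarrow> (nat \<Rightarrow> nat) filter" where
  "multi_at_top p = (INF j\<in>{..<p}. filtercomap (\<lambda>m. m j) at_top)"

definition double_coset :: "('a, 'b) monoid_scheme \<Rightarrow> 'a set \<Rightarrow> 'a \<Rightarrow> 'a set" where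
  "double_coset G H g = H <#>\<^bsub>G\<^esub> (g <#\<^bsub>G\<^esub> H)"

definition mantle_dcoset ::
  "classical list \<Rightarrow> heavy list \<Rightarrow> ((nat \<Rightarrow> mat) \<Rightarrow> nat \<Rightarrow> mat) \<Rightarrow> (nat \<Rightarrow> nat set) \<Rightarrow>
   (nat \<Rightarrow> mat) \<Rightarrow> (nat \<Rightarrow> mat) set" where
  "mantle_dcoset G L \<sigma> \<Xi> = double_coset (classical_group G) (pair_incl G \<sigma> ` heavy_stabilizer L \<Xi>)"

definition mantle ::
  "classical list \<Rightarrow> heavy list \<Rightarrow> ((nat \<Rightarrow> mat) \<Rightarrow> nat \<Rightarrow> mat) \<Rightarrow> (nat \<Rightarrow> nat set) \<Rightarrow>
   (nat \<Rightarrow> mat) set set" where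
  "mantle G L \<sigma> \<Xi> = mantle_dcoset G L \<sigma> \<Xi> ` carrier (classical_group G)"

definition eventual_dcoset ::
  "classical list \<Rightarrow> heavy list \<Rightarrow> ((nat \<Rightarrow> mat) \<Rightarrow> nat \<Rightarrow> mat) \<Rightarrow> (nat \<Rightarrow> nat set) \<Rightarrow>
   (nat \<Rightarrow> nat \<Rightarrow> nat) \<Rightarrow> (nat \<Rightarrow> mat) \<Rightarrow> (nat \<Rightarrow> mat) \<Rightarrow> (nat \<Rightarrow> mat) set \<Rightarrow> bool" where
  "eventual_dcoset G L \<sigma> \<Xi> \<omega> g h \<kk> \<longleftrightarrow>
     (\<forall>\<^sub>F m in multi_at_top (length L).
        mantle_dcoset G L \<sigma> \<Xi>
          (g \<otimes>\<^bsub>classical_group G\<^esub> pair_incl G \<sigma> (Theta L \<omega> m) \<otimes>\<^bsub>classical_group G\<^esub> h) = \<kk>)"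

definition mantle_mult ::
  "classical list \<Rightarrow> heavy list \<Rightarrow> ((nat \<Rightarrow> mat) \<Rightarrow> nat \<Rightarrow> mat) \<Rightarrow> (nat \<Rightarrow> nat set) \<Rightarrow>
   (nat \<Rightarrow> nat \<Rightarrow> nat) \<Rightarrow> (nat \<Rightarrow> mat) set \<Rightarrow> (nat \<Rightarrow> mat) set \<Rightarrow> (nat \<Rightarrow> mat) set" where
  "mantle_mult G L \<sigma> \<Xi> \<omega> \<gg> \<hh> =
     (THE \<kk>. \<forall>g\<in>\<gg>. \<forall>h\<in>\<hh>. eventual_dcoset G L \<sigma> \<Xi> \<omega> g h \<kk>)"


section \<open>Unitary representations\<close>

text \<open>Complex Hilbert spaces; the scalar product is linear in its first argument.\<close>

class complex_hilbert_space = real_inner + complete_space +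
  fixes scaleC :: "complex \<Rightarrow> 'a \<Rightarrow> 'a"
    and cinner :: "'a \<Rightarrow> 'a \<Rightarrow> complex"
  assumes scaleC_add_right: "scaleC a (x + y) = scaleC a x + scaleC a y"
    and scaleC_add_left: "scaleC (a + b) x = scaleC a x + scaleC b x"
    and scaleC_scaleC: "scaleC a (scaleC b x) = scaleC (a * b) x"
    and scaleC_of_real: "scaleC (complex_of_real r) x = r *\<^sub>R x"
    and cinner_commute: "cinner x y = cnj (cinner y x)"
    and cinner_add_left: "cinner (x + y) z = cinner x z + cinner y z"
    and cinner_scaleC_left: "cinner (scaleC a x) y = a * cinner x y"
    and Re_cinner: "Re (cinner x y) = inner x y"

instantiation complex :: complex_hilbert_space
begin

definition "scaleC a x = a * x" for a x :: complex
definition "cinner x y = x * cnj y" for x y :: complex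

instance
  by standard
    (auto simp: scaleC_complex_def cinner_complex_def inner_complex_def algebra_simps
      scaleR_conv_of_real)

end

definition clinear_on :: "'h::complex_hilbert_space set \<Rightarrow> ('h \<Rightarrow> 'h) \<Rightarrow> bool" where
  "clinear_on V T \<longleftrightarrow>
     (\<forall>x\<in>V. \<forall>y\<in>V. T (x + y) = T x + T y) \<and> (\<forall>a. \<forall>x\<in>V. T (scaleC a x) = scaleC a (T x))"

definition unitary_group :: "('h::complex_hilbert_space \<Rightarrow> 'h) monoid" where
  "unitary_group =
     \<lparr>carrier = {U. clinear_on UNIV U \<and> surj U \<and> (\<forall>x y. cinner (U x) (U y) = cinner x y)},
      monoid.mult = (\<circ>), one = id\<rparr>"

definition pair_unitary_rep ::
  "classical list \<Rightarrow> heavy list \<Rightarrow> ((nat \<Rightarrow> mat) \<Rightarrow> nat \<Rightarrow> mat) \<Rightarrow>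
   ((nat \<Rightarrow> mat) \<Rightarrow> 'h::complex_hilbert_space \<Rightarrow> 'h) \<Rightarrow> bool" where
  \<comment> \<open>The unitary group carries the weak operator topology (on it, the same as the strong one).\<close>
  "pair_unitary_rep G L \<sigma> \<rho> \<longleftrightarrow>
     \<rho> \<in> hom (classical_group G) unitary_group \<and>
     (\<forall>v w. continuous_map (heavy_topology L) euclidean (\<lambda>l. cinner (\<rho> (pair_incl G \<sigma> l) v) w))"

definition fixed_space ::
  "classical list \<Rightarrow> heavy list \<Rightarrow> ((nat \<Rightarrow> mat) \<Rightarrow> nat \<Rightarrow> mat) \<Rightarrow> (nat \<Rightarrow> nat set) \<Rightarrow>
   ((nat \<Rightarrow> mat) \<Rightarrow> 'h::complex_hilbert_space \<Rightarrow> 'h) \<Rightarrow> 'h set" where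
  "fixed_space G L \<sigma> \<Xi> \<rho> = {v. \<forall>l\<in>heavy_stabilizer L \<Xi>. \<rho> (pair_incl G \<sigma> l) v = v}"

definition orth_projection :: "'h::complex_hilbert_space set \<Rightarrow> 'h \<Rightarrow> 'h" where
  "orth_projection V v = (THE w. w \<in> V \<and> (\<forall>u\<in>V. cinner (v - w) u = 0))"

definition rho_bar ::
  "classical list \<Rightarrow> heavy list \<Rightarrow> ((nat \<Rightarrow> mat) \<Rightarrow> nat \<Rightarrow> mat) \<Rightarrow> (nat \<Rightarrow> nat set) \<Rightarrow>
   ((nat \<Rightarrow> mat) \<Rightarrow> 'h::complex_hilbert_space \<Rightarrow> 'h) \<Rightarrow> (nat \<Rightarrow> mat) \<Rightarrow> 'h \<Rightarrow> 'h" where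
  "rho_bar G L \<sigma> \<Xi> \<rho> g =
     (let V = fixed_space G L \<sigma> \<Xi> \<rho> in (\<lambda>v\<in>V. orth_projection V (\<rho> g v)))"

definition rho_bar_dcoset ::
  "classical list \<Rightarrow> heavy list \<Rightarrow> ((nat \<Rightarrow> mat) \<Rightarrow> nat \<Rightarrow> mat) \<Rightarrow> (nat \<Rightarrow> nat set) \<Rightarrow>
   ((nat \<Rightarrow> mat) \<Rightarrow> 'h::complex_hilbert_space \<Rightarrow> 'h) \<Rightarrow> (nat \<Rightarrow> mat) set \<Rightarrow> 'h \<Rightarrow> 'h" where
  "rho_bar_dcoset G L \<sigma> \<Xi> \<rho> \<gg> = (THE T. \<forall>g\<in>\<gg>. rho_bar G L \<sigma> \<Xi> \<rho> g = T)"


section \<open>Semigroups and their representations\<close>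

definition is_semigroup :: "'s set \<Rightarrow> ('s \<Rightarrow> 's \<Rightarrow> 's) \<Rightarrow> bool" where
  "is_semigroup S f \<longleftrightarrow>
     (\<forall>a\<in>S. \<forall>b\<in>S. f a b \<in> S) \<and> (\<forall>a\<in>S. \<forall>b\<in>S. \<forall>c\<in>S. f (f a b) c = f a (f b c))"

definition bounded_operators :: "'h::complex_hilbert_space set \<Rightarrow> ('h \<Rightarrow> 'h) set" where
  "bounded_operators V =
     {T \<in> V \<rightarrow>\<^sub>E V. clinear_on V T \<and> (\<exists>C. \<forall>v\<in>V. norm (T v) \<le> C * norm v)}"

definition semigroup_rep ::
  "'s set \<Rightarrow> ('s \<Rightarrow> 's \<Rightarrow> 's) \<Rightarrow> 'h::complex_hilbert_space set \<Rightarrow> ('s \<Rightarrow> 'h \<Rightarrow> 'h) \<Rightarrow> bool" where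
  "semigroup_rep S f V T \<longleftrightarrow>
     (\<forall>a\<in>S. T a \<in> bounded_operators V) \<and>
     (\<forall>a\<in>S. \<forall>b\<in>S. \<forall>v\<in>V. T (f a b) v = T a (T b v))"

end

theory Submission
  imports Defs
begin

text \<open>
  Write \<open>\<theta>\<^sub>m\<close> for the swap \<open>\<Theta>\<^sub>m\<close> of the statement. Modulo the stabilizer the element \<open>g \<theta>\<^sub>m h\<close> is the
  product of \<open>g\<close> with the conjugate \<open>\<theta>\<^sub>m h \<theta>\<^sub>m\<^sup>-\<^sup>1\<close>, and a straight embedding is local: since \<open>g\<close> and \<open>h\<close> are
  finite matrices, each of them commutes with every element of the stabilizer that moves only basis
  vectors outside some finite set, called here a set on which \<open>g\<close> or \<open>h\<close> is localized. For large \<open>m\<close>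
  the swap carries such a set for \<open>h\<close> off one for \<open>g\<close>. Any two finitary permutations \<open>s\<close> doing this
  differ by permutations that commute with \<open>g\<close> or with \<open>h\<close>, hence all of them produce the same double
  coset of \<open>g (s h s\<^sup>-\<^sup>1)\<close> (\<open>dc_cj_indep\<close>). So the sequence of double cosets is eventually constant; a change of
  representatives inserts stabilizer elements that can be commuted to the outside (\<open>eventually_dc\<close>),
  and associativity follows because both bracketings are the double coset of a product of three
  conjugates localized on pairwise disjoint sets (\<open>mantle_semigroup\<close>). This part is carried out in the locale
  \<open>mantle_group\<close>, for an abstract group with a family of stabilizers.

  For a unitary representation, conjugates of a stabilizer element by \<open>\<theta>\<^sub>m\<close> tend to the identity in the
  weak operator topology, because they act on basis vectors that escape to infinity
  (\<open>theta_conj_limit\<close>). As in the mean ergodic theorem, the orthogonal complement of the fixed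
  vectors is the closed span of the differences \<open>\<rho> k x - x\<close>, on which the operators of \<open>\<theta>\<^sub>m\<close> tend weakly
  to zero; so they converge weakly to the orthogonal projection \<open>P\<close> onto the fixed vectors (\<open>weak_limit\<close>). The matrix
  elements of \<open>P \<rho> (g \<theta>\<^sub>m h)\<close> on fixed vectors are eventually constant and converge to those of
  \<open>P \<rho> g P \<rho> h\<close>, which is multiplicativity (\<open>compression_mantle_prod\<close>).

  It remains to see that classical groups fit the abstract setting. All straight homomorphisms and
  all inclusions of maximal heavy subgroups are composed of two operations on matrices,
  replacing entries by blocks (\<open>expand\<close>) and block-diagonal sums, both of which preserve products,
  adjoints and locality (\<open>matrix_rep_expand\<close>, \<open>matrix_rep_block_diag\<close>); the images preserve the defining
  forms of the classical groups (\<open>max_heavy_incl_rep\<close>).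
\<close>

section \<open>Finitary colour-preserving permutations\<close>

text \<open>The colour separates the spaces on which the factors of a heavy group act: admissible
  permutations may not mix basis vectors of different spaces.\<close>

definition fin_perms :: "('x \<Rightarrow> 'c) \<Rightarrow> 'x set \<Rightarrow> ('x \<Rightarrow> 'x) set" where
  "fin_perms c X = {s. bij s \<and> finite {x. s x \<noteq> x} \<and> (\<forall>x. x \<notin> X \<longrightarrow> s x = x) \<and> (\<forall>x. c (s x) = c x)}"

lemma fin_perms_id: "id \<in> fin_perms c X"
  by (simp add: fin_perms_def)

lemma fin_perms_comp:
  assumes "s \<in> fin_perms c X" "t \<in> fin_perms c X"
  shows "s \<circ> t \<in> fin_perms c X"
proof -
  have "{x. (s \<circ> t) x \<noteq> x} \<subseteq> {x. s x \<noteq> x} \<union> {x. t x \<noteq> x}" by auto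
  then have "finite {x. (s \<circ> t) x \<noteq> x}"
    using assms unfolding fin_perms_def by (auto intro: finite_subset)
  then show ?thesis
    using assms by (auto simp: fin_perms_def bij_comp)
qed

lemma fin_perms_inv:
  assumes "s \<in> fin_perms c X"
  shows "inv_into UNIV s \<in> fin_perms c X"
proof -
  let ?i = "inv_into UNIV s"
  have b: "bij s" using assms by (simp add: fin_perms_def)
  have fi: "s (?i x) = x" for x by (simp add: b bij_is_surj surj_f_inv_f)
  have eq: "?i x = x \<longleftrightarrow> s x = x" for x
    by (metis b bij_inv_eq_iff)
  have "c (?i x) = c x" for x
  proof -
    have "c (s (?i x)) = c (?i x)" using assms by (simp add: fin_perms_def)
    then show ?thesis by (simp add: fi)
  qed
  then show ?thesis
    using assms by (simp add: fin_perms_def bij_imp_bij_inv eq)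
qed

lemma fin_perms_transpose:
  assumes "x \<in> X" "y \<in> X" "c x = c y"
  shows "Transposition.transpose x y \<in> fin_perms c X"
proof -
  have "{z. Transposition.transpose x y z \<noteq> z} \<subseteq> {x, y}"
    by (auto simp: Transposition.transpose_def)
  then have "finite {z. Transposition.transpose x y z \<noteq> z}"
    by (rule finite_subset) simp
  then show ?thesis
    using assms by (auto simp: fin_perms_def Transposition.transpose_def)
qed

lemma fin_perms_maps:
  assumes "s \<in> fin_perms c X" "x \<in> X"
  shows "s x \<in> X"
proof (rule ccontr)
  assume "s x \<notin> X"
  then have "s (s x) = s x" using assms by (auto simp: fin_perms_def)
  moreover have "inj s" using assms by (auto simp: fin_perms_def bij_is_inj)
  ultimately show False using assms \<open>s x \<notin> X\<close> by (metis injD)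
qed

text \<open>Points are moved one at a time: each step composes with a transposition, which disturbs
  neither \<open>E\<close> nor the points that are already in place.\<close>

lemma fin_perms_match:
  assumes s: "s \<in> fin_perms c X" and t: "t \<in> fin_perms c X"
    and F: "finite F" "F \<subseteq> X" and "s ` F \<inter> E = {}" "t ` F \<inter> E = {}"
  obtains u where "u \<in> fin_perms c X" "\<And>x. x \<in> E \<Longrightarrow> u x = x" "\<And>x. x \<in> F \<Longrightarrow> u (s x) = t x"
proof -
  have "\<exists>u\<in>fin_perms c X. (\<forall>x\<in>E. u x = x) \<and> (\<forall>x\<in>F. u (s x) = t x)"
    using F assms(5,6)
  proof (induction F rule: finite_induct)
    case empty
    then show ?case using bexI[OF _ fin_perms_id[of c X], of "\<lambda>u. (\<forall>x\<in>E. u x = x) \<and> (\<forall>x\<in>{}. u (s x) = t x)"] by simp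
  next
    case (insert x F)
    then obtain u where u: "u \<in> fin_perms c X" "\<forall>x\<in>E. u x = x" "\<forall>x\<in>F. u (s x) = t x"
      by auto
    let ?y = "u (s x)" and ?z = "t x"
    let ?u = "Transposition.transpose ?y ?z \<circ> u"
    have inj: "inj u" "inj s" "inj t"
      using u s t by (auto simp: fin_perms_def bij_is_inj)
    have yE: "?y \<notin> E"
    proof
      assume "?y \<in> E"
      then have "u ?y = ?y" using u by auto
      then have "?y = s x" using inj by (auto dest: injD)
      then show False using \<open>?y \<in> E\<close> insert.prems by auto
    qed
    have zE: "?z \<notin> E" using insert.prems by auto
    have cx: "c ?y = c ?z" using s t u by (simp add: fin_perms_def)
    have X: "?y \<in> X" "?z \<in> X"
      using insert.prems fin_perms_maps[OF s] fin_perms_maps[OF t] fin_perms_maps[OF u(1)] by simp_all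
    have 1: "?u \<in> fin_perms c X"
      by (intro fin_perms_comp fin_perms_transpose X cx u)
    have 2: "\<forall>x\<in>E. ?u x = x"
      using u yE zE by (auto simp: Transposition.transpose_def)
    have 3: "?u (s w) = t w" if "w \<in> F" for w
    proof -
      have "w \<noteq> x" using that insert.hyps by auto
      then have "t w \<noteq> ?z" "u (s w) \<noteq> ?y" using inj by (auto dest: injD)
      then show ?thesis using u(3) that by (auto simp: Transposition.transpose_def)
    qed
    have 4: "?u (s x) = t x" by simp
    show ?case by (rule bexI[OF _ 1]) (use 2 3 4 in auto)
  qed
  then show ?thesis using that by auto
qed

section \<open>Double cosets of a group with asymptotically commuting subgroups\<close>

text \<open>\<open>X\<close> is the set of all movable basis vectors, \<open>H\<close> the image
  of the stabilizer, \<open>K F\<close> the image of its subgroup that fixes in addition the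
  points of \<open>F\<close>, and \<open>\<pi>\<close> sends a permutation to its matrix. The two
  existence axioms express that all elements are finite matrices.\<close>

locale mantle_group = group G for G (structure) +
  fixes H :: "'a set" and colour :: "'x \<Rightarrow> 'c" and X :: "'x set"
    and \<pi> :: "('x \<Rightarrow> 'x) \<Rightarrow> 'a" and K :: "'x set \<Rightarrow> 'a set"
    and \<theta> :: "'i \<Rightarrow> 'x \<Rightarrow> 'x" and Fl :: "'i filter"
  assumes H: "subgroup H G"
    and Fl: "Fl \<noteq> bot"
    and K_sub: "K F \<subseteq> H"
    and K_ex: "k \<in> H \<Longrightarrow> \<exists>E. finite E \<and> E \<subseteq> X \<and> (\<forall>F. F \<inter> E = {} \<longrightarrow> k \<in> K F)"
    and localized_ex: "g \<in> carrier G \<Longrightarrow> \<exists>F. finite F \<and> F \<subseteq> X \<and> (\<forall>k\<in>K F. k \<otimes> g = g \<otimes> k)"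
    and K_anti: "F \<subseteq> F' \<Longrightarrow> K F' \<subseteq> K F"
    and \<pi>_H: "s \<in> fin_perms colour X \<Longrightarrow> \<pi> s \<in> H"
    and \<pi>_mult: "s \<in> fin_perms colour X \<Longrightarrow> t \<in> fin_perms colour X \<Longrightarrow> \<pi> (s \<circ> t) = \<pi> s \<otimes> \<pi> t"
    and \<pi>_K: "s \<in> fin_perms colour X \<Longrightarrow> k \<in> K F \<Longrightarrow> \<pi> s \<otimes> k \<otimes> inv (\<pi> s) \<in> K (s ` F)"
    and \<pi>_in_K: "s \<in> fin_perms colour X \<Longrightarrow> (\<And>x. x \<in> F \<Longrightarrow> s x = x) \<Longrightarrow> \<pi> s \<in> K F"
    and \<theta>: "\<theta> i \<in> fin_perms colour X"
    and \<theta>_ev: "finite F \<Longrightarrow> F \<subseteq> X \<Longrightarrow> \<forall>\<^sub>F i in Fl. \<theta> i ` F \<inter> F = {}"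
begin

abbreviation "S \<equiv> fin_perms colour X"

abbreviation dc :: "'a \<Rightarrow> 'a set" where "dc \<equiv> double_coset G H"

definition cj :: "('x \<Rightarrow> 'x) \<Rightarrow> 'a \<Rightarrow> 'a" where
  "cj s g = \<pi> s \<otimes> g \<otimes> inv (\<pi> s)"

definition localized :: "'x set \<Rightarrow> 'a \<Rightarrow> bool" where
  "localized F g \<longleftrightarrow> g \<in> carrier G \<and> finite F \<and> F \<subseteq> X \<and> (\<forall>k\<in>K F. k \<otimes> g = g \<otimes> k)"

lemma H_carrier [simp, intro]: "a \<in> H \<Longrightarrow> a \<in> carrier G"
  using H subgroup.subset by blast

lemma \<pi>_carrier [simp, intro]: "s \<in> S \<Longrightarrow> \<pi> s \<in> carrier G"
  using \<pi>_H by blast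

lemma K_carrier: "k \<in> K F \<Longrightarrow> k \<in> carrier G"
  using K_sub by blast

lemma H_mult: "a \<in> H \<Longrightarrow> b \<in> H \<Longrightarrow> a \<otimes> b \<in> H"
  using H by (rule subgroup.m_closed)

lemma H_inv: "a \<in> H \<Longrightarrow> inv a \<in> H"
  using H by (rule subgroup.m_inv_closed)

lemma cj_carrier [simp, intro]: "s \<in> S \<Longrightarrow> g \<in> carrier G \<Longrightarrow> cj s g \<in> carrier G"
  by (simp add: cj_def)

lemma cj_mult:
  assumes "s \<in> S" "g \<in> carrier G" "h \<in> carrier G"
  shows "cj s (g \<otimes> h) = cj s g \<otimes> cj s h"
proof -
  have "cj s g \<otimes> cj s h = \<pi> s \<otimes> g \<otimes> (inv (\<pi> s) \<otimes> \<pi> s) \<otimes> h \<otimes> inv (\<pi> s)"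
    unfolding cj_def using assms by (simp only: m_assoc m_closed inv_closed \<pi>_carrier)
  also have "\<dots> = cj s (g \<otimes> h)" unfolding cj_def using assms by (simp add: m_assoc)
  finally show ?thesis ..
qed

lemma cj_comp:
  assumes "s \<in> S" "t \<in> S" "g \<in> carrier G"
  shows "cj (s \<circ> t) g = cj s (cj t g)"
  unfolding cj_def using assms by (simp add: \<pi>_mult m_assoc inv_mult_group)

lemma cj_eq_iff: "s \<in> S \<Longrightarrow> g \<in> carrier G \<Longrightarrow> \<pi> s \<otimes> g = g \<otimes> \<pi> s \<Longrightarrow> cj s g = g"
  by (simp add: cj_def m_assoc)

lemma \<pi>_id: "\<pi> id = \<one>"
  using \<pi>_mult[of id id] \<pi>_carrier[of id] fin_perms_id[of colour X]
  by (metis comp_id l_cancel_one')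

lemma cj_inv_cancel:
  assumes "s \<in> S" "g \<in> carrier G"
  shows "cj s (cj (inv_into UNIV s) g) = g"
proof -
  have "s \<circ> inv_into UNIV s = id"
    using assms by (auto simp: fin_perms_def bij_is_surj surj_f_inv_f fun_eq_iff)
  then show ?thesis
    using assms cj_comp[OF assms(1) fin_perms_inv[OF assms(1)] assms(2)]
    by (simp add: cj_def \<pi>_id)
qed

lemma cj_H: "s \<in> S \<Longrightarrow> k \<in> H \<Longrightarrow> cj s k \<in> H"
  by (simp add: cj_def H_mult H_inv \<pi>_H)

lemma cj_K: "s \<in> S \<Longrightarrow> k \<in> K F \<Longrightarrow> cj s k \<in> K (s ` F)"
  by (simp add: cj_def \<pi>_K)

lemma localized_cj:
  assumes "localized F g" "s \<in> S"
  shows "localized (s ` F) (cj s g)"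
proof -
  have g: "g \<in> carrier G" using assms by (simp add: localized_def)
  have "k \<otimes> cj s g = cj s g \<otimes> k" if k: "k \<in> K (s ` F)" for k
  proof -
    let ?i = "inv_into UNIV s"
    have i: "?i \<in> S" using assms by (simp add: fin_perms_inv)
    have "?i ` s ` F = F" using assms by (simp add: fin_perms_def bij_is_inj image_comp)
    then have "cj ?i k \<in> K F" using cj_K[OF i k] by simp
    then have "cj ?i k \<otimes> g = g \<otimes> cj ?i k" using assms by (simp add: localized_def)
    then have "cj s (cj ?i k) \<otimes> cj s g = cj s g \<otimes> cj s (cj ?i k)"
      by (metis assms(2) cj_carrier cj_mult g i k K_carrier)
    then show ?thesis by (simp add: cj_inv_cancel assms K_carrier[OF k])
  qed
  moreover have "s ` F \<subseteq> X" using assms fin_perms_maps by (fastforce simp: localized_def)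
  ultimately show ?thesis using assms by (simp add: localized_def)
qed

lemma localized_mult:
  assumes "localized E g" "localized F h"
  shows "localized (E \<union> F) (g \<otimes> h)"
proof -
  have c: "g \<in> carrier G" "h \<in> carrier G" using assms by (simp_all add: localized_def)
  have "k \<otimes> (g \<otimes> h) = (g \<otimes> h) \<otimes> k" if "k \<in> K (E \<union> F)" for k
  proof -
    have "k \<in> K E" "k \<in> K F" using that K_anti by blast+
    then have "k \<otimes> g = g \<otimes> k" "k \<otimes> h = h \<otimes> k" using assms by (auto simp: localized_def)
    then show ?thesis using c K_carrier[OF that] by (metis m_assoc)
  qed
  then show ?thesis using assms by (simp add: localized_def)
qed

lemma localized_mono: "localized E g \<Longrightarrow> E \<subseteq> F \<Longrightarrow> finite F \<Longrightarrow> F \<subseteq> X \<Longrightarrow> localized F g"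
  unfolding localized_def using K_anti by blast

lemma localized_Un:
  assumes "localized E g" "localized F h"
  shows "localized (E \<union> F) g" "localized (E \<union> F) h"
  by (rule localized_mono[OF assms(1)] localized_mono[OF assms(2)]; use assms in \<open>auto simp: localized_def\<close>)+

lemma obtain_localized:
  assumes "g \<in> carrier G" obtains F where "localized F g"
  using localized_ex[OF assms] assms unfolding localized_def by blast

lemma dc_iff: "x \<in> dc g \<longleftrightarrow> (\<exists>a\<in>H. \<exists>b\<in>H. x = a \<otimes> (g \<otimes> b))"
  by (auto simp: double_coset_def set_mult_def l_coset_def)

lemma dc_translate:
  assumes "a \<in> H" "b \<in> H" "g \<in> carrier G"
  shows "dc (a \<otimes> g \<otimes> b) = dc g"
proof -
  have sub: "dc (a \<otimes> g \<otimes> b) \<subseteq> dc g" if "a \<in> H" "b \<in> H" "g \<in> carrier G" for a b g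
  proof
    fix x assume "x \<in> dc (a \<otimes> g \<otimes> b)"
    then obtain c d where "c \<in> H" "d \<in> H" "x = c \<otimes> ((a \<otimes> g \<otimes> b) \<otimes> d)" by (auto simp: dc_iff)
    then have "x = (c \<otimes> a) \<otimes> (g \<otimes> (b \<otimes> d))" "c \<otimes> a \<in> H" "b \<otimes> d \<in> H"
      using that by (simp_all add: m_assoc H_mult)
    then show "x \<in> dc g" unfolding dc_iff by blast
  qed
  have "inv a \<otimes> (a \<otimes> g \<otimes> b) \<otimes> inv b = (inv a \<otimes> a) \<otimes> g \<otimes> (b \<otimes> inv b)"
    using assms by (simp only: m_assoc H_carrier m_closed inv_closed)
  then have "g = inv a \<otimes> (a \<otimes> g \<otimes> b) \<otimes> inv b" using assms by simp
  then have "dc g \<subseteq> dc (a \<otimes> g \<otimes> b)"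
    using sub[of "inv a" "inv b" "a \<otimes> g \<otimes> b"] assms by (simp add: H_inv)
  with sub[OF assms] show ?thesis by blast
qed

lemma one_H: "\<one> \<in> H"
  using H by (rule subgroup.one_closed)

lemma dc_right: "b \<in> H \<Longrightarrow> g \<in> carrier G \<Longrightarrow> dc (g \<otimes> b) = dc g"
  using dc_translate[of \<one> b g] one_H by simp

lemma dc_self: "g \<in> carrier G \<Longrightarrow> g \<in> dc g"
  unfolding dc_iff using one_H by (metis l_one r_one)

text \<open>Some permutation \<open>u\<close> fixes \<open>E\<close> pointwise and agrees with \<open>t s\<^sup>-\<^sup>1\<close> on \<open>s ` F\<close>. It commutes with
  \<open>g\<close>, and \<open>t\<^sup>-\<^sup>1 u s\<close> commutes with \<open>h\<close>, so conjugation by \<open>u\<close> turns one product into the other.\<close>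

lemma dc_cj_indep:
  assumes g: "localized E g" and h: "localized F h" and st: "s \<in> S" "t \<in> S"
    and dis: "s ` F \<inter> E = {}" "t ` F \<inter> E = {}"
  shows "dc (g \<otimes> cj s h) = dc (g \<otimes> cj t h)"
proof -
  have c: "g \<in> carrier G" "h \<in> carrier G" using g h by (simp_all add: localized_def)
  have F: "finite F" "F \<subseteq> X" using h by (simp_all add: localized_def)
  obtain u where u: "u \<in> S" "\<And>x. x \<in> E \<Longrightarrow> u x = x" "\<And>x. x \<in> F \<Longrightarrow> u (s x) = t x"
    using fin_perms_match[OF st F dis] by blast
  have gu: "cj u g = g"
    using \<pi>_in_K[of u E] u g c by (intro cj_eq_iff) (auto simp: localized_def)
  let ?i = "inv_into UNIV t" 
  let ?v = "?i \<circ> (u \<circ> s)"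
  have i: "?i \<in> S" by (rule fin_perms_inv[OF st(2)])
  have v: "?v \<in> S" by (intro fin_perms_comp i u st)
  have "?v x = x" if "x \<in> F" for x
    using st(2) u(3)[OF that] by (simp add: fin_perms_def bij_is_inj)
  then have "\<pi> ?v \<in> K F" using \<pi>_in_K[OF v] by blast
  then have hv: "cj ?v h = h" using h c v by (intro cj_eq_iff) (auto simp: localized_def)
  have "cj u (cj s h) = cj (u \<circ> s) h" by (simp add: cj_comp u st c)
  also have "\<dots> = cj t (cj ?i (cj (u \<circ> s) h))"
    using cj_inv_cancel[OF st(2), of "cj (u \<circ> s) h"] u st c by (simp add: fin_perms_comp)
  also have "\<dots> = cj t h"
    using hv cj_comp[OF i fin_perms_comp[OF u(1) st(1)] c(2)] by simp
  finally have "g \<otimes> cj t h = cj u (g \<otimes> cj s h)"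
    by (simp add: cj_mult u st c gu)
  then show ?thesis
    unfolding cj_def[of u]
    using u st c by (simp add: dc_translate \<pi>_H H_inv)
qed

text \<open>The swap in the middle of a product may be replaced by a conjugation, since its
  inverse can be supplied on the right by \<open>H\<close>.\<close>

lemma dc_\<pi>:
  assumes "g \<in> carrier G" "h \<in> carrier G" "s \<in> S"
  shows "dc (g \<otimes> \<pi> s \<otimes> h) = dc (g \<otimes> cj s h)"
proof -
  have "(g \<otimes> \<pi> s \<otimes> h) \<otimes> inv (\<pi> s) = g \<otimes> cj s h"
    using assms by (simp add: cj_def m_assoc)
  then show ?thesis
    using dc_right[of "inv (\<pi> s)" "g \<otimes> \<pi> s \<otimes> h"] assms by (simp add: H_inv \<pi>_H)
qed

text \<open>Changing representatives inserts elements \<open>b\<close>, \<open>c\<close> of \<open>H\<close> between \<open>g\<close> and \<open>h\<close>. Once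
  \<open>\<theta> i\<close> carries everything in sight away from itself, the conjugate of \<open>c\<close> commutes with
  \<open>g\<close> and \<open>b\<close>, and \<open>b\<close> commutes with the conjugate of \<open>h\<close>, so both can be moved outside.\<close>

lemma eventually_dc:
  assumes g: "localized E g" and h: "localized F h" and s: "s \<in> S" "s ` F \<inter> E = {}"
    and g': "g' \<in> dc g" and h': "h' \<in> dc h"
  shows "\<forall>\<^sub>F i in Fl. dc (g' \<otimes> \<pi> (\<theta> i) \<otimes> h') = dc (g \<otimes> cj s h)"
proof -
  have gh: "g \<in> carrier G" "h \<in> carrier G" using g h by (simp_all add: localized_def)
  obtain a b where ab: "a \<in> H" "b \<in> H" "g' = a \<otimes> (g \<otimes> b)" using g' by (auto simp: dc_iff)
  obtain c d where cd: "c \<in> H" "d \<in> H" "h' = c \<otimes> (h \<otimes> d)" using h' by (auto simp: dc_iff)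
  obtain B where B: "localized B b" by (rule obtain_localized[OF H_carrier[OF ab(2)]])
  obtain B' where B': "finite B'" "B' \<subseteq> X" "\<And>F. F \<inter> B' = {} \<Longrightarrow> b \<in> K F" using K_ex ab by meson
  obtain C where C: "finite C" "C \<subseteq> X" "\<And>F. F \<inter> C = {} \<Longrightarrow> c \<in> K F" using K_ex cd by meson
  define D where "D = E \<union> F \<union> B \<union> B' \<union> C"
  have D: "finite D" "D \<subseteq> X" using g h B B' C by (auto simp: D_def localized_def)
  show ?thesis
  proof (rule eventually_mono[OF \<theta>_ev[OF D]])
    fix i assume i: "\<theta> i ` D \<inter> D = {}"
    let ?t = "\<theta> i" and ?r = "inv_into UNIV (\<theta> i)"
    have t: "?t \<in> S" by (rule \<theta>)
    have r: "?r \<in> S" by (rule fin_perms_inv[OF t])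
    have bt: "bij ?t" using t by (simp add: fin_perms_def)
    have tr: "?t (?r x) = x" for x by (simp add: bt bij_is_surj surj_f_inv_f)
    have "?r ` (E \<union> B) \<inter> C = {}"
    proof (rule ccontr)
      assume "\<not> ?thesis"
      then obtain x where x: "x \<in> E \<union> B" "?r x \<in> C" by blast
      then have "?t (?r x) \<in> ?t ` D" by (simp add: D_def)
      then have "x \<in> ?t ` D" by (simp only: tr)
      then show False using x i by (auto simp: D_def)
    qed
    then have "cj ?t c \<in> K (?t ` (?r ` (E \<union> B)))" using C(3) cj_K[OF t] by blast
    then have cK: "cj ?t c \<in> K (E \<union> B)" by (simp add: image_comp comp_def tr)
    have cgb: "cj ?t c \<otimes> (g \<otimes> b) = (g \<otimes> b) \<otimes> cj ?t c"
      using localized_mult[OF g B] cK by (simp add: localized_def)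
    have "?t ` F \<inter> B' = {}" using i unfolding D_def by blast
    then have bK: "b \<in> K (?t ` F)" using B'(3) by blast
    have bh: "b \<otimes> cj ?t h = cj ?t h \<otimes> b"
      using localized_cj[OF h t] bK by (simp add: localized_def)
    have cH: "cj ?t c \<in> H" "cj ?t d \<in> H" using cd t by (simp_all add: cj_H)
    have "g' \<otimes> cj ?t h' = a \<otimes> ((g \<otimes> b) \<otimes> cj ?t c) \<otimes> (cj ?t h \<otimes> cj ?t d)"
      using ab cd gh t by (simp add: cj_mult m_assoc)
    also have "\<dots> = (a \<otimes> cj ?t c) \<otimes> (g \<otimes> (b \<otimes> cj ?t h)) \<otimes> cj ?t d"
      unfolding cgb[symmetric] using ab cd gh t by (simp add: m_assoc)
    also have "\<dots> = (a \<otimes> cj ?t c) \<otimes> (g \<otimes> cj ?t h) \<otimes> (b \<otimes> cj ?t d)"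
      unfolding bh using ab cd gh t by (simp add: m_assoc)
    finally have "dc (g' \<otimes> cj ?t h') = dc (g \<otimes> cj ?t h)"
      using ab cH gh t by (simp add: dc_translate H_mult)
    moreover have "?t ` F \<inter> E = {}" using i unfolding D_def by blast
    then have "dc (g \<otimes> cj ?t h) = dc (g \<otimes> cj s h)"
      by (rule dc_cj_indep[OF g h t s(1) _ s(2)])
    moreover have "g' \<in> carrier G" "h' \<in> carrier G" using ab cd gh by simp_all
    then have "dc (g' \<otimes> \<pi> ?t \<otimes> h') = dc (g' \<otimes> cj ?t h')"
      by (rule dc_\<pi>[OF _ _ t])
    ultimately show "dc (g' \<otimes> \<pi> ?t \<otimes> h') = dc (g \<otimes> cj s h)" by (simp only:)
  qed
qed

lemma obtain_shift:
  assumes "finite F" "F \<subseteq> X" obtains s where "s \<in> S" "s ` F \<inter> F = {}"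
  using eventually_happens'[OF Fl \<theta>_ev[OF assms]] \<theta> by blast

definition mantle_prod :: "'a set \<Rightarrow> 'a set \<Rightarrow> 'a set" where
  "mantle_prod \<gg> \<hh> = (THE \<kk>. \<forall>g\<in>\<gg>. \<forall>h\<in>\<hh>. \<forall>\<^sub>F i in Fl. dc (g \<otimes> \<pi> (\<theta> i) \<otimes> h) = \<kk>)"

lemma mantle_prod_eq:
  assumes g: "localized E g" and h: "localized F h" and s: "s \<in> S" "s ` F \<inter> E = {}"
  shows "mantle_prod (dc g) (dc h) = dc (g \<otimes> cj s h)"
  unfolding mantle_prod_def
proof (rule the_equality)
  show "\<forall>g'\<in>dc g. \<forall>h'\<in>dc h. \<forall>\<^sub>F i in Fl. dc (g' \<otimes> \<pi> (\<theta> i) \<otimes> h') = dc (g \<otimes> cj s h)"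
    by (intro ballI eventually_dc[OF assms])
  fix \<kk> assume "\<forall>g'\<in>dc g. \<forall>h'\<in>dc h. \<forall>\<^sub>F i in Fl. dc (g' \<otimes> \<pi> (\<theta> i) \<otimes> h') = \<kk>"
  moreover have gh: "g \<in> dc g" "h \<in> dc h" using g h by (auto simp: localized_def dc_self)
  ultimately have "\<forall>\<^sub>F i in Fl. dc (g \<otimes> \<pi> (\<theta> i) \<otimes> h) = \<kk>" by blast
  with eventually_dc[OF assms gh] have "\<forall>\<^sub>F i in Fl. \<kk> = dc (g \<otimes> cj s h)" by eventually_elim simp
  then show "\<kk> = dc (g \<otimes> cj s h)" using Fl by simp
qed

lemma obtain_common:
  assumes "g \<in> carrier G" "h \<in> carrier G"
  obtains F where "localized F g" "localized F h"
proof -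
  obtain E where E: "localized E g" by (rule obtain_localized[OF assms(1)])
  obtain F where F: "localized F h" by (rule obtain_localized[OF assms(2)])
  show ?thesis by (rule that[OF localized_Un[OF E F]])
qed

theorem mantle_prod_eventually:
  assumes gh: "g \<in> carrier G" "h \<in> carrier G" and "g' \<in> dc g" "h' \<in> dc h"
  shows "\<forall>\<^sub>F i in Fl. dc (g' \<otimes> \<pi> (\<theta> i) \<otimes> h') = mantle_prod (dc g) (dc h)"
proof -
  obtain F where F: "localized F g" "localized F h" by (rule obtain_common[OF gh(1,2)])
  have "finite F" "F \<subseteq> X" using F by (simp_all add: localized_def)
  then obtain s where s: "s \<in> S" "s ` F \<inter> F = {}" by (rule obtain_shift)
  show ?thesis
    using eventually_dc[OF F s assms(3,4)] mantle_prod_eq[OF F s] by simp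
qed

text \<open>For associativity, choose \<open>s\<close> carrying the support of \<open>k\<close> off that of \<open>h\<close>, and then \<open>t\<close>
  carrying the supports of \<open>h\<close> and of the conjugate of \<open>k\<close> off everything so far. Both bracketings
  give the double coset of \<open>g \<otimes> t h t\<^sup>-\<^sup>1 \<otimes> (t s) k (t s)\<^sup>-\<^sup>1\<close>.\<close>

theorem mantle_semigroup: "is_semigroup (dc ` carrier G) mantle_prod"
  unfolding is_semigroup_def
proof (intro conjI ballI)
  fix \<gg> \<hh> assume "\<gg> \<in> dc ` carrier G" "\<hh> \<in> dc ` carrier G"
  then obtain g h where gh: "g \<in> carrier G" "h \<in> carrier G" "\<gg> = dc g" "\<hh> = dc h" by blast
  obtain F where F: "localized F g" "localized F h" by (rule obtain_common[OF gh(1,2)])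
  have "finite F" "F \<subseteq> X" using F by (simp_all add: localized_def)
  then obtain s where s: "s \<in> S" "s ` F \<inter> F = {}" by (rule obtain_shift)
  show "mantle_prod \<gg> \<hh> \<in> dc ` carrier G"
    using mantle_prod_eq[OF F s] gh s by simp
next
  fix \<gg> \<hh> \<kk> assume "\<gg> \<in> dc ` carrier G" "\<hh> \<in> dc ` carrier G" "\<kk> \<in> dc ` carrier G"
  then obtain g h k where ghk: "g \<in> carrier G" "h \<in> carrier G" "k \<in> carrier G"
    and eq: "\<gg> = dc g" "\<hh> = dc h" "\<kk> = dc k" by blast
  obtain F1 where F1: "localized F1 g" "localized F1 h" by (rule obtain_common[OF ghk(1,2)])
  obtain F2 where F2: "localized F2 k" by (rule obtain_localized[OF ghk(3)])
  define F where "F = F1 \<union> F2"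
  have F: "localized F g" "localized F h" "localized F k"
    unfolding F_def using localized_Un[OF F1(1) F2] localized_Un[OF F1(2) F2] by simp_all
  have "finite F" "F \<subseteq> X" using F by (simp_all add: localized_def)
  then obtain s where s: "s \<in> S" "s ` F \<inter> F = {}" by (rule obtain_shift)
  have hk: "localized (F \<union> s ` F) (h \<otimes> cj s k)"
    by (intro localized_mult localized_cj F s)
  then have "finite (F \<union> s ` F)" "F \<union> s ` F \<subseteq> X" unfolding localized_def by blast+
  then obtain t where t: "t \<in> S" "t ` (F \<union> s ` F) \<inter> (F \<union> s ` F) = {}"
    by (rule obtain_shift)
  have gh: "localized (F \<union> t ` F) (g \<otimes> cj t h)"
    by (intro localized_mult localized_cj F t)
  have ts: "t \<circ> s \<in> S" by (intro fin_perms_comp s t)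
  have "inj t" using t by (simp add: fin_perms_def bij_is_inj)
  then have dis: "(t \<circ> s) ` F \<inter> (F \<union> t ` F) = {}" 
  proof -
    have "(t \<circ> s) ` F \<inter> t ` F = t ` (s ` F \<inter> F)"
      using \<open>inj t\<close> by (simp add: image_Int image_comp)
    then show ?thesis using t(2) s(2) by (simp add: image_comp) blast
  qed
  have t1: "t ` F \<inter> F = {}" "t ` (F \<union> s ` F) \<inter> F = {}" using t(2) by blast+
  have "mantle_prod (mantle_prod \<gg> \<hh>) \<kk> = dc ((g \<otimes> cj t h) \<otimes> cj (t \<circ> s) k)"
    unfolding eq mantle_prod_eq[OF F(1,2) t(1) t1(1)] by (rule mantle_prod_eq[OF gh F(3) ts dis])
  also have "\<dots> = dc (g \<otimes> cj t (h \<otimes> cj s k))"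
    using ghk s t by (simp add: cj_mult cj_comp m_assoc)
  also have "\<dots> = mantle_prod \<gg> (mantle_prod \<hh> \<kk>)"
    unfolding eq mantle_prod_eq[OF F(2,3) s] by (rule mantle_prod_eq[OF F(1) hk t(1) t1(2), symmetric])
  finally show "mantle_prod (mantle_prod \<gg> \<hh>) \<kk> = mantle_prod \<gg> (mantle_prod \<hh> \<kk>)" .
qed

end

section \<open>Orthogonal projections in complex Hilbert spaces\<close>

text \<open>A minimizing sequence is Cauchy by the parallelogram law.\<close>

lemma nearest_point_exists:
  fixes V :: "'h::{real_inner,complete_space} set"
  assumes V: "closed V" "convex V" "V \<noteq> {}"
  obtains w where "w \<in> V" "\<And>u. u \<in> V \<Longrightarrow> norm (v - w) \<le> norm (v - u)"
proof -
  define d where "d = (INF u\<in>V. (norm (v - u))\<^sup>2)"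
  have bb: "bdd_below ((\<lambda>u. (norm (v - u))\<^sup>2) ` V)" by (rule bdd_belowI[of _ 0]) auto
  have d: "d \<le> (norm (v - u))\<^sup>2" if "u \<in> V" for u
    unfolding d_def by (rule cINF_lower[OF bb that])
  have "\<exists>u\<in>V. (norm (v - u))\<^sup>2 < d + inverse (real (Suc n))" for n
  proof -
    have "(INF u\<in>V. (norm (v - u))\<^sup>2) < d + inverse (real (Suc n))" by (simp add: d_def)
    then show ?thesis by (subst (asm) cINF_less_iff[OF V(3) bb])
  qed
  then obtain x where xV: "\<And>n. x n \<in> V"
    and x: "\<And>n. (norm (v - x n))\<^sup>2 < d + inverse (real (Suc n))" by metis
  have key: "(norm (x m - x n))\<^sup>2 \<le> 2 * inverse (real (Suc m)) + 2 * inverse (real (Suc n))" for m n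
  proof -
    have "(1/2) *\<^sub>R x m + (1/2) *\<^sub>R x n \<in> V"
      using V(2) xV by (intro convexD) auto
    then have "d \<le> (norm (v - ((1/2) *\<^sub>R x m + (1/2) *\<^sub>R x n)))\<^sup>2" by (rule d)
    moreover have "(norm (x m - x n))\<^sup>2 + 4 * (norm (v - ((1/2) *\<^sub>R x m + (1/2) *\<^sub>R x n)))\<^sup>2
        = 2 * (norm (v - x m))\<^sup>2 + 2 * (norm (v - x n))\<^sup>2"
      by (simp add: power2_norm_eq_inner inner_diff_left inner_diff_right inner_add_left
          inner_add_right inner_commute algebra_simps)
    ultimately show ?thesis using x[of m] x[of n] by linarith
  qed
  have "Cauchy x"
  proof (rule metric_CauchyI)
    fix e :: real assume e: "0 < e"
    then obtain N where N: "inverse (real (Suc N)) < e\<^sup>2 / 4"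
      using reals_Archimedean[of "e\<^sup>2 / 4"] by auto
    have "dist (x m) (x n) < e" if "m \<ge> N" "n \<ge> N" for m n
    proof -
      have "inverse (real (Suc m)) \<le> inverse (real (Suc N))" "inverse (real (Suc n)) \<le> inverse (real (Suc N))"
        using that by (auto intro!: le_imp_inverse_le)
      then have "(norm (x m - x n))\<^sup>2 < e\<^sup>2" using key[of m n] N by linarith
      then show ?thesis using e by (simp add: dist_norm power2_less_imp_less)
    qed
    then show "\<exists>M. \<forall>m\<ge>M. \<forall>n\<ge>M. dist (x m) (x n) < e" by blast
  qed
  then obtain w where w: "x \<longlonglongrightarrow> w" using Cauchy_convergent_iff convergent_def by blast
  have wV: "w \<in> V" using closed_sequentially[OF V(1) xV w] .
  have "(\<lambda>n. (norm (v - x n))\<^sup>2) \<longlonglongrightarrow> (norm (v - w))\<^sup>2" by (intro tendsto_intros w)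
  moreover have "(\<lambda>n. d + inverse (real (Suc n))) \<longlonglongrightarrow> d + 0"
    by (intro tendsto_intros LIMSEQ_inverse_real_of_nat)
  ultimately have wd: "(norm (v - w))\<^sup>2 \<le> d"
    using x by (intro tendsto_le[OF sequentially_bot, of _ "d" _ "(norm (v - w))\<^sup>2"])
      (auto intro!: always_eventually less_imp_le)
  have "norm (v - w) \<le> norm (v - u)" if "u \<in> V" for u
    using order_trans[OF wd d[OF that]] by (rule power2_le_imp_le) simp
  with wV that show ?thesis by blast
qed

lemma norm_diff_scaleR_squared:
  fixes a u :: "'a::real_inner"
  shows "(norm (a - t *\<^sub>R u))\<^sup>2 = (norm a)\<^sup>2 - 2 * t * inner a u + t\<^sup>2 * inner u u"
  by (simp add: power2_norm_eq_inner inner_diff_left inner_diff_right inner_commute[of u a]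
      algebra_simps power2_eq_square[of t])

lemma orthogonal_decomposition:
  fixes V :: "'h::{real_inner,complete_space} set"
  assumes "closed V" "subspace V"
  obtains w where "w \<in> V" "\<And>u. u \<in> V \<Longrightarrow> inner (v - w) u = 0"
proof -
  obtain w where w: "w \<in> V" "\<And>u. u \<in> V \<Longrightarrow> norm (v - w) \<le> norm (v - u)"
    using nearest_point_exists[of V v] assms subspace_imp_convex subspace_0 by blast
  have "inner (v - w) u = 0" if u: "u \<in> V" for u
  proof (cases "u = 0")
    case False
    \<comment> \<open>the minimizer of the distance from \<open>v\<close> along the line through \<open>w\<close> in direction \<open>u\<close>\<close>
    define t where "t = inner (v - w) u / inner u u"
    have "w + t *\<^sub>R u \<in> V" using w u assms(2) by (simp add: subspace_add subspace_scale)
    then have "(norm (v - w))\<^sup>2 \<le> (norm (v - (w + t *\<^sub>R u)))\<^sup>2"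
      using w(2) by (simp add: power_mono)
    also have "v - (w + t *\<^sub>R u) = (v - w) - t *\<^sub>R u" by simp
    also have "(norm ((v - w) - t *\<^sub>R u))\<^sup>2
        = (norm (v - w))\<^sup>2 - 2 * t * inner (v - w) u + t\<^sup>2 * inner u u"
      by (rule norm_diff_scaleR_squared)
    finally have "2 * t * inner (v - w) u \<le> t\<^sup>2 * inner u u" by simp
    moreover have "t\<^sup>2 * inner u u = t * inner (v - w) u"
      using False by (simp add: t_def power2_eq_square)
    ultimately have "t * inner (v - w) u \<le> 0" by simp
    then have "(inner (v - w) u)\<^sup>2 / inner u u \<le> 0" by (simp add: t_def power2_eq_square)
    moreover have "inner u u > 0" using False by simp
    ultimately show ?thesis by (simp add: divide_le_0_iff)
  qed simp
  with w(1) that show ?thesis by blast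
qed

lemma subspace_closure_real:
  fixes W :: "'a::real_normed_vector set"
  assumes "subspace W"
  shows "subspace (closure W)"
proof (rule subspaceI)
  show "0 \<in> closure W"
    using assms closure_subset subspace_0 by blast
  fix x y assume "x \<in> closure W" "y \<in> closure W"
  then obtain f g where "\<And>n. f n \<in> W" "f \<longlonglongrightarrow> x" "\<And>n. g n \<in> W" "g \<longlonglongrightarrow> y"
    by (meson closure_sequential)
  then have "\<forall>n. f n + g n \<in> W" "(\<lambda>n. f n + g n) \<longlonglongrightarrow> x + y"
    using assms by (auto intro: subspace_add tendsto_add)
  then show "x + y \<in> closure W"
    unfolding closure_sequential by (intro exI[of _ "\<lambda>n. f n + g n"] conjI)
next
  fix c x assume "x \<in> closure W"
  then obtain f where "\<And>n. f n \<in> W" "f \<longlonglongrightarrow> x" by (meson closure_sequential)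
  then have "\<forall>n. c *\<^sub>R f n \<in> W" "(\<lambda>n. c *\<^sub>R f n) \<longlonglongrightarrow> c *\<^sub>R x"
    using assms by (auto intro: subspace_scale tendsto_scaleR)
  then show "c *\<^sub>R x \<in> closure W"
    unfolding closure_sequential by (intro exI[of _ "\<lambda>n. c *\<^sub>R f n"] conjI)
qed

lemma scaleC_minus_one: "scaleC (-1) x = - x" for x :: "'h::complex_hilbert_space"
  using scaleC_of_real[of "-1" x] by simp

lemma cinner_diff_left: "cinner (x - y) z = cinner x z - cinner y z"
  for x :: "'h::complex_hilbert_space"
proof -
  have "x - y = x + scaleC (-1) y" by (simp add: scaleC_minus_one)
  then show ?thesis by (simp only: cinner_add_left cinner_scaleC_left) simp
qed

lemma cinner_scaleC_right: "cinner x (scaleC a y) = cnj a * cinner x y"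
  for x :: "'h::complex_hilbert_space"
  by (metis cinner_commute cinner_scaleC_left complex_cnj_cnj complex_cnj_mult)

definition csubspace :: "'h::complex_hilbert_space set \<Rightarrow> bool" where
  "csubspace V \<longleftrightarrow> subspace V \<and> (\<forall>a. \<forall>v\<in>V. scaleC a v \<in> V)"

text \<open>The imaginary part of \<open>cinner x u\<close> is the real part for a multiple of
  \<open>u\<close> by the imaginary unit, so orthogonality to a complex subspace is visible to the
  real scalar product. This lets the analysis below run with \<open>inner\<close> only.\<close>

lemma cinner_zero_iff_inner:
  fixes V :: "'h::complex_hilbert_space set"
  assumes "csubspace V"
  shows "(\<forall>u\<in>V. cinner x u = 0) \<longleftrightarrow> (\<forall>u\<in>V. inner x u = 0)"
proof
  assume "\<forall>u\<in>V. cinner x u = 0"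
  then show "\<forall>u\<in>V. inner x u = 0" by (metis Re_cinner zero_complex.sel(1))
next
  assume *: "\<forall>u\<in>V. inner x u = 0"
  show "\<forall>u\<in>V. cinner x u = 0"
  proof
    fix u assume u: "u \<in> V"
    then have "inner x (scaleC \<i> u) = 0" using * assms by (simp add: csubspace_def)
    then have "Re (cinner x (scaleC \<i> u)) = 0" by (simp add: Re_cinner)
    then have "Im (cinner x u) = 0" by (simp add: cinner_scaleC_right)
    moreover have "Re (cinner x u) = 0" using * u by (simp add: Re_cinner)
    ultimately show "cinner x u = 0" by (simp add: complex_eq_iff)
  qed
qed

lemma orth_projection_unique:
  fixes V :: "'h::complex_hilbert_space set"
  assumes V: "csubspace V" and w: "w \<in> V" "\<And>u. u \<in> V \<Longrightarrow> inner (v - w) u = 0"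
  shows "orth_projection V v = w"
  unfolding orth_projection_def cinner_zero_iff_inner[OF V]
proof (rule the_equality)
  show "w \<in> V \<and> (\<forall>u\<in>V. inner (v - w) u = 0)" using w by blast
  fix w' assume w': "w' \<in> V \<and> (\<forall>u\<in>V. inner (v - w') u = 0)"
  then have "w - w' \<in> V" using w V by (simp add: csubspace_def subspace_diff)
  then have "inner (v - w') (w - w') - inner (v - w) (w - w') = 0" using w w' by simp
  then have "inner (w - w') (w - w') = 0" by (simp add: inner_diff_left)
  then show "w' = w" by simp
qed

lemma orth_projection:
  fixes V :: "'h::complex_hilbert_space set"
  assumes "closed V" "csubspace V"
  shows "orth_projection V v \<in> V" "u \<in> V \<Longrightarrow> inner (v - orth_projection V v) u = 0"
proof -
  obtain w where w: "w \<in> V" "\<And>u. u \<in> V \<Longrightarrow> inner (v - w) u = 0"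
    using orthogonal_decomposition[of V v] assms by (auto simp: csubspace_def)
  have "orth_projection V v = w" by (rule orth_projection_unique[OF assms(2) w])
  then show "orth_projection V v \<in> V" "u \<in> V \<Longrightarrow> inner (v - orth_projection V v) u = 0"
    using w by auto
qed

lemma orth_projection_eqI:
  fixes V :: "'h::complex_hilbert_space set"
  assumes V: "closed V" "csubspace V" and "\<And>u. u \<in> V \<Longrightarrow> inner v u = inner v' u"
  shows "orth_projection V v = orth_projection V v'"
  by (rule orth_projection_unique[OF V(2) orth_projection(1)[OF V]])
    (use orth_projection(2)[OF V, of _ v'] assms(3) in \<open>simp add: inner_diff_left\<close>)

lemma orth_projection_in_bounded_operators:
  fixes V :: "'h::complex_hilbert_space set"
  assumes V: "closed V" "csubspace V" and U: "clinear_on UNIV U" "\<And>x. norm (U x) \<le> norm x"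
  shows "(\<lambda>v\<in>V. orth_projection V (U v)) \<in> bounded_operators V"
proof -
  let ?P = "orth_projection V"
  have sV: "subspace V" and cV: "\<And>a v. v \<in> V \<Longrightarrow> scaleC a v \<in> V"
    using V by (auto simp: csubspace_def)
  note P = orth_projection[OF V]
  have add: "?P (x + y) = ?P x + ?P y" for x y
  proof (rule orth_projection_unique[OF V(2)])
    show "?P x + ?P y \<in> V" using sV P by (simp add: subspace_add)
    fix u assume "u \<in> V"
    then have "inner (x - ?P x) u + inner (y - ?P y) u = 0" using P by simp
    then show "inner (x + y - (?P x + ?P y)) u = 0" by (simp add: inner_diff_left inner_add_left)
  qed
  have scale: "?P (scaleC a x) = scaleC a (?P x)" for a x
  proof (rule orth_projection_unique[OF V(2)])
    show "scaleC a (?P x) \<in> V" by (simp add: cV P)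
    have "\<forall>u\<in>V. cinner (x - ?P x) u = 0" using P by (simp add: cinner_zero_iff_inner[OF V(2)])
    moreover have "cinner (scaleC a x - scaleC a (?P x)) u = a * cinner (x - ?P x) u" for u
      by (simp add: cinner_diff_left cinner_scaleC_left right_diff_distrib)
    ultimately have "\<forall>u\<in>V. cinner (scaleC a x - scaleC a (?P x)) u = 0" by simp
    then show "inner (scaleC a x - scaleC a (?P x)) u = 0" if "u \<in> V" for u
      using that by (simp add: cinner_zero_iff_inner[OF V(2)])
  qed
  have bound: "norm (?P x) \<le> norm x" for x
  proof -
    have "inner (?P x) (?P x) = inner x (?P x)" using P(2)[OF P(1), of x x] by (simp add: inner_diff_left)
    then have "norm (?P x) * norm (?P x) \<le> norm x * norm (?P x)"
      using norm_cauchy_schwarz[of x "?P x"] by (simp add: power2_norm_eq_inner[symmetric] power2_eq_square)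
    then show ?thesis
      by (metis mult_le_cancel_right norm_ge_zero norm_zero not_le order_le_less)
  qed
  have "norm (?P (U v)) \<le> 1 * norm v" for v using bound[of "U v"] U(2)[of v] by simp
  then have ex: "\<exists>C. \<forall>v\<in>V. norm ((\<lambda>v\<in>V. ?P (U v)) v) \<le> C * norm v" by (auto intro!: exI[of _ 1])
  have "clinear_on V (\<lambda>v\<in>V. ?P (U v))"
    using U(1) sV cV by (simp add: clinear_on_def add scale subspace_add)
  with ex P(1) show ?thesis by (auto simp: bounded_operators_def)
qed

section \<open>Unitary representations and the mantle\<close>

lemma unitary_groupD:
  assumes "U \<in> carrier unitary_group"
  shows "linear U" "clinear_on UNIV U" "inner (U x) (U y) = inner x y" "norm (U x) = norm x"
    "continuous_on UNIV U"
proof -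
  show cl: "clinear_on UNIV U" using assms by (simp add: unitary_group_def)
  then show lin: "linear U"
    unfolding clinear_on_def by (intro linearI) (simp_all, metis scaleC_of_real)
  show inn: "inner (U x) (U y) = inner x y" for x y
    using assms by (metis (mono_tags, lifting) Re_cinner mem_Collect_eq partial_object.select_convs(1) unitary_group_def)
  show norm: "norm (U x) = norm x" for x by (simp add: norm_eq_sqrt_inner inn)
  show "continuous_on UNIV U"
    by (intro linear_continuous_on bounded_linear_intro[of _ 1])
      (simp_all add: linear_add[OF lin] linear_scale[OF lin] norm)
qed

text \<open>The asymptotic axiom is the only trace of the continuity of the
  representation.\<close>

locale mantle_rep = mantle_group +
  fixes \<rho> :: "'a \<Rightarrow> 'h::complex_hilbert_space \<Rightarrow> 'h"
  assumes \<rho>: "\<rho> \<in> hom G unitary_group"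
    and asymptotic: "k \<in> H \<Longrightarrow> ((\<lambda>i. \<rho> (cj (\<theta> i) k) v) \<longlongrightarrow> v) Fl"
begin

abbreviation "\<Theta> i \<equiv> \<rho> (\<pi> (\<theta> i))"

definition fixed :: "'h set" where
  "fixed = {v. \<forall>k\<in>H. \<rho> k v = v}"

lemma \<rho>_unitary: "g \<in> carrier G \<Longrightarrow> \<rho> g \<in> carrier unitary_group"
  using \<rho> by (auto simp: hom_def)

lemmas \<rho>_linear = unitary_groupD(1)[OF \<rho>_unitary]
  and \<rho>_inner = unitary_groupD(3)[OF \<rho>_unitary]
  and \<rho>_norm = unitary_groupD(4)[OF \<rho>_unitary]

lemma \<rho>_mult: "g \<in> carrier G \<Longrightarrow> h \<in> carrier G \<Longrightarrow> \<rho> (g \<otimes> h) v = \<rho> g (\<rho> h v)"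
  using hom_mult[OF \<rho>, of g h] by (simp add: unitary_group_def)

lemma \<rho>_one: "\<rho> \<one> v = v"
proof -
  have "\<rho> \<one> (\<rho> \<one> v - v) = 0"
    by (simp add: linear_diff[OF \<rho>_linear] \<rho>_mult[symmetric])
  then show ?thesis using \<rho>_norm[of \<one> "\<rho> \<one> v - v"] by simp
qed

lemma \<rho>_adjoint:
  assumes "g \<in> carrier G"
  shows "inner (\<rho> g v) w = inner v (\<rho> (inv g) w)"
proof -
  have "inner v (\<rho> (inv g) w) = inner (\<rho> g v) (\<rho> g (\<rho> (inv g) w))"
    using assms by (simp add: \<rho>_inner)
  then show ?thesis using assms by (simp add: \<rho>_mult[symmetric] \<rho>_one)
qed

lemma fixed_closed: "closed fixed"
proof -
  have "fixed = (\<Inter>k\<in>H. {v. \<rho> k v = v})" by (auto simp: fixed_def)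
  moreover have "closed {v. \<rho> k v = v}" if "k \<in> H" for k
    by (intro closed_Collect_eq unitary_groupD(5)[OF \<rho>_unitary] continuous_on_id H_carrier that)
  ultimately show ?thesis by auto
qed

lemma fixed_csubspace: "csubspace fixed"
  using unitary_groupD(2)[OF \<rho>_unitary]
  unfolding csubspace_def fixed_def subspace_def clinear_on_def
  by (auto simp: linear_add[OF \<rho>_linear] linear_scale[OF \<rho>_linear] linear_0[OF \<rho>_linear])

definition compression :: "'a \<Rightarrow> 'h \<Rightarrow> 'h" where
  "compression g = (\<lambda>v\<in>fixed. orth_projection fixed (\<rho> g v))"

text \<open>Stabilizer elements are absorbed by the fixed vectors on both sides, so matrix
  elements between fixed vectors are functions of the double coset.\<close>

lemma inner_dc:
  assumes "g \<in> carrier G" "g' \<in> dc g" "v \<in> fixed" "u \<in> fixed"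
  shows "inner (\<rho> g' v) u = inner (\<rho> g v) u"
proof -
  obtain a b where ab: "a \<in> H" "b \<in> H" "g' = a \<otimes> (g \<otimes> b)" using assms by (auto simp: dc_iff)
  then have "\<rho> g' v = \<rho> a (\<rho> g v)" using assms by (simp add: \<rho>_mult fixed_def)
  then show ?thesis using ab assms by (simp add: \<rho>_adjoint fixed_def H_inv)
qed

lemma compression_dc:
  assumes "g \<in> carrier G" "g' \<in> dc g"
  shows "compression g' = compression g"
  unfolding compression_def
  by (intro restrict_ext orth_projection_eqI fixed_closed fixed_csubspace inner_dc assms)

lemma compression_bounded: "g \<in> carrier G \<Longrightarrow> compression g \<in> bounded_operators fixed"
  unfolding compression_def
  by (intro orth_projection_in_bounded_operators fixed_closed fixed_csubspace unitary_groupD(2) \<rho>_unitary)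
    (simp_all add: \<rho>_norm)

definition displacements :: "'h set" where
  "displacements = span {\<rho> k x - x |k x. k \<in> H}"

text \<open>The remainder \<open>v - w\<close> after projecting to the closed span is orthogonal
  to all differences \<open>\<rho> k x - x\<close>, hence fixed; being also orthogonal to the
  fixed vectors, it vanishes.\<close>

lemma orthogonal_fixed_imp:
  assumes "\<And>u. u \<in> fixed \<Longrightarrow> inner v u = 0"
  shows "v \<in> closure displacements"
proof -
  have sub: "subspace (closure displacements)" unfolding displacements_def by (rule subspace_closure_real[OF subspace_span])
  obtain w where w: "w \<in> closure displacements" "\<And>u. u \<in> closure displacements \<Longrightarrow> inner (v - w) u = 0"
    using orthogonal_decomposition[OF _ sub, of v] by auto
  have "\<rho> k (v - w) = v - w" if k: "k \<in> H" for k
  proof -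
    let ?x = "v - w"
    have "\<rho> (inv k) ?x - ?x \<in> closure displacements"
      unfolding displacements_def using k by (intro subsetD[OF closure_subset] span_base) (auto intro: H_inv)
    from w(2)[OF this] have "inner ?x (\<rho> (inv k) ?x) = inner ?x ?x" by (simp only: inner_diff_right)
    then have *: "inner (\<rho> k ?x) ?x = inner ?x ?x" using k by (simp only: \<rho>_adjoint H_carrier)
    have "inner (\<rho> k ?x - ?x) (\<rho> k ?x - ?x) = inner (\<rho> k ?x) (\<rho> k ?x) - 2 * inner (\<rho> k ?x) ?x + inner ?x ?x"
      by (simp only: inner_diff_left[of "\<rho> k ?x" ?x] inner_diff_right[of _ "\<rho> k ?x" ?x]
          inner_commute[of ?x "\<rho> k ?x"])
    then show ?thesis using * k by (simp only: \<rho>_inner H_carrier) simp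
  qed
  then have xV: "v - w \<in> fixed" by (simp add: fixed_def)
  have perp: "inner u (v - w) = 0" if "u \<in> displacements" for u
    using that unfolding displacements_def
  proof (induction rule: span_induct_alt)
    case base show ?case by simp
  next
    case (step c x y)
    then obtain k z where x: "x = \<rho> k z - z" "k \<in> H" by blast
    have "inner x (v - w) = inner z (\<rho> (inv k) (v - w)) - inner z (v - w)"
      unfolding x(1) using x(2) by (simp only: inner_diff_left \<rho>_adjoint H_carrier)
    also have "\<dots> = 0" using xV x(2) by (simp add: fixed_def H_inv)
    finally show ?case using step by (simp only: inner_add_left inner_scaleR_left)
  qed
  have "closure displacements \<subseteq> {u. inner u (v - w) = 0}"
    by (intro closure_minimal subsetI CollectI perp closed_Collect_eq continuous_intros)
  then have "inner w (v - w) = 0" using w by blast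
  moreover have "inner v (v - w) = 0" using assms xV by blast
  ultimately have "inner (v - w) (v - w) = 0" by (simp only: inner_diff_left)
  then show ?thesis using w by simp
qed

text \<open>On a vector \<open>\<rho> k x - x\<close> the operator of \<open>\<theta> i\<close> acts as the difference of the
  conjugate of \<open>k\<close> by \<open>\<theta> i\<close> and the identity, applied to a vector of bounded norm; as the
  conjugate tends to the identity, the matrix elements tend to zero.\<close>

lemma weak_limit_displacements:
  assumes "v \<in> displacements"
  shows "((\<lambda>i. inner (\<Theta> i v) y) \<longlongrightarrow> 0) Fl"
  using assms unfolding displacements_def
proof (induction rule: span_induct_alt)
  case base
  show ?case by (simp add: linear_0[OF \<rho>_linear] \<theta>)
next
  case (step c x z)
  then obtain k w where x: "x = \<rho> k w - w" "k \<in> H" by blast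
  let ?r = "\<lambda>i. \<rho> (cj (\<theta> i) (inv k)) y - y"
  have eq: "inner (\<Theta> i x) y = inner (\<Theta> i w) (?r i)" for i
  proof -
    let ?p = "\<pi> (\<theta> i)"
    have p: "?p \<in> carrier G" using \<theta> by blast
    have k: "k \<in> carrier G" using x by blast
    have c: "cj (\<theta> i) k \<in> carrier G" using \<theta> k by blast
    have "cj (\<theta> i) k \<otimes> ?p = ?p \<otimes> k" using p k by (simp add: cj_def m_assoc)
    then have "\<rho> ?p x = \<rho> (cj (\<theta> i) k) (\<rho> ?p w) - \<rho> ?p w"
      using p c k by (simp add: x linear_diff[OF \<rho>_linear] \<rho>_mult[symmetric])
    moreover have "inv (cj (\<theta> i) k) = cj (\<theta> i) (inv k)"
      using p k by (simp add: cj_def inv_mult_group m_assoc)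
    ultimately show ?thesis using c by (simp add: inner_diff_left inner_diff_right \<rho>_adjoint)
  qed
  have "(?r \<longlongrightarrow> y - y) Fl" using x by (intro tendsto_intros asymptotic H_inv)
  then have "((\<lambda>i. norm w * norm (?r i)) \<longlongrightarrow> norm w * 0) Fl"
    by (intro tendsto_intros tendsto_norm_zero) simp
  then have "((\<lambda>i. inner (\<Theta> i w) (?r i)) \<longlongrightarrow> 0) Fl"
  proof (rule Lim_null_comparison[rotated, OF _ always_eventually, OF tendsto_eq_rhs])
    show "\<forall>i. norm (inner (\<Theta> i w) (?r i)) \<le> norm w * norm (?r i)"
      using \<theta> Cauchy_Schwarz_ineq2[of "\<Theta> i w" for i] by (metis \<pi>_carrier \<rho>_norm real_norm_def)
  qed simp
  then have "((\<lambda>i. c * inner (\<Theta> i x) y + inner (\<Theta> i z) y) \<longlongrightarrow> c * 0 + 0) Fl"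
    unfolding eq by (intro tendsto_intros step.IH)
  then show ?case
    by (simp add: linear_add[OF \<rho>_linear] linear_scale[OF \<rho>_linear] \<theta> inner_add_left)
qed

text \<open>The operators are isometric, so the limit passes from the span of the
  differences to its closure.\<close>

lemma weak_limit_orthogonal:
  assumes "\<And>u. u \<in> fixed \<Longrightarrow> inner v u = 0"
  shows "((\<lambda>i. inner (\<Theta> i v) y) \<longlongrightarrow> 0) Fl"
proof (rule tendstoI)
  fix e :: real assume e: "e > 0"
  \<comment> \<open>the summand 1 only keeps the denominator positive\<close>
  define d where "d = e / (2 * (norm y + 1))"
  have d: "d > 0" using e by (simp add: d_def add_nonneg_pos)
  have "norm y * d < e / 2"
  proof -
    have "norm y * d < (norm y + 1) * d" using d by simp
    also have "(norm y + 1) * d = e / 2"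
    proof -
      have "norm y + 1 \<noteq> 0" using norm_ge_zero[of y] by linarith
      moreover have "c * (e / (2 * c)) = e / 2" if "c \<noteq> 0" for c :: real
        using that by simp
      ultimately show ?thesis by (simp only: d_def)
    qed
    finally show ?thesis .
  qed
  obtain w where w: "w \<in> displacements" "dist w v < d"
    using orthogonal_fixed_imp[OF assms] d closure_approachable by blast
  have "\<forall>\<^sub>F i in Fl. dist (inner (\<Theta> i w) y) 0 < e / 2"
    by (rule tendstoD[OF weak_limit_displacements[OF w(1)]]) (use e in simp)
  then show "\<forall>\<^sub>F i in Fl. dist (inner (\<Theta> i v) y) 0 < e"
  proof (rule eventually_mono)
    fix i assume i: "dist (inner (\<Theta> i w) y) 0 < e / 2"
    let ?U = "\<Theta> i"
    have "inner (?U v) y = inner (?U w) y + inner (?U (v - w)) y"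
      by (simp add: linear_diff[OF \<rho>_linear] \<theta> inner_diff_left)
    moreover have "\<bar>inner (?U (v - w)) y\<bar> \<le> norm (v - w) * norm y"
      using Cauchy_Schwarz_ineq2[of "?U (v - w)" y] by (simp add: \<rho>_norm \<theta>)
    moreover have "norm (v - w) * norm y \<le> d * norm y"
      using w(2) by (intro mult_right_mono) (simp_all add: dist_norm norm_minus_commute)
    moreover have "d * norm y < e / 2" using \<open>norm y * d < e / 2\<close> by (simp only: mult.commute)
    moreover have "\<bar>inner (?U w) y\<bar> < e / 2" using i by (simp only: dist_real_def diff_0_right)
    ultimately show "dist (inner (?U v) y) 0 < e"
      unfolding dist_real_def diff_0_right by linarith
  qed
qed

lemma weak_limit:
  "((\<lambda>i. inner (\<Theta> i v) y) \<longlongrightarrow> inner (orth_projection fixed v) y) Fl"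
proof -
  let ?P = "orth_projection fixed v"
  have "((\<lambda>i. inner (\<Theta> i (v - ?P)) y) \<longlongrightarrow> 0) Fl"
    by (intro weak_limit_orthogonal orth_projection fixed_closed fixed_csubspace)
  then have "((\<lambda>i. inner (\<Theta> i (v - ?P)) y + inner ?P y) \<longlongrightarrow> 0 + inner ?P y) Fl"
    by (intro tendsto_intros)
  moreover have "\<Theta> i ?P = ?P" for i
    using orth_projection(1)[OF fixed_closed fixed_csubspace, of v] \<pi>_H[OF \<theta>] by (auto simp: fixed_def)
  ultimately show ?thesis
    by (simp add: linear_diff[OF \<rho>_linear] \<theta> inner_diff_left)
qed

text \<open>The matrix elements of \<open>\<rho> (g \<otimes> \<pi> (\<theta> i) \<otimes>
  h)\<close> between fixed vectors are eventually those of \<open>\<rho> x\<close>; by the weak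
  limit they tend to those of \<open>\<rho> g\<close> applied to the projection of \<open>\<rho> h
  v\<close>.\<close>

theorem compression_mantle_prod:
  assumes g: "g \<in> carrier G" and h: "h \<in> carrier G" and x: "x \<in> carrier G"
    and eq: "dc x = mantle_prod (dc g) (dc h)" and v: "v \<in> fixed"
  shows "compression x v = compression g (compression h v)"
proof -
  let ?P = "orth_projection fixed"
  note P = orth_projection[OF fixed_closed fixed_csubspace]
  have "?P (\<rho> x v) = ?P (\<rho> g (?P (\<rho> h v)))"
  proof (rule orth_projection_eqI[OF fixed_closed fixed_csubspace])
    fix u assume u: "u \<in> fixed"
    have "((\<lambda>i. inner (\<rho> (\<pi> (\<theta> i)) (\<rho> h v)) (\<rho> (inv g) u)) \<longlongrightarrow> inner (?P (\<rho> h v)) (\<rho> (inv g) u)) Fl"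
      by (rule weak_limit)
    then have lim: "((\<lambda>i. inner (\<rho> (g \<otimes> \<pi> (\<theta> i) \<otimes> h) v) u) \<longlongrightarrow> inner (\<rho> g (?P (\<rho> h v))) u) Fl"
      using g h by (simp add: \<rho>_mult \<theta> \<rho>_adjoint[of g] m_assoc)
    have "\<forall>\<^sub>F i in Fl. dc (g \<otimes> \<pi> (\<theta> i) \<otimes> h) = dc x"
      unfolding eq by (intro mantle_prod_eventually g h dc_self)
    then have "\<forall>\<^sub>F i in Fl. inner (\<rho> (g \<otimes> \<pi> (\<theta> i) \<otimes> h) v) u = inner (\<rho> x v) u"
    proof eventually_elim
      case (elim i)
      have "g \<otimes> \<pi> (\<theta> i) \<otimes> h \<in> dc (g \<otimes> \<pi> (\<theta> i) \<otimes> h)"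
        by (rule dc_self) (simp add: g h \<theta>)
      then have "g \<otimes> \<pi> (\<theta> i) \<otimes> h \<in> dc x" by (simp only: elim)
      then show ?case by (rule inner_dc[OF x _ v u])
    qed
    from tendsto_cong[OF this] lim
    have "((\<lambda>i. inner (\<rho> x v) u) \<longlongrightarrow> inner (\<rho> g (?P (\<rho> h v))) u) Fl" by simp
    then show "inner (\<rho> x v) u = inner (\<rho> g (?P (\<rho> h v))) u"
      using Fl by (simp add: tendsto_const_iff)
  qed
  then show ?thesis using v P(1) by (simp add: compression_def)
qed

end

section \<open>Matrices differing from the identity in finitely many entries\<close>

lemma qcnj_simps [simp]:
  "qcnj (qcnj x) = x" "qcnj 0 = 0" "qcnj 1 = 1" "qcnj (x + y) = qcnj x + qcnj y"
  "qcnj (x * y) = qcnj y * qcnj x" "qcnj x = 0 \<longleftrightarrow> x = 0"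
  by (simp_all add: quat_eq_iff qcnj_def quat_sel_mult)

lemma qcnj_sum: "qcnj (sum f A) = (\<Sum>x\<in>A. qcnj (f x))"
  by (induction A rule: infinite_finite_induct) simp_all

lemma scalar_set_closed:
  "0 \<in> scalar_set F" "1 \<in> scalar_set F" "x \<in> scalar_set F \<Longrightarrow> y \<in> scalar_set F \<Longrightarrow> x + y \<in> scalar_set F"
  "x \<in> scalar_set F \<Longrightarrow> y \<in> scalar_set F \<Longrightarrow> x * y \<in> scalar_set F"
  "x \<in> scalar_set F \<Longrightarrow> qcnj x \<in> scalar_set F"
  by (cases F; simp add: quat_sel_mult qcnj_def)+

lemma scalar_set_sum: "(\<And>x. x \<in> A \<Longrightarrow> f x \<in> scalar_set F) \<Longrightarrow> sum f A \<in> scalar_set F"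
  by (induction A rule: infinite_finite_induct) (simp_all add: scalar_set_closed)

lemma scalar_mult_commute:
  "F \<noteq> Scal_H \<Longrightarrow> x \<in> scalar_set F \<Longrightarrow> y \<in> scalar_set F \<Longrightarrow> x * y = y * x"
  by (cases F) (simp_all add: quat_eq_iff quat_sel_mult)

text \<open>The basis vectors moved by \<open>A\<close> or occurring in the image of another basis
  vector; outside them \<open>A\<close> is the identity block.\<close>

definition msupp :: "mat \<Rightarrow> nat set" where
  "msupp A = {x. \<exists>y. A x y \<noteq> mat_one x y \<or> A y x \<noteq> mat_one y x}"

definition row_finite :: "mat \<Rightarrow> bool" where
  "row_finite A \<longleftrightarrow> (\<forall>x. finite {k. A x k \<noteq> 0})"

lemma off_msupp: "x \<notin> msupp A \<Longrightarrow> A x y = mat_one x y" "x \<notin> msupp A \<Longrightarrow> A y x = mat_one y x"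
  by (auto simp: msupp_def)

lemma finite_mats_iff:
  "A \<in> finite_mats F \<longleftrightarrow> (\<forall>x y. A x y \<in> scalar_set F) \<and> finite (msupp A)"
proof -
  let ?D = "{(x, y). A x y \<noteq> mat_one x y}"
  have eq: "msupp A = fst ` ?D \<union> snd ` ?D" by (force simp: msupp_def image_iff)
  have sub: "?D \<subseteq> msupp A \<times> msupp A" by (auto simp: msupp_def)
  have "finite ?D \<Longrightarrow> finite (msupp A)" unfolding eq by (intro finite_UnI finite_imageI)
  moreover have "finite (msupp A) \<Longrightarrow> finite ?D" by (rule finite_subset[OF sub]) (rule finite_SigmaI)
  ultimately have "finite ?D \<longleftrightarrow> finite (msupp A)" by blast
  then show ?thesis by (simp add: finite_mats_def)
qed

lemma finite_mats_rf:
  assumes "A \<in> finite_mats F"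
  shows "row_finite A"
proof -
  have "{k. A x k \<noteq> 0} \<subseteq> insert x (msupp A)" for x
    by (auto dest: off_msupp(2)[of _ A x] simp: mat_one_def split: if_splits)
  then show ?thesis
    using assms unfolding row_finite_def finite_mats_iff by (meson finite_insert finite_subset)
qed

lemma row_finite_one: "row_finite mat_one"
  by (simp add: row_finite_def mat_one_def)

lemma mat_mult_eq:
  assumes "finite S" "\<And>k. A x k \<noteq> 0 \<Longrightarrow> B k y \<noteq> 0 \<Longrightarrow> k \<in> S" "row_finite A"
  shows "(A *\<^sub>m B) x y = (\<Sum>k\<in>S. A x k * B k y)"
proof -
  let ?T = "{k. A x k \<noteq> 0} \<union> S"
  have "(A *\<^sub>m B) x y = (\<Sum>k\<in>?T. A x k * B k y)"
    unfolding mat_mult_def using assms by (intro sum.mono_neutral_left) (auto simp: row_finite_def)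
  also have "\<dots> = (\<Sum>k\<in>S. A x k * B k y)"
  proof (rule sum.mono_neutral_right)
    have "A x k * B k y = 0" if "k \<notin> S" for k
      using assms(2)[of k] that by (cases "A x k = 0"; cases "B k y = 0") auto
    then show "\<forall>k\<in>?T - S. A x k * B k y = 0" by blast
  qed (use assms in \<open>auto simp: row_finite_def\<close>)
  finally show ?thesis .
qed

lemma row_finite_mult:
  assumes "row_finite A" "row_finite B"
  shows "row_finite (A *\<^sub>m B)"
proof -
  have "{y. (A *\<^sub>m B) x y \<noteq> 0} \<subseteq> (\<Union>k\<in>{k. A x k \<noteq> 0}. {y. B k y \<noteq> 0})" for x
    by (auto simp: mat_mult_def intro!: sum.neutral)
  moreover have "finite (\<Union>k\<in>{k. A x k \<noteq> 0}. {y. B k y \<noteq> 0})" for x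
    using assms by (auto simp: row_finite_def)
  ultimately show ?thesis unfolding row_finite_def by (meson finite_subset)
qed

lemma mat_mult_assoc:
  assumes "row_finite A" "row_finite B"
  shows "(A *\<^sub>m B) *\<^sub>m C = A *\<^sub>m (B *\<^sub>m C)"
proof (intro ext)
  fix x y
  let ?S = "{k. A x k \<noteq> 0}"
  let ?T = "\<Union>k\<in>?S. {l. B k l \<noteq> 0}"
  have fin: "finite ?S" "finite ?T" using assms by (auto simp: row_finite_def)
  have sub: "l \<in> ?T" if "(A *\<^sub>m B) x l \<noteq> 0" for l
    using that by (rule contrapos_np) (auto simp: mat_mult_def intro!: sum.neutral)
  have "((A *\<^sub>m B) *\<^sub>m C) x y = (\<Sum>l\<in>?T. (A *\<^sub>m B) x l * C l y)"
    using fin sub assms by (intro mat_mult_eq) (auto simp: row_finite_mult)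
  also have "\<dots> = (\<Sum>l\<in>?T. \<Sum>k\<in>?S. A x k * B k l * C l y)"
    by (simp add: mat_mult_def sum_distrib_right)
  also have "\<dots> = (\<Sum>k\<in>?S. \<Sum>l\<in>?T. A x k * (B k l * C l y))"
    by (subst sum.swap) (simp add: mult.assoc)
  also have "\<dots> = (\<Sum>k\<in>?S. A x k * (B *\<^sub>m C) k y)"
  proof (rule sum.cong[OF refl])
    fix k assume "k \<in> ?S"
    then have "(B *\<^sub>m C) k y = (\<Sum>l\<in>?T. B k l * C l y)"
      using fin assms by (intro mat_mult_eq) auto
    then show "(\<Sum>l\<in>?T. A x k * (B k l * C l y)) = A x k * (B *\<^sub>m C) k y"
      by (simp add: sum_distrib_left)
  qed
  finally show "((A *\<^sub>m B) *\<^sub>m C) x y = (A *\<^sub>m (B *\<^sub>m C)) x y"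
    by (simp add: mat_mult_def)
qed

lemma mat_mult_left_off:
  assumes "x \<notin> msupp A"
  shows "(A *\<^sub>m B) x y = B x y"
proof -
  have "{k. A x k \<noteq> 0} = {x}"
    using off_msupp(1)[OF assms] by (auto simp: mat_one_def)
  then show ?thesis using off_msupp(1)[OF assms] by (simp add: mat_mult_def mat_one_def)
qed

lemma mat_mult_right_off:
  assumes "y \<notin> msupp B" "row_finite A"
  shows "(A *\<^sub>m B) x y = A x y"
proof -
  have B: "B k y = mat_one k y" for k using off_msupp(2)[OF assms(1)] .
  have "(A *\<^sub>m B) x y = (\<Sum>k\<in>{y}. A x k * B k y)"
    by (rule mat_mult_eq[OF _ _ assms(2)]) (auto simp: B mat_one_def split: if_splits)
  then show ?thesis by (simp add: B mat_one_def)
qed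

lemma msupp_one [simp]: "msupp mat_one = {}"
  by (simp add: msupp_def)

lemma mat_mult_one_left [simp]: "mat_one *\<^sub>m A = A"
  by (intro ext mat_mult_left_off) simp

lemma mat_mult_one_right [simp]: "row_finite A \<Longrightarrow> A *\<^sub>m mat_one = A"
  by (intro ext mat_mult_right_off) simp_all

lemma msupp_mult:
  assumes "row_finite A"
  shows "msupp (A *\<^sub>m B) \<subseteq> msupp A \<union> msupp B"
proof
  fix x assume "x \<in> msupp (A *\<^sub>m B)"
  show "x \<in> msupp A \<union> msupp B"
  proof (rule ccontr)
    assume "x \<notin> msupp A \<union> msupp B"
    then have x: "x \<notin> msupp A" "x \<notin> msupp B" by blast+
    have "(A *\<^sub>m B) x y = mat_one x y" "(A *\<^sub>m B) y x = mat_one y x" for y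
      unfolding mat_mult_left_off[OF x(1)] mat_mult_right_off[OF x(2) assms]
      by (rule off_msupp[OF x(2)], rule off_msupp[OF x(1)])
    then show False using \<open>x \<in> msupp (A *\<^sub>m B)\<close> by (simp add: msupp_def)
  qed
qed

lemma finite_mats_mult:
  assumes "A \<in> finite_mats F" "B \<in> finite_mats F"
  shows "A *\<^sub>m B \<in> finite_mats F"
proof -
  have "finite (msupp (A *\<^sub>m B))"
    using msupp_mult[OF finite_mats_rf[OF assms(1)], of B] assms
    by (meson finite_UnI finite_mats_iff finite_subset)
  then show ?thesis
    using assms by (auto simp: finite_mats_iff mat_mult_def intro!: scalar_set_sum scalar_set_closed)
qed

lemma finite_mats_one: "mat_one \<in> finite_mats F"
  by (simp add: finite_mats_iff) (simp add: mat_one_def scalar_set_closed)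

lemma mat_commute_disjoint:
  assumes AB: "row_finite A" "row_finite B" and dis: "msupp A \<inter> msupp B = {}"
  shows "A *\<^sub>m B = B *\<^sub>m A"
proof -
  have zero: "(A *\<^sub>m B) x y = mat_one x y"
    if "x \<in> msupp A" "y \<in> msupp B" "msupp A \<inter> msupp B = {}" for A B x y
  proof -
    have "A x k * B k y = 0" for k
    proof (cases "k \<in> msupp A")
      case True
      then have "B k y = mat_one k y" using that off_msupp(1) by blast
      moreover have "k \<noteq> y" using True that by blast
      ultimately show ?thesis by (simp add: mat_one_def)
    next
      case False
      then have "A x k = mat_one x k" using off_msupp(2) by blast
      moreover have "k \<noteq> x" using False that by blast
      ultimately show ?thesis by (simp add: mat_one_def)
    qed
    moreover have "x \<noteq> y" using that by blast
    ultimately show ?thesis by (simp add: mat_mult_def mat_one_def)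
  qed
  have "(A *\<^sub>m B) x y = (B *\<^sub>m A) x y" for x y
  proof (cases "x \<in> msupp A")
    case True
    then have "x \<notin> msupp B" using dis by blast
    then have "(B *\<^sub>m A) x y = A x y" by (rule mat_mult_left_off)
    moreover have "(A *\<^sub>m B) x y = A x y"
    proof (cases "y \<in> msupp B")
      case True
      then have "y \<notin> msupp A" using dis by blast
      then have "A x y = mat_one x y" by (rule off_msupp)
      then show ?thesis using zero[OF \<open>x \<in> msupp A\<close> True dis] by simp
    qed (simp add: mat_mult_right_off AB)
    ultimately show ?thesis by simp
  next
    case False
    then have 1: "(A *\<^sub>m B) x y = B x y" by (rule mat_mult_left_off)
    have "(B *\<^sub>m A) x y = B x y"
    proof (cases "y \<in> msupp A")
      case True
      then have y: "y \<notin> msupp B" using dis by blast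
      then have B: "B x y = mat_one x y" by (rule off_msupp)
      show ?thesis
      proof (cases "x \<in> msupp B")
        case True
        then show ?thesis using zero[OF True \<open>y \<in> msupp A\<close>] dis B by (simp add: Int_commute)
      next
        case False
        then show ?thesis
          using B off_msupp(1)[OF \<open>x \<notin> msupp A\<close>] by (simp add: mat_mult_left_off)
      qed
    qed (simp add: mat_mult_right_off AB)
    with 1 show ?thesis by simp
  qed
  then show ?thesis by blast
qed

section \<open>Matrix groups\<close>

lemma mat_monoid_simps [simp]:
  "carrier (mat_monoid S) = S" "x \<otimes>\<^bsub>mat_monoid S\<^esub> y = x *\<^sub>m y" "\<one>\<^bsub>mat_monoid S\<^esub> = mat_one"
  by (simp_all add: mat_monoid_def)

lemma general_linear_iff:
  "A \<in> general_linear F \<longleftrightarrow>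
     A \<in> finite_mats F \<and> (\<exists>B\<in>finite_mats F. B *\<^sub>m A = mat_one \<and> A *\<^sub>m B = mat_one)"
  by (auto simp: general_linear_def Units_def)

lemma general_linear_finite: "A \<in> general_linear F \<Longrightarrow> A \<in> finite_mats F"
  by (simp add: general_linear_iff)

lemma general_linear_rf: "A \<in> general_linear F \<Longrightarrow> row_finite A"
  using general_linear_finite finite_mats_rf by blast

lemma general_linear_mult:
  assumes "A \<in> general_linear F" "B \<in> general_linear F"
  shows "A *\<^sub>m B \<in> general_linear F"
proof -
  obtain A' B' where inv: "A' \<in> finite_mats F" "A' *\<^sub>m A = mat_one" "A *\<^sub>m A' = mat_one"
    "B' \<in> finite_mats F" "B' *\<^sub>m B = mat_one" "B *\<^sub>m B' = mat_one"
    using assms by (auto simp: general_linear_iff)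
  note rf = inv(1,4)[THEN finite_mats_rf] assms[THEN general_linear_rf]
  have "(B' *\<^sub>m A') *\<^sub>m (A *\<^sub>m B) = B' *\<^sub>m ((A' *\<^sub>m A) *\<^sub>m B)"
    by (simp only: mat_mult_assoc rf)
  moreover have "(A *\<^sub>m B) *\<^sub>m (B' *\<^sub>m A') = A *\<^sub>m ((B *\<^sub>m B') *\<^sub>m A')"
    by (simp only: mat_mult_assoc rf)
  ultimately show ?thesis
    using inv assms by (auto simp: general_linear_iff finite_mats_mult intro!: bexI[of _ "B' *\<^sub>m A'"])
qed

lemma general_linear_inverse:
  assumes "A \<in> general_linear F"
  obtains B where "B \<in> general_linear F" "B *\<^sub>m A = mat_one" "A *\<^sub>m B = mat_one"
  using assms by (auto simp: general_linear_iff)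

lemma general_linear_one: "mat_one \<in> general_linear F"
  by (auto simp: general_linear_iff finite_mats_one row_finite_one)

lemma group_mat_monoid:
  assumes S: "S \<subseteq> general_linear F" "mat_one \<in> S" "\<And>A B. A \<in> S \<Longrightarrow> B \<in> S \<Longrightarrow> A *\<^sub>m B \<in> S"
    and inv: "\<And>A B. A \<in> S \<Longrightarrow> B \<in> general_linear F \<Longrightarrow> B *\<^sub>m A = mat_one \<Longrightarrow> A *\<^sub>m B = mat_one \<Longrightarrow> B \<in> S"
  shows "group (mat_monoid S)"
proof (rule groupI)
  fix A B C assume "A \<in> carrier (mat_monoid S)" "B \<in> carrier (mat_monoid S)"
  then show "A \<otimes>\<^bsub>mat_monoid S\<^esub> B \<otimes>\<^bsub>mat_monoid S\<^esub> C = A \<otimes>\<^bsub>mat_monoid S\<^esub> (B \<otimes>\<^bsub>mat_monoid S\<^esub> C)"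
    using S(1) general_linear_rf by (auto intro!: mat_mult_assoc)
next
  fix A assume A: "A \<in> carrier (mat_monoid S)"
  then have "A \<in> general_linear F" using S(1) by auto
  then obtain B where "B \<in> general_linear F" "B *\<^sub>m A = mat_one" "A *\<^sub>m B = mat_one"
    by (rule general_linear_inverse)
  then show "\<exists>B\<in>carrier (mat_monoid S). B \<otimes>\<^bsub>mat_monoid S\<^esub> A = \<one>\<^bsub>mat_monoid S\<^esub>"
    using inv A by auto
qed (use S in auto)

lemma mat_adjoint_mult:
  assumes "A \<in> finite_mats F" "B \<in> finite_mats F"
  shows "mat_adjoint (A *\<^sub>m B) = mat_adjoint B *\<^sub>m mat_adjoint A"
proof (intro ext)
  fix x y
  have rf: "row_finite (mat_adjoint B)"
  proof -
    have "{k. mat_adjoint B x k \<noteq> 0} \<subseteq> insert x (msupp B)" for x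
      by (auto dest: off_msupp(1)[of _ B x] simp: mat_adjoint_def mat_one_def split: if_splits)
    then show ?thesis
      using assms unfolding row_finite_def finite_mats_iff by (meson finite_insert finite_subset)
  qed
  let ?S = "{k. A y k \<noteq> 0}"
  have fin: "finite ?S" using finite_mats_rf[OF assms(1)] by (simp add: row_finite_def)
  have "mat_adjoint (A *\<^sub>m B) x y = (\<Sum>k\<in>?S. mat_adjoint B x k * mat_adjoint A k y)"
    by (simp add: mat_adjoint_def mat_mult_def qcnj_sum)
  also have "\<dots> = (mat_adjoint B *\<^sub>m mat_adjoint A) x y"
    by (rule mat_mult_eq[OF fin _ rf, symmetric]) (simp add: mat_adjoint_def)
  finally show "mat_adjoint (A *\<^sub>m B) x y = (mat_adjoint B *\<^sub>m mat_adjoint A) x y" .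
qed

lemma msupp_adjoint: "msupp (mat_adjoint A) = msupp A"
proof -
  have "qcnj (A y x) = mat_one x y \<longleftrightarrow> A y x = mat_one y x" for x y
    by (auto simp: mat_one_def quat_eq_iff qcnj_def)
  then show ?thesis by (auto simp: msupp_def mat_adjoint_def)
qed

lemma finite_mats_adjoint: "A \<in> finite_mats F \<Longrightarrow> mat_adjoint A \<in> finite_mats F"
  by (auto simp: finite_mats_iff msupp_adjoint) (simp add: mat_adjoint_def scalar_set_closed)

lemma mat_adjoint_one [simp]: "mat_adjoint mat_one = mat_one"
  by (auto simp: mat_adjoint_def mat_one_def fun_eq_iff)

lemma finite_mats_cnj: "A \<in> finite_mats F \<Longrightarrow> mat_cnj A \<in> finite_mats F"
proof -
  have "qcnj (A x y) = mat_one x y \<longleftrightarrow> A x y = mat_one x y" for x y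
    by (auto simp: mat_one_def quat_eq_iff qcnj_def)
  then have "msupp (mat_cnj A) = msupp A" by (auto simp: msupp_def mat_cnj_def)
  then show "A \<in> finite_mats F \<Longrightarrow> mat_cnj A \<in> finite_mats F"
    by (auto simp: finite_mats_iff) (simp add: mat_cnj_def scalar_set_closed)
qed

lemma mat_cnj_mult:
  assumes "F \<noteq> Scal_H" "A \<in> finite_mats F" "B \<in> finite_mats F"
  shows "mat_cnj (A *\<^sub>m B) = mat_cnj A *\<^sub>m mat_cnj B"
proof (intro ext)
  fix x y
  have "qcnj (A x k * B k y) = qcnj (A x k) * qcnj (B k y)" for k
    using assms by (simp add: finite_mats_iff scalar_set_closed scalar_mult_commute[OF assms(1)])
  then show "mat_cnj (A *\<^sub>m B) x y = (mat_cnj A *\<^sub>m mat_cnj B) x y"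
    by (simp add: mat_cnj_def mat_mult_def qcnj_sum del: qcnj_simps(5))
qed

lemma mat_transpose_eq: "mat_transpose A = mat_cnj (mat_adjoint A)"
  by (simp add: mat_transpose_def mat_cnj_def mat_adjoint_def)

lemma mat_cnj_one [simp]: "mat_cnj mat_one = mat_one"
  by (auto simp: mat_cnj_def mat_one_def fun_eq_iff)

text \<open>The involution \<open>st\<close> stands for the adjoint or the transpose, so that both
  kinds of forms are treated at once.\<close>

definition isometries :: "scalars \<Rightarrow> (mat \<Rightarrow> mat) \<Rightarrow> mat \<Rightarrow> mat set" where
  "isometries F st J = {A \<in> general_linear F. st A *\<^sub>m J *\<^sub>m A = J}"

lemma group_isometries:
  assumes J: "row_finite J"
    and st: "\<And>A. A \<in> finite_mats F \<Longrightarrow> st A \<in> finite_mats F"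
      "\<And>A B. A \<in> finite_mats F \<Longrightarrow> B \<in> finite_mats F \<Longrightarrow> st (A *\<^sub>m B) = st B *\<^sub>m st A"
      "st mat_one = mat_one"
  shows "group (mat_monoid (isometries F st J))"
proof (rule group_mat_monoid)
  show "isometries F st J \<subseteq> general_linear F" by (auto simp: isometries_def)
  show "mat_one \<in> isometries F st J"
    by (simp add: isometries_def general_linear_one st J)
  fix A B assume A: "A \<in> isometries F st J"
  then have fA: "A \<in> finite_mats F" by (auto simp: isometries_def general_linear_finite)
  note rA = finite_mats_rf[OF fA] finite_mats_rf[OF st(1)[OF fA]]
  show "A *\<^sub>m B \<in> isometries F st J" if B: "B \<in> isometries F st J"
  proof -
    have fB: "B \<in> finite_mats F" using B by (auto simp: isometries_def general_linear_finite)
    note rB = finite_mats_rf[OF fB] finite_mats_rf[OF st(1)[OF fB]]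
    have "st (A *\<^sub>m B) *\<^sub>m J *\<^sub>m (A *\<^sub>m B) = st B *\<^sub>m (st A *\<^sub>m J *\<^sub>m A) *\<^sub>m B"
      by (simp only: st(2)[OF fA fB] mat_mult_assoc rA rB J row_finite_mult)
    then show ?thesis using A B by (simp add: isometries_def general_linear_mult)
  qed
  show "B \<in> isometries F st J"
    if B: "B \<in> general_linear F" "B *\<^sub>m A = mat_one" "A *\<^sub>m B = mat_one"
  proof -
    have fB: "B \<in> finite_mats F" using B by (simp add: general_linear_finite)
    note rB = finite_mats_rf[OF fB] finite_mats_rf[OF st(1)[OF fB]]
    have "st B *\<^sub>m (st A *\<^sub>m J *\<^sub>m A) *\<^sub>m B = st (A *\<^sub>m B) *\<^sub>m J *\<^sub>m (A *\<^sub>m B)"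
      by (simp only: st(2)[OF fA fB] mat_mult_assoc rA rB J row_finite_mult)
    then have "st B *\<^sub>m J *\<^sub>m B = J"
      using A B J by (simp add: isometries_def st)
    then show ?thesis using B by (simp add: isometries_def)
  qed
qed

lemma row_finite_diag: "row_finite (mat_diag d)"
proof -
  have "{k. mat_diag d x k \<noteq> 0} \<subseteq> {x}" for x by (auto simp: mat_diag_def)
  then show ?thesis unfolding row_finite_def by (meson finite.intros finite_subset)
qed

lemma row_finite_symplectic: "row_finite symplectic_form"
proof -
  have "{k. symplectic_form x k \<noteq> 0} \<subseteq> {x + 1, x - 1}" for x
    by (auto simp: symplectic_form_def)
  then show ?thesis unfolding row_finite_def by (meson finite.intros finite_subset)
qed

lemma group_sesquilinear:
  "row_finite J \<Longrightarrow> group (mat_monoid (sesquilinear_isometries F J))"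
  using group_isometries[of J F mat_adjoint]
  by (simp add: isometries_def sesquilinear_isometries_def finite_mats_adjoint mat_adjoint_mult)

lemma group_bilinear:
  assumes "row_finite J" "F \<noteq> Scal_H"
  shows "group (mat_monoid (bilinear_isometries F J))"
proof -
  have "mat_transpose (A *\<^sub>m B) = mat_transpose B *\<^sub>m mat_transpose A"
    if "A \<in> finite_mats F" "B \<in> finite_mats F" for A B
    unfolding mat_transpose_eq mat_adjoint_mult[OF that]
    by (rule mat_cnj_mult[OF assms(2) finite_mats_adjoint[OF that(2)] finite_mats_adjoint[OF that(1)]])
  moreover have "A \<in> finite_mats F \<Longrightarrow> mat_transpose A \<in> finite_mats F" for A
    unfolding mat_transpose_eq by (intro finite_mats_cnj finite_mats_adjoint)
  moreover have "mat_transpose mat_one = mat_one" by (simp add: mat_transpose_eq)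
  ultimately show ?thesis
    using group_isometries[of J F mat_transpose] assms
    by (simp add: isometries_def bilinear_isometries_def)
qed

lemma group_irr_classical: "group (mat_monoid (irr_classical_carrier c))"
proof -
  have "group (mat_monoid (general_linear F))" for F
    by (rule group_mat_monoid[of _ F]) (auto simp: general_linear_one general_linear_mult)
  then show ?thesis
    by (cases c) (auto intro!: group_sesquilinear group_bilinear row_finite_one row_finite_symplectic
        simp: sig_inf_inf_def sig_fin_inf_def skew_form_def row_finite_diag)
qed

lemma irr_classical_finite:
  assumes "A \<in> irr_classical_carrier c"
  shows "row_finite A" "finite (msupp A)"
proof -
  have "\<exists>F. A \<in> general_linear F"
    using assms by (cases c) (auto simp: sesquilinear_isometries_def bilinear_isometries_def)
  then show "row_finite A" "finite (msupp A)"
    using general_linear_finite general_linear_rf by (auto simp: finite_mats_iff)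
qed

lemma group_classical: "group (classical_group G)"
  unfolding classical_group_def by (intro product_group group_irr_classical)

lemma irr_heavy_carrier:
  "A \<in> carrier (irr_heavy_group h) \<longleftrightarrow>
     A \<in> general_linear (heavy_scalars h) \<and> mat_adjoint A *\<^sub>m A = mat_one"
  by (simp add: irr_heavy_group_def)

lemma group_irr_heavy: "group (irr_heavy_group h)"
proof -
  have "{A \<in> general_linear F. mat_adjoint A *\<^sub>m A = mat_one} = sesquilinear_isometries F mat_one" for F
  proof -
    have "mat_adjoint A *\<^sub>m mat_one = mat_adjoint A" if "A \<in> general_linear F" for A
      using that by (intro mat_mult_one_right finite_mats_rf[OF finite_mats_adjoint] general_linear_finite)
    then show ?thesis unfolding sesquilinear_isometries_def by auto
  qed
  then show ?thesis by (simp add: irr_heavy_group_def group_sesquilinear row_finite_one)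
qed

lemma group_heavy: "group (heavy_group L)"
  unfolding heavy_group_def by (intro product_group group_irr_heavy)

abbreviation heavy_elems :: "heavy list \<Rightarrow> (nat \<Rightarrow> mat) set" where
  "heavy_elems L \<equiv> carrier (heavy_group L)"

lemma heavy_carrier:
  "l \<in> heavy_elems L \<longleftrightarrow>
     l \<in> extensional {..<length L} \<and> (\<forall>j<length L. l j \<in> carrier (irr_heavy_group (L ! j)))"
  by (auto simp: heavy_group_def PiE_iff)

lemma heavy_component:
  assumes "l \<in> heavy_elems L" "j < length L"
  shows "l j \<in> finite_mats (heavy_scalars (L ! j))" "row_finite (l j)" "finite (msupp (l j))"
    "mat_adjoint (l j) *\<^sub>m l j = mat_one"
proof -
  have "l j \<in> carrier (irr_heavy_group (L ! j))" using assms by (simp add: heavy_carrier)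
  then show "l j \<in> finite_mats (heavy_scalars (L ! j))" "row_finite (l j)" "finite (msupp (l j))"
    "mat_adjoint (l j) *\<^sub>m l j = mat_one"
    using general_linear_finite general_linear_rf
    by (auto simp: irr_heavy_carrier finite_mats_iff)
qed

lemma heavy_mult:
  "j < length L \<Longrightarrow> (l \<otimes>\<^bsub>heavy_group L\<^esub> l') j = l j *\<^sub>m l' j"
  by (simp add: heavy_group_def irr_heavy_group_def)

lemma heavy_one: "j < length L \<Longrightarrow> \<one>\<^bsub>heavy_group L\<^esub> j = mat_one"
  by (simp add: heavy_group_def irr_heavy_group_def)

text \<open>For a unitary matrix, fixing a basis vector determines the column and, by unitarity, also
  the row.\<close>

lemma fixes_basis_vec_iff:
  assumes A: "row_finite A" "mat_adjoint A *\<^sub>m A = mat_one" "row_finite (mat_adjoint A)"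
  shows "mat_vec A (basis_vec \<xi>) = basis_vec \<xi> \<longleftrightarrow> \<xi> \<notin> msupp A"
proof -
  have col: "mat_vec A (basis_vec \<xi>) x = A x \<xi>" for x
  proof -
    have "mat_vec A (basis_vec \<xi>) x = (\<Sum>k\<in>{k. A x k \<noteq> 0}. if k = \<xi> then A x k else 0)"
      unfolding mat_vec_def basis_vec_def by (intro sum.cong) auto
    then show ?thesis using A(1) by (simp add: row_finite_def sum.delta)
  qed
  show ?thesis
  proof
    assume "mat_vec A (basis_vec \<xi>) = basis_vec \<xi>"
    then have c: "A x \<xi> = mat_one x \<xi>" for x
      using col by (metis basis_vec_def mat_one_def)
    have "(mat_adjoint A *\<^sub>m A) x \<xi> = (\<Sum>k\<in>{\<xi>}. mat_adjoint A x k * A k \<xi>)" for x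
      by (rule mat_mult_eq[OF _ _ A(3)]) (auto simp: c mat_one_def split: if_splits)
    then have "mat_one x \<xi> = (\<Sum>k\<in>{\<xi>}. mat_adjoint A x k * A k \<xi>)" for x
      unfolding A(2) .
    also have "(\<Sum>k\<in>{\<xi>}. mat_adjoint A x k * A k \<xi>) = qcnj (A \<xi> x)" for x
      by (simp add: c[of \<xi>], simp add: mat_adjoint_def mat_one_def)
    finally have e: "mat_one x \<xi> = qcnj (A \<xi> x)" for x .
    have "A \<xi> x = qcnj (mat_one x \<xi>)" for x unfolding e by simp
    then have "A \<xi> x = mat_one \<xi> x" for x by (simp add: mat_one_def)
    then show "\<xi> \<notin> msupp A" using c by (simp add: msupp_def)
  next
    assume "\<xi> \<notin> msupp A"
    then show "mat_vec A (basis_vec \<xi>) = basis_vec \<xi>"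
      unfolding fun_eq_iff col using off_msupp(2)[of \<xi> A] by (simp add: mat_one_def basis_vec_def)
  qed
qed

lemma heavy_stabilizer_iff:
  "l \<in> heavy_stabilizer L \<Xi> \<longleftrightarrow>
     l \<in> heavy_elems L \<and> (\<forall>j<length L. msupp (l j) \<inter> \<Xi> j = {})"
proof -
  have "mat_vec (l j) (basis_vec \<xi>) = basis_vec \<xi> \<longleftrightarrow> \<xi> \<notin> msupp (l j)"
    if "l \<in> heavy_elems L" "j < length L" for j \<xi>
    by (rule fixes_basis_vec_iff[OF heavy_component(2,4)[OF that]
          finite_mats_rf[OF finite_mats_adjoint[OF heavy_component(1)[OF that]]]])
  then show ?thesis by (auto simp: heavy_stabilizer_def)
qed

section \<open>Matrix representations of heavy groups\<close>

text \<open>A basis vector \<open>x\<close> can be moved by \<open>\<Phi> l\<close> only if \<open>l\<close> moves one of finitely many basis vectors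
  determined by \<open>x\<close>. This locality makes an element of the classical group commute with the images
  of all \<open>l\<close> that fix enough basis vectors.\<close>

abbreviation local_at :: "heavy list \<Rightarrow> ((nat \<Rightarrow> mat) \<Rightarrow> mat) \<Rightarrow> nat \<Rightarrow> bool" where
  "local_at L \<Phi> x \<equiv> \<exists>E. (\<forall>j. finite (E j)) \<and>
     (\<forall>l\<in>heavy_elems L. (\<forall>j<length L. msupp (l j) \<inter> E j = {}) \<longrightarrow> x \<notin> msupp (\<Phi> l))"

definition matrix_rep :: "heavy list \<Rightarrow> scalars \<Rightarrow> ((nat \<Rightarrow> mat) \<Rightarrow> mat) \<Rightarrow> bool" where
  "matrix_rep L F \<Phi> \<longleftrightarrow>
     (\<forall>l\<in>heavy_elems L. \<Phi> l \<in> finite_mats F \<and> mat_adjoint (\<Phi> l) *\<^sub>m \<Phi> l = mat_one \<and>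
        (\<forall>l'\<in>heavy_elems L. \<Phi> (l \<otimes>\<^bsub>heavy_group L\<^esub> l') = \<Phi> l *\<^sub>m \<Phi> l')) \<and>
     \<Phi> \<one>\<^bsub>heavy_group L\<^esub> = mat_one \<and>
     (\<forall>x. local_at L \<Phi> x)"

lemma matrix_repI:
  assumes "\<And>l. l \<in> heavy_elems L \<Longrightarrow> \<Phi> l \<in> finite_mats F"
    "\<And>l. l \<in> heavy_elems L \<Longrightarrow> mat_adjoint (\<Phi> l) *\<^sub>m \<Phi> l = mat_one"
    "\<And>l l'. l \<in> heavy_elems L \<Longrightarrow> l' \<in> heavy_elems L \<Longrightarrow>
       \<Phi> (l \<otimes>\<^bsub>heavy_group L\<^esub> l') = \<Phi> l *\<^sub>m \<Phi> l'"
    "\<Phi> \<one>\<^bsub>heavy_group L\<^esub> = mat_one"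
    "\<And>x. local_at L \<Phi> x"
  shows "matrix_rep L F \<Phi>"
  using assms unfolding matrix_rep_def by blast

lemma matrix_repD:
  assumes "matrix_rep L F \<Phi>" "l \<in> heavy_elems L"
  shows "\<Phi> l \<in> finite_mats F" "mat_adjoint (\<Phi> l) *\<^sub>m \<Phi> l = mat_one"
    "l' \<in> heavy_elems L \<Longrightarrow> \<Phi> (l \<otimes>\<^bsub>heavy_group L\<^esub> l') = \<Phi> l *\<^sub>m \<Phi> l'"
  using assms unfolding matrix_rep_def by blast+

lemma matrix_rep_one: "matrix_rep L F \<Phi> \<Longrightarrow> \<Phi> \<one>\<^bsub>heavy_group L\<^esub> = mat_one"
  unfolding matrix_rep_def by blast

lemma matrix_rep_local:
  assumes "matrix_rep L F \<Phi>"
  obtains E where "\<And>j. finite (E j)"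
    "\<And>l. l \<in> heavy_elems L \<Longrightarrow> (\<And>j. j < length L \<Longrightarrow> msupp (l j) \<inter> E j = {}) \<Longrightarrow> x \<notin> msupp (\<Phi> l)"
proof -
  have "local_at L \<Phi> x"
    using assms unfolding matrix_rep_def by blast
  then obtain E where "\<forall>j. finite (E j)"
     "\<forall>l\<in>heavy_elems L. (\<forall>j<length L. msupp (l j) \<inter> E j = {}) \<longrightarrow> x \<notin> msupp (\<Phi> l)" by blast
  then show ?thesis by (intro that[of E]) auto
qed

lemma matrix_rep_cong:
  assumes "matrix_rep L F \<Phi>" "\<And>l. l \<in> heavy_elems L \<Longrightarrow> \<Psi> l = \<Phi> l"
  shows "matrix_rep L F \<Psi>"
proof -
  interpret group "heavy_group L" by (rule group_heavy)
  show ?thesis using assms unfolding matrix_rep_def by simp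
qed

lemma matrix_rep_general_linear:
  assumes "matrix_rep L F \<Phi>" "l \<in> heavy_elems L"
  shows "\<Phi> l \<in> general_linear F"
proof -
  interpret group "heavy_group L" by (rule group_heavy)
  let ?l = "inv\<^bsub>heavy_group L\<^esub> l"
  have l: "?l \<in> heavy_elems L" using assms(2) by simp
  have "\<Phi> ?l *\<^sub>m \<Phi> l = mat_one" "\<Phi> l *\<^sub>m \<Phi> ?l = mat_one"
    using matrix_repD(3)[OF assms(1) l assms(2)] matrix_repD(3)[OF assms(1) assms(2) l] matrix_rep_one[OF assms(1)]
    by (simp_all add: assms(2))
  then show ?thesis
    using matrix_repD(1)[OF assms] matrix_repD(1)[OF assms(1) l] by (auto simp: general_linear_iff)
qed

lemma matrix_rep_component:
  assumes "j < length L"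
  shows "matrix_rep L (heavy_scalars (L ! j)) (\<lambda>l. l j)"
proof (rule matrix_repI)
  show "local_at L (\<lambda>l. l j) x" for x
    using assms by (intro exI[of _ "\<lambda>_. {x}"]) auto
qed (use assms heavy_component heavy_mult heavy_one in auto)

lemma matrix_rep_scalars:
  assumes "matrix_rep L F \<Phi>" "scalar_set F \<subseteq> scalar_set F'"
  shows "matrix_rep L F' \<Phi>"
  using assms unfolding matrix_rep_def finite_mats_iff by blast

section \<open>Replacing entries by blocks\<close>

definition expand :: "nat \<Rightarrow> (nat \<Rightarrow> nat \<Rightarrow> quat \<Rightarrow> quat) \<Rightarrow> mat \<Rightarrow> mat" where
  "expand n \<phi> A = (\<lambda>x y. \<phi> (x mod n) (y mod n) (A (x div n) (y div n)))"

text \<open>A \<open>*\<close>-homomorphism from the scalars to the \<open>n \<times> n\<close> matrices.\<close>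

definition scalar_rep :: "scalars \<Rightarrow> scalars \<Rightarrow> nat \<Rightarrow> (nat \<Rightarrow> nat \<Rightarrow> quat \<Rightarrow> quat) \<Rightarrow> bool" where
  "scalar_rep F F' n \<phi> \<longleftrightarrow> 0 < n \<and>
     (\<forall>s<n. \<forall>t<n. \<phi> s t 1 = (if s = t then 1 else 0) \<and>
        (\<forall>p\<in>scalar_set F. \<phi> s t p \<in> scalar_set F' \<and> \<phi> s t (qcnj p) = qcnj (\<phi> t s p) \<and>
           (\<forall>q\<in>scalar_set F. \<phi> s t (p + q) = \<phi> s t p + \<phi> s t q \<and>
              \<phi> s t (p * q) = (\<Sum>u<n. \<phi> s u p * \<phi> u t q))))"

context
  fixes F F' n \<phi>
  assumes \<phi>: "scalar_rep F F' n \<phi>"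
begin

lemma scalar_repD:
  "0 < n" "s < n \<Longrightarrow> t < n \<Longrightarrow> \<phi> s t 1 = (if s = t then 1 else 0)"
  "s < n \<Longrightarrow> t < n \<Longrightarrow> p \<in> scalar_set F \<Longrightarrow> \<phi> s t p \<in> scalar_set F'"
  "s < n \<Longrightarrow> t < n \<Longrightarrow> p \<in> scalar_set F \<Longrightarrow> \<phi> s t (qcnj p) = qcnj (\<phi> t s p)"
  "s < n \<Longrightarrow> t < n \<Longrightarrow> p \<in> scalar_set F \<Longrightarrow> q \<in> scalar_set F \<Longrightarrow> \<phi> s t (p + q) = \<phi> s t p + \<phi> s t q"
  "s < n \<Longrightarrow> t < n \<Longrightarrow> p \<in> scalar_set F \<Longrightarrow> q \<in> scalar_set F \<Longrightarrow>
     \<phi> s t (p * q) = (\<Sum>u<n. \<phi> s u p * \<phi> u t q)"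
  using \<phi> by (simp_all add: scalar_rep_def)

lemma scalar_rep_zero: "s < n \<Longrightarrow> t < n \<Longrightarrow> \<phi> s t 0 = 0"
  using scalar_repD(5)[of s t 0 0] by (simp add: scalar_set_closed)

lemma scalar_rep_sum:
  assumes "s < n" "t < n" "\<And>k. k \<in> A \<Longrightarrow> f k \<in> scalar_set F"
  shows "\<phi> s t (sum f A) = (\<Sum>k\<in>A. \<phi> s t (f k))"
  using assms(3)
  by (induction A rule: infinite_finite_induct)
    (simp_all add: scalar_rep_zero assms scalar_repD(5) scalar_set_sum)

lemma expand_one: "expand n \<phi> mat_one = mat_one"
proof (intro ext)
  fix x y
  have "x = y \<longleftrightarrow> x div n = y div n \<and> x mod n = y mod n" by (metis div_mult_mod_eq)
  then show "expand n \<phi> mat_one x y = mat_one x y"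
    using scalar_repD(1,2) by (auto simp: expand_def mat_one_def scalar_rep_zero)
qed

lemma msupp_expand: "x \<in> msupp (expand n \<phi> A) \<Longrightarrow> x div n \<in> msupp A"
proof (rule ccontr)
  assume x: "x \<in> msupp (expand n \<phi> A)" and "x div n \<notin> msupp A"
  note off = off_msupp(1)[OF this(2)] off_msupp(2)[OF this(2)]
  have "expand n \<phi> A x y = expand n \<phi> mat_one x y" "expand n \<phi> A y x = expand n \<phi> mat_one y x" for y
    unfolding expand_def off by (rule refl)+
  then show False using x unfolding expand_one by (simp add: msupp_def)
qed

lemma expand_finite:
  assumes "A \<in> finite_mats F"
  shows "expand n \<phi> A \<in> finite_mats F'"
proof -
  have "msupp (expand n \<phi> A) \<subseteq> (\<lambda>(a, s). a * n + s) ` (msupp A \<times> {..<n})"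
  proof
    fix x assume "x \<in> msupp (expand n \<phi> A)"
    then have "(x div n, x mod n) \<in> msupp A \<times> {..<n}" using msupp_expand scalar_repD(1) by simp
    then show "x \<in> (\<lambda>(a, s). a * n + s) ` (msupp A \<times> {..<n})"
      by (rule image_eqI[rotated]) simp
  qed
  moreover have "finite ((\<lambda>(a, s). a * n + s) ` (msupp A \<times> {..<n}))"
    using assms by (simp add: finite_mats_iff)
  ultimately have "finite (msupp (expand n \<phi> A))" by (rule finite_subset)
  then show ?thesis
    using assms scalar_repD(1) by (simp add: finite_mats_iff) (simp add: expand_def scalar_repD(3))
qed

lemma expand_mult:
  assumes A: "A \<in> finite_mats F" and B: "B \<in> finite_mats F"
  shows "expand n \<phi> (A *\<^sub>m B) = expand n \<phi> A *\<^sub>m expand n \<phi> B"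
proof (intro ext)
  fix x y
  let ?a = "x div n" and ?s = "x mod n" and ?b = "y div n" and ?t = "y mod n"
  have n: "0 < n" by (rule scalar_repD)
  then have st: "?s < n" "?t < n" by simp_all
  have sc: "A a b \<in> scalar_set F" "B a b \<in> scalar_set F" for a b
    using A B by (simp_all add: finite_mats_iff)
  let ?C = "{c. A ?a c \<noteq> 0}"
  let ?i = "\<lambda>(c, u). c * n + u"
  have C: "finite ?C" using finite_mats_rf[OF A] by (simp add: row_finite_def)
  have inj: "inj_on ?i (?C \<times> {..<n})"
  proof (rule inj_onI)
    fix p q assume pq: "p \<in> ?C \<times> {..<n}" "q \<in> ?C \<times> {..<n}" and eq: "?i p = ?i q"
    have "(?i p div n, ?i p mod n) = p" "(?i q div n, ?i q mod n) = q" using pq by auto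
    then show "p = q" unfolding eq by simp
  qed
  have mem: "k \<in> ?i ` (?C \<times> {..<n})" if "expand n \<phi> A x k \<noteq> 0" for k
  proof -
    have "A ?a (k div n) \<noteq> 0"
      using that n st by (auto simp: expand_def scalar_rep_zero)
    then show ?thesis using n by (intro image_eqI[of _ _ "(k div n, k mod n)"]) simp_all
  qed
  have "(expand n \<phi> A *\<^sub>m expand n \<phi> B) x y
      = (\<Sum>k\<in>?i ` (?C \<times> {..<n}). expand n \<phi> A x k * expand n \<phi> B k y)"
    by (rule mat_mult_eq) (use C mem finite_mats_rf[OF expand_finite[OF A]] in auto)
  also have "\<dots> = (\<Sum>p\<in>?C \<times> {..<n}. expand n \<phi> A x (?i p) * expand n \<phi> B (?i p) y)"
    by (rule sum.reindex[OF inj, unfolded comp_def])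
  also have "\<dots> = (\<Sum>(c, u)\<in>?C \<times> {..<n}. \<phi> ?s u (A ?a c) * \<phi> u ?t (B c ?b))"
    by (rule sum.cong[OF refl]) (auto simp: expand_def)
  also have "\<dots> = (\<Sum>c\<in>?C. \<Sum>u<n. \<phi> ?s u (A ?a c) * \<phi> u ?t (B c ?b))"
    by (rule sum.cartesian_product[symmetric])
  also have "\<dots> = (\<Sum>c\<in>?C. \<phi> ?s ?t (A ?a c * B c ?b))"
    by (simp add: scalar_repD(6) st sc)
  also have "\<dots> = \<phi> ?s ?t (\<Sum>c\<in>?C. A ?a c * B c ?b)"
    by (rule scalar_rep_sum[symmetric]) (simp_all add: n sc scalar_set_closed)
  also have "\<dots> = expand n \<phi> (A *\<^sub>m B) x y"
    by (simp add: expand_def mat_mult_def)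
  finally show "expand n \<phi> (A *\<^sub>m B) x y = (expand n \<phi> A *\<^sub>m expand n \<phi> B) x y" ..
qed

lemma expand_adjoint:
  assumes "A \<in> finite_mats F"
  shows "mat_adjoint (expand n \<phi> A) = expand n \<phi> (mat_adjoint A)"
  using assms scalar_repD(1) by (simp add: expand_def mat_adjoint_def scalar_repD(4) finite_mats_iff)

lemma matrix_rep_expand:
  assumes "matrix_rep L F \<Phi>"
  shows "matrix_rep L F' (\<lambda>l. expand n \<phi> (\<Phi> l))"
proof (rule matrix_repI)
  note D = matrix_repD[OF assms]
  fix l assume l: "l \<in> heavy_elems L"
  show "expand n \<phi> (\<Phi> l) \<in> finite_mats F'" by (intro expand_finite D l)
  show "mat_adjoint (expand n \<phi> (\<Phi> l)) *\<^sub>m expand n \<phi> (\<Phi> l) = mat_one"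
    by (simp add: expand_adjoint expand_mult[symmetric] finite_mats_adjoint D l expand_one)
  show "expand n \<phi> (\<Phi> (l \<otimes>\<^bsub>heavy_group L\<^esub> l')) = expand n \<phi> (\<Phi> l) *\<^sub>m expand n \<phi> (\<Phi> l')"
    if "l' \<in> heavy_elems L" for l'
    by (simp add: D(3) expand_mult D(1) l that)
next
  show "expand n \<phi> (\<Phi> \<one>\<^bsub>heavy_group L\<^esub>) = mat_one"
    by (simp add: matrix_rep_one[OF assms] expand_one)
  fix x
  obtain E where "\<And>j. finite (E j)" "\<And>l. l \<in> heavy_elems L \<Longrightarrow>
      (\<And>j. j < length L \<Longrightarrow> msupp (l j) \<inter> E j = {}) \<Longrightarrow> x div n \<notin> msupp (\<Phi> l)"
    by (rule matrix_rep_local[OF assms, where x = "x div n"]) blast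
  then show "local_at L (\<lambda>l. expand n \<phi> (\<Phi> l)) x"
    by (intro exI[of _ E]) (auto dest!: msupp_expand)
qed

end

section \<open>Block diagonal matrices\<close>

lemma block_diag_in:
  assumes "disjoint_blocks N \<beta>" "j < N"
  shows "block_diag N \<beta> B (\<beta> j a) (\<beta> j b) = B j a b"
proof -
  have inj: "inj (\<beta> j)" using assms by (simp add: disjoint_blocks_def)
  have "(THE i. i < N \<and> \<beta> j a \<in> range (\<beta> i)) = j"
  proof (rule the_equality)
    show "j < N \<and> \<beta> j a \<in> range (\<beta> j)" using assms by simp
    fix i assume i: "i < N \<and> \<beta> j a \<in> range (\<beta> i)"
    show "i = j"
    proof (rule ccontr)
      assume "i \<noteq> j"
      then have "range (\<beta> i) \<inter> range (\<beta> j) = {}"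
        using assms i by (auto simp: disjoint_blocks_def disjoint_family_on_def)
      then show False using i by blast
    qed
  qed
  moreover have "\<exists>j'<N. \<beta> j a \<in> range (\<beta> j') \<and> \<beta> j b \<in> range (\<beta> j')" using assms by blast
  ultimately show ?thesis by (simp add: block_diag_def inj)
qed

lemma block_diag_off:
  assumes "\<And>j a b. j < N \<Longrightarrow> x = \<beta> j a \<Longrightarrow> y = \<beta> j b \<Longrightarrow> False"
  shows "block_diag N \<beta> B x y = mat_one x y"
proof -
  have "\<not> (\<exists>j<N. x \<in> range (\<beta> j) \<and> y \<in> range (\<beta> j))" using assms by blast
  then show ?thesis unfolding block_diag_def by (rule if_not_P)
qed

lemma block_diag_cases:
  obtains j a b where "j < N" "x = \<beta> j a" "y = \<beta> j b"
  | "\<And>j a b. j < N \<Longrightarrow> x = \<beta> j a \<Longrightarrow> y = \<beta> j b \<Longrightarrow> False"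
  by blast

lemma block_diag_one:
  assumes \<beta>: "disjoint_blocks N \<beta>" and "\<And>j. j < N \<Longrightarrow> B j = mat_one"
  shows "block_diag N \<beta> B = mat_one"
proof (intro ext)
  fix x y
  show "block_diag N \<beta> B x y = mat_one x y"
  proof (cases rule: block_diag_cases[where N = N and \<beta> = \<beta> and x = x and y = y])
    case (1 j a b)
    have "inj (\<beta> j)" using \<beta> 1 by (simp add: disjoint_blocks_def)
    then show ?thesis using 1 assms(2) by (simp add: block_diag_in[OF \<beta>] mat_one_def inj_eq)
  qed (rule block_diag_off)
qed

lemma msupp_block_diag:
  assumes \<beta>: "disjoint_blocks N \<beta>"
  shows "msupp (block_diag N \<beta> B) \<subseteq> (\<Union>j<N. \<beta> j ` msupp (B j))"
proof
  fix x assume x: "x \<in> msupp (block_diag N \<beta> B)"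
  then obtain y where "block_diag N \<beta> B x y \<noteq> mat_one x y \<or> block_diag N \<beta> B y x \<noteq> mat_one y x"
    by (auto simp: msupp_def)
  then obtain j a b where j: "j < N" "x = \<beta> j a" "y = \<beta> j b"
    using block_diag_off[of N x \<beta> y B] block_diag_off[of N y \<beta> x B] by blast
  have "inj (\<beta> j)" using \<beta> j by (simp add: disjoint_blocks_def)
  then have "B j a b \<noteq> mat_one a b \<or> B j b a \<noteq> mat_one b a"
    using \<open>block_diag N \<beta> B x y \<noteq> mat_one x y \<or> block_diag N \<beta> B y x \<noteq> mat_one y x\<close> j
    by (simp add: block_diag_in[OF \<beta>] mat_one_def inj_eq)
  then have "a \<in> msupp (B j)" by (auto simp: msupp_def)
  then show "x \<in> (\<Union>j<N. \<beta> j ` msupp (B j))" using j by blast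
qed

lemma block_diag_adjoint:
  assumes \<beta>: "disjoint_blocks N \<beta>"
  shows "mat_adjoint (block_diag N \<beta> B) = block_diag N \<beta> (\<lambda>j. mat_adjoint (B j))"
proof (intro ext)
  fix x y
  show "mat_adjoint (block_diag N \<beta> B) x y = block_diag N \<beta> (\<lambda>j. mat_adjoint (B j)) x y"
  proof (cases rule: block_diag_cases[where N = N and \<beta> = \<beta> and x = x and y = y])
    case (1 j a b)
    then show ?thesis by (simp add: mat_adjoint_def block_diag_in[OF \<beta>])
  next
    case 2
    have "block_diag N \<beta> B y x = mat_one y x" by (rule block_diag_off) (rule 2)
    moreover have "block_diag N \<beta> (\<lambda>j. mat_adjoint (B j)) x y = mat_one x y" by (rule block_diag_off) (rule 2)
    ultimately show ?thesis by (simp add: mat_adjoint_def mat_one_def)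
  qed
qed

lemma block_diag_mult:
  assumes \<beta>: "disjoint_blocks N \<beta>"
  shows "block_diag N \<beta> (\<lambda>j. B j *\<^sub>m B' j) = block_diag N \<beta> B *\<^sub>m block_diag N \<beta> B'"
proof (intro ext)
  fix x y
  show "block_diag N \<beta> (\<lambda>j. B j *\<^sub>m B' j) x y = (block_diag N \<beta> B *\<^sub>m block_diag N \<beta> B') x y"
  proof (cases "\<exists>j<N. x \<in> range (\<beta> j)")
    case False
    then have "x \<notin> msupp (block_diag N \<beta> B)" using msupp_block_diag[OF \<beta>, of B] by blast
    then have "(block_diag N \<beta> B *\<^sub>m block_diag N \<beta> B') x y = block_diag N \<beta> B' x y"
      by (rule mat_mult_left_off)
    moreover have "block_diag N \<beta> C x y = mat_one x y" for C
      using False by (intro block_diag_off) blast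
    ultimately show ?thesis by simp
  next
    case True
    then obtain j a where j: "j < N" "x = \<beta> j a" by blast
    have inj: "inj (\<beta> j)" using \<beta> j by (simp add: disjoint_blocks_def)
    have sub: "k \<in> range (\<beta> j)" if "block_diag N \<beta> C x k \<noteq> 0" for C k
    proof (rule ccontr)
      assume k: "k \<notin> range (\<beta> j)"
      have "block_diag N \<beta> C x k = mat_one x k"
      proof (rule block_diag_off)
        fix i c d assume i: "i < N" "x = \<beta> i c" "k = \<beta> i d"
        then have "i \<noteq> j" using k by blast
        then have "range (\<beta> i) \<inter> range (\<beta> j) = {}"
          using \<beta> i j by (auto simp: disjoint_blocks_def disjoint_family_on_def)
        then show False using i j by blast
      qed
      moreover have "x \<noteq> k" using j k by blast
      ultimately show False using that by (simp add: mat_one_def)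
    qed
    have "{k. block_diag N \<beta> B x k \<noteq> 0} = \<beta> j ` {c. B j a c \<noteq> 0}"
    proof (intro equalityI subsetI)
      fix k assume k: "k \<in> {k. block_diag N \<beta> B x k \<noteq> 0}"
      then obtain c where c: "k = \<beta> j c" using sub by blast
      then show "k \<in> \<beta> j ` {c. B j a c \<noteq> 0}"
        using k j by (simp add: block_diag_in[OF \<beta>])
    qed (use j in \<open>auto simp: block_diag_in[OF \<beta>]\<close>)
    then have eq: "(block_diag N \<beta> B *\<^sub>m block_diag N \<beta> B') x y
        = (\<Sum>c | B j a c \<noteq> 0. B j a c * block_diag N \<beta> B' (\<beta> j c) y)"
      using inj j by (simp add: mat_mult_def sum.reindex inj_on_def block_diag_in[OF \<beta>])
    show ?thesis
    proof (cases "y \<in> range (\<beta> j)")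
      case True
      then obtain b where "y = \<beta> j b" by blast
      then show ?thesis unfolding eq using j by (simp add: block_diag_in[OF \<beta>] mat_mult_def)
    next
      case False
      have "block_diag N \<beta> C (\<beta> j c) y = 0" for C c
      proof (cases rule: block_diag_cases[where N = N and \<beta> = \<beta> and x = "\<beta> j c" and y = y])
        case (1 i d e)
        then have "i \<noteq> j" using False by blast
        then have "range (\<beta> i) \<inter> range (\<beta> j) = {}"
          using \<beta> 1 j by (auto simp: disjoint_blocks_def disjoint_family_on_def)
        then show ?thesis using 1 by blast
      next
        case 2
        then have "block_diag N \<beta> C (\<beta> j c) y = mat_one (\<beta> j c) y" by (rule block_diag_off)
        then show ?thesis using False by (auto simp: mat_one_def)
      qed
      then show ?thesis unfolding eq by (simp add: j(2))
    qed
  qed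
qed

lemma block_diag_finite:
  assumes \<beta>: "disjoint_blocks N \<beta>" and B: "\<And>j. j < N \<Longrightarrow> B j \<in> finite_mats F"
  shows "block_diag N \<beta> B \<in> finite_mats F"
proof -
  have "finite (\<Union>j<N. \<beta> j ` msupp (B j))" using B by (auto simp: finite_mats_iff)
  then have "finite (msupp (block_diag N \<beta> B))" using msupp_block_diag[OF \<beta>] finite_subset by blast
  moreover have "block_diag N \<beta> B x y \<in> scalar_set F" for x y
  proof (cases rule: block_diag_cases[where N = N and \<beta> = \<beta> and x = x and y = y])
    case (1 j a b)
    then show ?thesis using B by (simp add: block_diag_in[OF \<beta>] finite_mats_iff)
  next
    case 2
    then have "block_diag N \<beta> B x y = mat_one x y" by (rule block_diag_off)
    then show ?thesis by (simp add: mat_one_def scalar_set_closed)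
  qed
  ultimately show ?thesis by (simp add: finite_mats_iff)
qed

lemma block_diag_cong:
  assumes "disjoint_blocks N \<beta>" "\<And>j. j < N \<Longrightarrow> B j = C j"
  shows "block_diag N \<beta> B = block_diag N \<beta> C"
proof (intro ext)
  fix x y
  show "block_diag N \<beta> B x y = block_diag N \<beta> C x y"
  proof (cases rule: block_diag_cases[where N = N and \<beta> = \<beta> and x = x and y = y])
    case 2
    then have "block_diag N \<beta> D x y = mat_one x y" for D by (rule block_diag_off)
    then show ?thesis by simp
  qed (simp add: block_diag_in[OF assms(1)] assms(2))
qed

lemma matrix_rep_block_diag:
  assumes \<beta>: "disjoint_blocks N \<beta>" and \<Phi>: "\<And>j. j < N \<Longrightarrow> matrix_rep L F (\<Phi> j)"
  shows "matrix_rep L F (\<lambda>l. block_diag N \<beta> (\<lambda>j. \<Phi> j l))"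
proof (rule matrix_repI)
  note D = matrix_repD[OF \<Phi>]
  fix l assume l: "l \<in> heavy_elems L"
  show "block_diag N \<beta> (\<lambda>j. \<Phi> j l) \<in> finite_mats F" by (intro block_diag_finite \<beta> D l)
  show "mat_adjoint (block_diag N \<beta> (\<lambda>j. \<Phi> j l)) *\<^sub>m block_diag N \<beta> (\<lambda>j. \<Phi> j l) = mat_one"
    unfolding block_diag_adjoint[OF \<beta>] block_diag_mult[OF \<beta>, symmetric]
    by (intro block_diag_one \<beta> D l)
  show "block_diag N \<beta> (\<lambda>j. \<Phi> j (l \<otimes>\<^bsub>heavy_group L\<^esub> l'))
      = block_diag N \<beta> (\<lambda>j. \<Phi> j l) *\<^sub>m block_diag N \<beta> (\<lambda>j. \<Phi> j l')"
    if "l' \<in> heavy_elems L" for l'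
    unfolding block_diag_mult[OF \<beta>, symmetric] by (intro block_diag_cong \<beta> D l that)
next
  show "block_diag N \<beta> (\<lambda>j. \<Phi> j \<one>\<^bsub>heavy_group L\<^esub>) = mat_one"
    by (intro block_diag_one \<beta> matrix_rep_one[OF \<Phi>])
  fix x
  have "\<exists>E. (\<forall>i. finite (E i)) \<and> (\<forall>l\<in>heavy_elems L.
      (\<forall>i<length L. msupp (l i) \<inter> E i = {}) \<longrightarrow> x \<notin> \<beta> j ` msupp (\<Phi> j l))" if j: "j < N" for j
  proof (cases "x \<in> range (\<beta> j)")
    case True
    then obtain a where a: "x = \<beta> j a" by blast
    have inj: "inj (\<beta> j)" using \<beta> j by (simp add: disjoint_blocks_def)
    obtain E where "\<And>i. finite (E i)" "\<And>l. l \<in> heavy_elems L \<Longrightarrow>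
        (\<And>i. i < length L \<Longrightarrow> msupp (l i) \<inter> E i = {}) \<Longrightarrow> a \<notin> msupp (\<Phi> j l)"
      by (rule matrix_rep_local[OF \<Phi>[OF j], where x = a]) blast
    then show ?thesis unfolding a inj_image_mem_iff[OF inj] by (intro exI[of _ E]) blast
  next
    case False
    then show ?thesis by (intro exI[of _ "\<lambda>_. {}"]) auto
  qed
  then obtain E where E: "\<And>j i. j < N \<Longrightarrow> finite (E j i)"
    "\<And>j l. j < N \<Longrightarrow> l \<in> heavy_elems L \<Longrightarrow>
      (\<forall>i<length L. msupp (l i) \<inter> E j i = {}) \<Longrightarrow> x \<notin> \<beta> j ` msupp (\<Phi> j l)"
    by metis
  have "x \<notin> msupp (block_diag N \<beta> (\<lambda>j. \<Phi> j l))"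
    if l: "l \<in> heavy_elems L" and dis: "\<forall>i<length L. msupp (l i) \<inter> (\<Union>j<N. E j i) = {}" for l
  proof
    assume "x \<in> msupp (block_diag N \<beta> (\<lambda>j. \<Phi> j l))"
    then obtain j where j: "j < N" "x \<in> \<beta> j ` msupp (\<Phi> j l)" using msupp_block_diag[OF \<beta>] by blast
    have "\<forall>i<length L. msupp (l i) \<inter> E j i = {}" using dis j(1) by blast
    then show False using E(2)[OF j(1) l] j(2) by blast
  qed
  then show "local_at L (\<lambda>l. block_diag N \<beta> (\<lambda>j. \<Phi> j l)) x"
    using E(1) by (intro exI[of _ "\<lambda>i. \<Union>j<N. E j i"]) auto
qed

section \<open>The embedding of the heavy group\<close>

lemma all_less_2: "(\<forall>s<2. P s) \<longleftrightarrow> P 0 \<and> P (1::nat)"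
  by (auto simp: less_2_cases_iff)

lemma all_less_4: "(\<forall>s<4. P s) \<longleftrightarrow> P 0 \<and> P 1 \<and> P 2 \<and> P (3::nat)"
proof -
  have "s < 4 \<longleftrightarrow> s = 0 \<or> s = 1 \<or> s = 2 \<or> s = 3" for s :: nat by auto
  then show ?thesis by auto
qed

lemma sum_less_2: "(\<Sum>u<2. f u) = f 0 + f (1::nat)"
  by (simp add: numeral_2_eq_2)

lemma sum_less_4: "(\<Sum>u<4. f u) = f 0 + f 1 + f 2 + f (3::nat)"
  by (simp add: eval_nat_numeral)

lemma quat_of_real_sel [simp]:
  "qRe (of_real r) = r" "qI (of_real r) = 0" "qJ (of_real r) = 0" "qK (of_real r) = 0"
  by (simp_all add: of_real_def)

lemma qcnj_of_real [simp]: "qcnj (of_real r) = of_real r"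
  by (simp add: quat_eq_iff qcnj_def)

lemma qcnj_sel [simp]: "qRe (qcnj x) = qRe x" "qI (qcnj x) = - qI x" "qJ (qcnj x) = - qJ x" "qK (qcnj x) = - qK x"
  by (simp_all add: qcnj_def)

lemma qcoord_sel: "qcoord 0 q = qRe q" "qcoord 1 q = qI q" "qcoord 2 q = qJ q" "qcoord 3 q = qK q"
  "qcoord (Suc 0) q = qI q"
  by (simp_all add: qcoord_def)

lemma qbasis_nth: "qbasis 0 = Quat 1 0 0 0" "qbasis 1 = Quat 0 1 0 0" "qbasis (Suc 0) = Quat 0 1 0 0"
  "qbasis 2 = Quat 0 0 1 0" "qbasis 3 = Quat 0 0 0 1"
  by (simp_all add: qbasis_def)

definition realify_entry :: "nat \<Rightarrow> nat \<Rightarrow> quat \<Rightarrow> quat" where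
  "realify_entry s t q = of_real (qcoord s (q * qbasis t))"

definition complexify_entry :: "nat \<Rightarrow> nat \<Rightarrow> quat \<Rightarrow> quat" where
  "complexify_entry s t q =
     (if s = 0 then (if t = 0 then Quat (qRe q) (qI q) 0 0 else Quat (qJ q) (qK q) 0 0)
      else (if t = 0 then Quat (- qJ q) (qK q) 0 0 else Quat (qRe q) (- qI q) 0 0))"

lemma realify_expand: "realify n = expand n realify_entry"
  by (simp add: fun_eq_iff realify_def expand_def realify_entry_def)

lemma complexify_expand: "complexify = expand 2 complexify_entry"
  by (auto simp: fun_eq_iff complexify_def expand_def complexify_entry_def Let_def qcnj_def
      uminus_quat_def even_iff_mod_2_eq_zero)

lemma mat_cnj_expand: "mat_cnj = expand 1 (\<lambda>_ _. qcnj)"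
  by (simp add: fun_eq_iff mat_cnj_def expand_def)

text \<open>These are the regular representations of the complex numbers and the quaternions on
  real vectors, and the standard embedding of the quaternions into complex matrices.\<close>

lemma scalar_rep_realify_2: "scalar_rep Scal_C Scal_R 2 realify_entry"
  unfolding scalar_rep_def all_less_2 sum_less_2 realify_entry_def quat_eq_iff
  by (simp add: qcoord_sel qbasis_nth quat_sel_mult algebra_simps)

lemma scalar_rep_realify_4: "scalar_rep Scal_H Scal_R 4 realify_entry"
  unfolding scalar_rep_def all_less_4 sum_less_4 realify_entry_def quat_eq_iff
  by (simp add: qcoord_sel qbasis_nth quat_sel_mult algebra_simps)

lemma scalar_rep_complexify: "scalar_rep Scal_H Scal_C 2 complexify_entry"
  unfolding scalar_rep_def all_less_2 sum_less_2 complexify_entry_def quat_eq_iff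
  by (simp add: quat_sel_mult algebra_simps)

lemma scalar_rep_cnj: "scalar_rep Scal_C Scal_C 1 (\<lambda>_ _. qcnj)"
  unfolding scalar_rep_def quat_eq_iff by (simp add: quat_sel_mult algebra_simps)

lemma matrix_rep_trivial_hom:
  assumes "matrix_rep L (heavy_scalars h) \<Phi>" "\<tau> \<in> trivial_homs h h'"
  shows "matrix_rep L (heavy_scalars h') (\<lambda>l. \<tau> (\<Phi> l))"
  using assms
  by (cases h; cases h')
    (auto simp: realify_expand complexify_expand mat_cnj_expand
      intro: matrix_rep_expand[OF scalar_rep_realify_2] matrix_rep_expand[OF scalar_rep_realify_4]
        matrix_rep_expand[OF scalar_rep_complexify] matrix_rep_expand[OF scalar_rep_cnj, unfolded One_nat_def]
        matrix_rep_scalars)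

lemma matrix_rep_straight_hom:
  assumes "straight_hom_irr L h \<sigma>"
  shows "matrix_rep L (heavy_scalars h) \<sigma>"
proof -
  obtain N \<beta> m \<tau> where \<beta>: "disjoint_blocks N \<beta>"
    and m: "\<And>j. j < N \<Longrightarrow> m j < length L" "\<And>j. j < N \<Longrightarrow> \<tau> j \<in> trivial_homs (L ! m j) h"
    and \<sigma>: "\<And>g. g \<in> heavy_elems L \<Longrightarrow> \<sigma> g = block_diag N \<beta> (\<lambda>j. \<tau> j (g (m j)))"
    using assms unfolding straight_hom_irr_def by blast
  have "matrix_rep L (heavy_scalars h) (\<lambda>l. \<tau> j (l (m j)))" if "j < N" for j
    by (rule matrix_rep_trivial_hom[OF matrix_rep_component[OF m(1)[OF that]] m(2)[OF that]])
  from matrix_rep_block_diag[OF \<beta> this] show ?thesis by (rule matrix_rep_cong) (auto simp: \<sigma>)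
qed

lemma sesquilinear_isometriesI:
  assumes A: "A \<in> general_linear F" "mat_adjoint A *\<^sub>m A = mat_one"
    and J: "row_finite J" "A *\<^sub>m J = J *\<^sub>m A"
  shows "A \<in> sesquilinear_isometries F J"
proof -
  have rf: "row_finite A" "row_finite (mat_adjoint A)"
    using A general_linear_finite finite_mats_adjoint finite_mats_rf by blast+
  have "mat_adjoint A *\<^sub>m J *\<^sub>m A = mat_adjoint A *\<^sub>m (A *\<^sub>m J)"
    by (simp add: mat_mult_assoc rf J)
  also have "\<dots> = (mat_adjoint A *\<^sub>m A) *\<^sub>m J"
    by (rule mat_mult_assoc[OF rf(2,1), symmetric])
  finally show ?thesis using A by (simp add: sesquilinear_isometries_def)
qed

lemma real_isometries: "sesquilinear_isometries Scal_R J = bilinear_isometries Scal_R J"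
proof -
  have "mat_adjoint A = mat_transpose A" if "A \<in> general_linear Scal_R" for A
    using general_linear_finite[OF that]
    by (simp add: fun_eq_iff mat_adjoint_def mat_transpose_def finite_mats_iff quat_eq_iff)
  then show ?thesis by (auto simp: sesquilinear_isometries_def bilinear_isometries_def)
qed

lemma mat_diag_commute:
  assumes "row_finite A" "\<And>x y. A x y * d y = d x * A x y"
  shows "A *\<^sub>m mat_diag d = mat_diag d *\<^sub>m A"
proof (intro ext)
  fix x y
  have "(A *\<^sub>m mat_diag d) x y = (\<Sum>k\<in>{y}. A x k * mat_diag d k y)"
    by (rule mat_mult_eq) (auto simp: assms(1) mat_diag_def split: if_splits)
  moreover have "(mat_diag d *\<^sub>m A) x y = (\<Sum>k\<in>{x}. mat_diag d x k * A k y)"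
    by (rule mat_mult_eq[OF _ _ row_finite_diag]) (auto simp: mat_diag_def split: if_splits)
  ultimately show "(A *\<^sub>m mat_diag d) x y = (mat_diag d *\<^sub>m A) x y"
    by (simp add: mat_diag_def assms(2))
qed

lemma symplectic_left:
  "(symplectic_form *\<^sub>m A) (2 * a) y = A (2 * a + 1) y"
  "(symplectic_form *\<^sub>m A) (2 * a + 1) y = - A (2 * a) y"
proof -
  have "(symplectic_form *\<^sub>m A) (2 * a) y = (\<Sum>k\<in>{2 * a + 1}. symplectic_form (2 * a) k * A k y)"
    by (rule mat_mult_eq[OF _ _ row_finite_symplectic]) (auto simp: symplectic_form_def split: if_splits dest: arg_cong[of _ _ even])
  moreover have "(symplectic_form *\<^sub>m A) (2 * a + 1) y = (\<Sum>k\<in>{2 * a}. symplectic_form (2 * a + 1) k * A k y)"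
    by (rule mat_mult_eq[OF _ _ row_finite_symplectic]) (auto simp: symplectic_form_def split: if_splits dest: arg_cong[of _ _ even])
  ultimately show "(symplectic_form *\<^sub>m A) (2 * a) y = A (2 * a + 1) y"
    "(symplectic_form *\<^sub>m A) (2 * a + 1) y = - A (2 * a) y"
    by (simp_all add: symplectic_form_def)
qed

lemma symplectic_right:
  assumes "row_finite A"
  shows "(A *\<^sub>m symplectic_form) x (2 * b) = - A x (2 * b + 1)"
    "(A *\<^sub>m symplectic_form) x (2 * b + 1) = A x (2 * b)"
proof -
  have "(A *\<^sub>m symplectic_form) x (2 * b) = (\<Sum>k\<in>{2 * b + 1}. A x k * symplectic_form k (2 * b))"
    by (rule mat_mult_eq[OF _ _ assms]) (auto simp: symplectic_form_def split: if_splits dest: arg_cong[of _ _ even])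
  moreover have "(A *\<^sub>m symplectic_form) x (2 * b + 1) = (\<Sum>k\<in>{2 * b}. A x k * symplectic_form k (2 * b + 1))"
    by (rule mat_mult_eq[OF _ _ assms]) (auto simp: symplectic_form_def split: if_splits dest: arg_cong[of _ _ even])
  ultimately show "(A *\<^sub>m symplectic_form) x (2 * b) = - A x (2 * b + 1)"
    "(A *\<^sub>m symplectic_form) x (2 * b + 1) = A x (2 * b)"
    by (simp_all add: symplectic_form_def)
qed

lemma mat_eq_parity:
  fixes A B :: mat
  assumes "\<And>a b. A (2 * a) (2 * b) = B (2 * a) (2 * b)" "\<And>a b. A (2 * a) (2 * b + 1) = B (2 * a) (2 * b + 1)"
    "\<And>a b. A (2 * a + 1) (2 * b) = B (2 * a + 1) (2 * b)"
    "\<And>a b. A (2 * a + 1) (2 * b + 1) = B (2 * a + 1) (2 * b + 1)"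
  shows "A = B"
proof (intro ext)
  fix x y
  consider a b :: nat where "x = 2 * a" "y = 2 * b" | a b :: nat where "x = 2 * a" "y = 2 * b + 1"
    | a b :: nat where "x = 2 * a + 1" "y = 2 * b" | a b :: nat where "x = 2 * a + 1" "y = 2 * b + 1"
    by (metis evenE oddE)
  then show "A x y = B x y" using assms by cases auto
qed

lemma realify_symplectic:
  assumes "row_finite (realify 2 A)" "A \<in> finite_mats Scal_C"
  shows "realify 2 A *\<^sub>m symplectic_form = symplectic_form *\<^sub>m realify 2 A"
  by (rule mat_eq_parity; unfold symplectic_left symplectic_right[OF assms(1)])
    (use assms(2) in \<open>simp_all add: realify_def qcoord_sel qbasis_nth quat_eq_iff quat_sel_mult\<close>)

text \<open>Quaternionic matrices are the complex ones commuting with the antilinear map given by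
  the symplectic form followed by complex conjugation.\<close>

lemma complexify_symplectic:
  assumes "row_finite (mat_cnj (complexify A))"
  shows "symplectic_form *\<^sub>m complexify A = mat_cnj (complexify A) *\<^sub>m symplectic_form"
  by (rule mat_eq_parity; unfold symplectic_left symplectic_right[OF assms])
    (simp_all add: complexify_def Let_def mat_cnj_def quat_eq_iff)

lemma complexify_isometry:
  assumes A: "complexify A \<in> general_linear Scal_C" "mat_adjoint (complexify A) *\<^sub>m complexify A = mat_one"
  shows "complexify A \<in> bilinear_isometries Scal_C symplectic_form"
proof -
  let ?A = "complexify A" and ?J = symplectic_form
  have fA: "?A \<in> finite_mats Scal_C" by (rule general_linear_finite[OF A(1)])
  have rc: "row_finite (mat_cnj ?A)" by (rule finite_mats_rf[OF finite_mats_cnj[OF fA]])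
  have fT: "mat_transpose ?A \<in> finite_mats Scal_C"
    unfolding mat_transpose_eq by (intro finite_mats_cnj finite_mats_adjoint fA)
  note rT = finite_mats_rf[OF fT]
  have "mat_transpose ?A *\<^sub>m mat_cnj ?A = mat_cnj (mat_adjoint ?A *\<^sub>m ?A)"
    unfolding mat_transpose_eq by (rule mat_cnj_mult[OF _ finite_mats_adjoint[OF fA] fA, symmetric]) simp
  also have "\<dots> = mat_one" by (simp add: A(2))
  finally have one: "mat_transpose ?A *\<^sub>m mat_cnj ?A = mat_one" .
  have "mat_transpose ?A *\<^sub>m ?J *\<^sub>m ?A = mat_transpose ?A *\<^sub>m (?J *\<^sub>m ?A)"
    by (rule mat_mult_assoc[OF rT row_finite_symplectic])
  also have "\<dots> = mat_transpose ?A *\<^sub>m (mat_cnj ?A *\<^sub>m ?J)"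
    by (simp only: complexify_symplectic[OF rc])
  also have "\<dots> = (mat_transpose ?A *\<^sub>m mat_cnj ?A) *\<^sub>m ?J"
    by (rule mat_mult_assoc[OF rT rc, symmetric])
  finally show ?thesis using A(1) by (simp add: one bilinear_isometries_def)
qed

lemma interleave_disjoint: "disjoint_blocks 2 (\<lambda>j r. 2 * r + j)"
  by (auto simp: disjoint_blocks_def inj_on_def disjoint_family_on_def less_2_cases_iff) presburger+

lemma shift_disjoint: "disjoint_blocks 1 (\<lambda>_ r. r + p)"
  by (auto simp: disjoint_blocks_def inj_on_def disjoint_family_on_def)

lemma interleave_signature:
  assumes "row_finite (interleave_blocks k)"
  shows "interleave_blocks k *\<^sub>m sig_inf_inf = sig_inf_inf *\<^sub>m interleave_blocks k"
  unfolding sig_inf_inf_def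
proof (rule mat_diag_commute[OF assms])
  fix x y
  show "interleave_blocks k x y * (if even y then 1 else - 1) = (if even x then 1 else - 1) * interleave_blocks k x y"
  proof (cases rule: block_diag_cases[where N = 2 and \<beta> = "\<lambda>j r. 2 * r + j" and x = x and y = y])
    case (1 j a b)
    then have "even x \<longleftrightarrow> even y" by simp
    then show ?thesis by simp
  next
    case 2
    then have "interleave_blocks k x y = mat_one x y"
      unfolding interleave_blocks_def by (rule block_diag_off)
    then show ?thesis by (simp add: mat_one_def)
  qed
qed

lemma shift_signature:
  assumes "row_finite (shift_block p k)"
  shows "shift_block p k *\<^sub>m sig_fin_inf p = sig_fin_inf p *\<^sub>m shift_block p k"
  unfolding sig_fin_inf_def
proof (rule mat_diag_commute[OF assms])
  fix x y
  show "shift_block p k x y * (if y < p then - 1 else 1) = (if x < p then - 1 else 1) * shift_block p k x y"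
  proof (cases "p \<le> x \<and> p \<le> y")
    case False
    have "shift_block p k x y = mat_one x y"
      unfolding shift_block_def by (rule block_diag_off) (use False in auto)
    then show ?thesis by (simp add: mat_one_def)
  qed simp
qed

lemma skew_commute:
  assumes "A \<in> finite_mats Scal_C"
  shows "A *\<^sub>m skew_form = skew_form *\<^sub>m A"
  unfolding skew_form_def
  by (rule mat_diag_commute[OF finite_mats_rf[OF assms]])
    (use assms in \<open>simp add: finite_mats_iff quat_eq_iff quat_sel_mult\<close>)

lemma row_finite_forms: "row_finite sig_inf_inf" "row_finite (sig_fin_inf p)" "row_finite skew_form"
  by (simp_all add: sig_inf_inf_def sig_fin_inf_def skew_form_def row_finite_diag)

lemma max_heavy_incl_rep:
  assumes "\<And>r. r < length (irr_max_heavy c) \<Longrightarrow> matrix_rep L (heavy_scalars (irr_max_heavy c ! r)) (\<Phi> r)"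
  shows "\<exists>F. matrix_rep L F (\<lambda>l. irr_max_heavy_incl c (\<lambda>r. \<Phi> r l)) \<and>
     (\<forall>l\<in>heavy_elems L. irr_max_heavy_incl c (\<lambda>r. \<Phi> r l) \<in> irr_classical_carrier c)"
proof -
  have inter: "matrix_rep L F (\<lambda>l. interleave_blocks (\<lambda>r. \<Phi> r l))"
    "l \<in> heavy_elems L \<Longrightarrow> interleave_blocks (\<lambda>r. \<Phi> r l) \<in> sesquilinear_isometries F sig_inf_inf"
    if "matrix_rep L F (\<Phi> 0)" "matrix_rep L F (\<Phi> (Suc 0))" for F l
  proof -
    have "matrix_rep L F (\<Phi> j)" if "j < 2" for j
      using that \<open>matrix_rep L F (\<Phi> 0)\<close> \<open>matrix_rep L F (\<Phi> (Suc 0))\<close> by (auto simp: less_2_cases_iff)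
    from matrix_rep_block_diag[OF interleave_disjoint this]
    show 1: "matrix_rep L F (\<lambda>l. interleave_blocks (\<lambda>r. \<Phi> r l))" by (simp add: interleave_blocks_def)
    assume l: "l \<in> heavy_elems L"
    show "interleave_blocks (\<lambda>r. \<Phi> r l) \<in> sesquilinear_isometries F sig_inf_inf"
      by (intro sesquilinear_isometriesI interleave_signature row_finite_forms
          matrix_repD(2)[OF 1 l] matrix_rep_general_linear[OF 1 l] finite_mats_rf[OF matrix_repD(1)[OF 1 l]])
  qed
  have shift: "matrix_rep L F (\<lambda>l. shift_block p (\<lambda>r. \<Phi> r l))"
    "l \<in> heavy_elems L \<Longrightarrow> shift_block p (\<lambda>r. \<Phi> r l) \<in> sesquilinear_isometries F (sig_fin_inf p)"
    if "matrix_rep L F (\<Phi> 0)" for F p l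
  proof -
    have "matrix_rep L F (\<Phi> j)" if "j < 1" for j
      using that \<open>matrix_rep L F (\<Phi> 0)\<close> by simp
    from matrix_rep_block_diag[OF shift_disjoint this]
    show 1: "matrix_rep L F (\<lambda>l. shift_block p (\<lambda>r. \<Phi> r l))" by (simp add: shift_block_def)
    assume l: "l \<in> heavy_elems L"
    show "shift_block p (\<lambda>r. \<Phi> r l) \<in> sesquilinear_isometries F (sig_fin_inf p)"
      by (intro sesquilinear_isometriesI shift_signature row_finite_forms
          matrix_repD(2)[OF 1 l] matrix_rep_general_linear[OF 1 l] finite_mats_rf[OF matrix_repD(1)[OF 1 l]])
  qed
  show ?thesis
  proof (cases c)
    case Sp_2inf_R
    then have 0: "matrix_rep L Scal_C (\<Phi> 0)" using assms[of 0] by simp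
    have 1: "matrix_rep L Scal_R (\<lambda>l. realify 2 (\<Phi> 0 l))"
      unfolding realify_expand by (rule matrix_rep_expand[OF scalar_rep_realify_2 0])
    have "realify 2 (\<Phi> 0 l) \<in> bilinear_isometries Scal_R symplectic_form" if l: "l \<in> heavy_elems L" for l
      unfolding real_isometries[symmetric]
      by (intro sesquilinear_isometriesI realify_symplectic row_finite_symplectic matrix_repD(1)[OF 0 l]
          matrix_repD(2)[OF 1 l] matrix_rep_general_linear[OF 1 l] finite_mats_rf[OF matrix_repD(1)[OF 1 l]])
    with 1 Sp_2inf_R show ?thesis by auto
  next
    case Sp_2inf_C
    then have 0: "matrix_rep L Scal_H (\<Phi> 0)" using assms[of 0] by simp
    have 1: "matrix_rep L Scal_C (\<lambda>l. complexify (\<Phi> 0 l))"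
      unfolding complexify_expand by (rule matrix_rep_expand[OF scalar_rep_complexify 0])
    have "complexify (\<Phi> 0 l) \<in> bilinear_isometries Scal_C symplectic_form" if l: "l \<in> heavy_elems L" for l
      by (intro complexify_isometry matrix_repD(2)[OF 1 l] matrix_rep_general_linear[OF 1 l])
    with 1 Sp_2inf_C show ?thesis by auto
  next
    case O_inf_C
    then have 0: "matrix_rep L Scal_R (\<Phi> 0)" using assms[of 0] by simp
    have 1: "matrix_rep L Scal_C (\<Phi> 0)" by (rule matrix_rep_scalars[OF 0]) auto
    have "\<Phi> 0 l \<in> bilinear_isometries Scal_C mat_one" if l: "l \<in> heavy_elems L" for l
    proof -
      have "\<Phi> 0 l \<in> bilinear_isometries Scal_R mat_one"
        unfolding real_isometries[symmetric]
        by (rule sesquilinear_isometriesI[OF matrix_rep_general_linear[OF 0 l] matrix_repD(2)[OF 0 l] row_finite_one])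
          (simp add: finite_mats_rf[OF matrix_repD(1)[OF 0 l]])
      then show ?thesis using matrix_rep_general_linear[OF 1 l] by (simp add: bilinear_isometries_def)
    qed
    with 1 O_inf_C show ?thesis by auto
  next
    case SO_star
    then have 0: "matrix_rep L Scal_C (\<Phi> 0)" using assms[of 0] by simp
    have 1: "matrix_rep L Scal_H (\<Phi> 0)" by (rule matrix_rep_scalars[OF 0]) auto
    have "\<Phi> 0 l \<in> sesquilinear_isometries Scal_H skew_form" if l: "l \<in> heavy_elems L" for l
      by (intro sesquilinear_isometriesI skew_commute row_finite_forms matrix_repD(1)[OF 0 l]
          matrix_repD(2)[OF 1 l] matrix_rep_general_linear[OF 1 l])
    with 1 SO_star show ?thesis by auto
  next
    case U_inf_inf
    then have "matrix_rep L Scal_C (\<Phi> 0)" "matrix_rep L Scal_C (\<Phi> (Suc 0))"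
      using assms[of 0] assms[of "Suc 0"] by simp_all
    from inter[OF this] U_inf_inf show ?thesis by auto
  next
    case Sp_inf_inf
    then have "matrix_rep L Scal_H (\<Phi> 0)" "matrix_rep L Scal_H (\<Phi> (Suc 0))"
      using assms[of 0] assms[of "Suc 0"] by simp_all
    from inter[OF this] Sp_inf_inf show ?thesis by auto
  next
    case O_inf_inf
    then have "matrix_rep L Scal_R (\<Phi> 0)" "matrix_rep L Scal_R (\<Phi> (Suc 0))"
      using assms[of 0] assms[of "Suc 0"] by simp_all
    from inter[OF this] O_inf_inf show ?thesis by (auto simp: real_isometries)
  next
    case (U_fin_inf p)
    then have "matrix_rep L Scal_C (\<Phi> 0)" using assms[of 0] by simp
    from shift[OF this] U_fin_inf show ?thesis by auto
  next
    case (O_fin_inf p)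
    then have "matrix_rep L Scal_R (\<Phi> 0)" using assms[of 0] by simp
    from shift[OF this] O_fin_inf show ?thesis by (auto simp: real_isometries)
  next
    case (Sp_fin_inf p)
    then have "matrix_rep L Scal_H (\<Phi> 0)" using assms[of 0] by simp
    from shift[OF this] Sp_fin_inf show ?thesis by auto
  qed (use assms[of 0] matrix_rep_general_linear in auto)
qed

lemma max_heavy_nth:
  assumes "i < length G" "r < length (irr_max_heavy (G ! i))"
  shows "length (max_heavy (take i G)) + r < length (max_heavy G)"
    "max_heavy G ! (length (max_heavy (take i G)) + r) = irr_max_heavy (G ! i) ! r"
proof -
  have "G = take i G @ G ! i # drop (Suc i) G" using assms(1) by (rule id_take_nth_drop)
  then have "max_heavy G = max_heavy (take i G) @ irr_max_heavy (G ! i) @ max_heavy (drop (Suc i) G)"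
    unfolding max_heavy_def by (metis concat.simps(2) concat_append list.simps(9) map_append)
  then show "length (max_heavy (take i G)) + r < length (max_heavy G)"
    "max_heavy G ! (length (max_heavy (take i G)) + r) = irr_max_heavy (G ! i) ! r"
    using assms(2) by (simp_all add: nth_append)
qed

lemma pair_incl_rep:
  assumes "GL_pair G L \<sigma>" "i < length G"
  shows "\<exists>F. matrix_rep L F (\<lambda>l. pair_incl G \<sigma> l i) \<and>
     (\<forall>l\<in>heavy_elems L. pair_incl G \<sigma> l i \<in> irr_classical_carrier (G ! i))"
proof -
  let ?n = "length (max_heavy (take i G))"
  have "matrix_rep L (heavy_scalars (irr_max_heavy (G ! i) ! r)) (\<lambda>l. \<sigma> l (?n + r))"
    if "r < length (irr_max_heavy (G ! i))" for r
    using assms(1) max_heavy_nth[OF assms(2) that]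
    by (metis GL_pair_def matrix_rep_straight_hom straight_hom_def)
  from max_heavy_incl_rep[OF this] show ?thesis
    using assms(2) by (simp add: pair_incl_def max_heavy_incl_def)
qed

lemma classical_carrier:
  "g \<in> carrier (classical_group G) \<longleftrightarrow>
     g \<in> extensional {..<length G} \<and> (\<forall>i<length G. g i \<in> irr_classical_carrier (G ! i))"
  by (auto simp: classical_group_def PiE_iff)

lemma classical_mult:
  "g \<otimes>\<^bsub>classical_group G\<^esub> h = (\<lambda>i\<in>{..<length G}. g i *\<^sub>m h i)"
  by (simp add: classical_group_def)

lemma pair_incl_hom:
  assumes "GL_pair G L \<sigma>"
  shows "pair_incl G \<sigma> \<in> hom (heavy_group L) (classical_group G)"
proof (rule homI)
  fix l assume l: "l \<in> heavy_elems L"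
  show "pair_incl G \<sigma> l \<in> carrier (classical_group G)"
    using pair_incl_rep[OF assms] l unfolding classical_carrier
    by (auto simp: pair_incl_def max_heavy_incl_def)
  fix l' assume l': "l' \<in> heavy_elems L"
  have "pair_incl G \<sigma> (l \<otimes>\<^bsub>heavy_group L\<^esub> l') i = pair_incl G \<sigma> l i *\<^sub>m pair_incl G \<sigma> l' i"
    if "i < length G" for i
    using pair_incl_rep[OF assms that] matrix_repD(3) l l' by blast
  moreover have "pair_incl G \<sigma> k \<in> extensional {..<length G}" for k
    by (simp add: pair_incl_def max_heavy_incl_def)
  ultimately show "pair_incl G \<sigma> (l \<otimes>\<^bsub>heavy_group L\<^esub> l') = pair_incl G \<sigma> l \<otimes>\<^bsub>classical_group G\<^esub> pair_incl G \<sigma> l'"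
    unfolding classical_mult by (auto intro: extensionalityI[of _ "{..<length G}", OF _ restrict_extensional])
qed

text \<open>Locality keeps the image of \<open>l\<close> off the finite support of \<open>g\<close>, and matrices with disjoint
  supports commute.\<close>

lemma pair_incl_commute:
  assumes GL: "GL_pair G L \<sigma>" and g: "g \<in> carrier (classical_group G)"
  obtains E where "\<And>j. finite (E j)"
    "\<And>l. l \<in> heavy_elems L \<Longrightarrow> (\<And>j. j < length L \<Longrightarrow> msupp (l j) \<inter> E j = {}) \<Longrightarrow>
       pair_incl G \<sigma> l \<otimes>\<^bsub>classical_group G\<^esub> g = g \<otimes>\<^bsub>classical_group G\<^esub> pair_incl G \<sigma> l"
proof -
  let ?G = "classical_group G"
  have gi: "row_finite (g i)" "finite (msupp (g i))" if "i < length G" for i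
    using g that irr_classical_finite by (auto simp: classical_carrier)
  have "local_at L (\<lambda>l. pair_incl G \<sigma> l i) x"
    if "i < length G" for i x
    using pair_incl_rep[OF GL that] unfolding matrix_rep_def by blast
  then obtain E where E: "\<And>i x j. i < length G \<Longrightarrow> finite (E i x j)"
    "\<And>i x l. i < length G \<Longrightarrow> l \<in> heavy_elems L \<Longrightarrow>
      (\<forall>j<length L. msupp (l j) \<inter> E i x j = {}) \<Longrightarrow> x \<notin> msupp (pair_incl G \<sigma> l i)"
    by metis
  let ?E = "\<lambda>j. \<Union>i<length G. \<Union>x\<in>msupp (g i). E i x j"
  show ?thesis
  proof (rule that[of ?E])
    show "finite (?E j)" for j using E(1) gi(2) by auto
    fix l assume l: "l \<in> heavy_elems L"
      and dis: "\<And>j. j < length L \<Longrightarrow> msupp (l j) \<inter> ?E j = {}"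
    have "pair_incl G \<sigma> l i *\<^sub>m g i = g i *\<^sub>m pair_incl G \<sigma> l i" if i: "i < length G" for i
    proof (rule mat_commute_disjoint)
      show "row_finite (pair_incl G \<sigma> l i)"
        using pair_incl_rep[OF GL i] l irr_classical_finite by blast
      show "row_finite (g i)" by (rule gi[OF i])
      have "x \<notin> msupp (pair_incl G \<sigma> l i)" if "x \<in> msupp (g i)" for x
        by (rule E(2)[OF i l]) (use dis i that in blast)
      then show "msupp (pair_incl G \<sigma> l i) \<inter> msupp (g i) = {}" by blast
    qed
    then show "pair_incl G \<sigma> l \<otimes>\<^bsub>?G\<^esub> g = g \<otimes>\<^bsub>?G\<^esub> pair_incl G \<sigma> l"
      unfolding classical_mult by (intro restrict_ext) simp
  qed
qed

section \<open>Permutation matrices in the heavy group\<close>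

lemma row_finite_perm:
  assumes "bij s"
  shows "row_finite (perm_mat s)"
proof -
  have "{k. perm_mat s x k \<noteq> 0} \<subseteq> {inv_into UNIV s x}" for x
    using assms by (auto simp: perm_mat_def bij_is_inj)
  then show ?thesis unfolding row_finite_def by (meson finite.intros finite_subset)
qed

lemma perm_mat_right:
  assumes "row_finite A"
  shows "(A *\<^sub>m perm_mat s) x y = A x (s y)"
proof -
  have "(A *\<^sub>m perm_mat s) x y = (\<Sum>k\<in>{s y}. A x k * perm_mat s k y)"
    by (rule mat_mult_eq[OF _ _ assms]) (auto simp: perm_mat_def split: if_splits)
  then show ?thesis by (simp add: perm_mat_def)
qed

lemma perm_mat_left:
  assumes "bij s"
  shows "(perm_mat s *\<^sub>m A) x y = A (inv_into UNIV s x) y"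
proof -
  have "(perm_mat s *\<^sub>m A) x y = (\<Sum>k\<in>{inv_into UNIV s x}. perm_mat s x k * A k y)"
    by (rule mat_mult_eq[OF _ _ row_finite_perm[OF assms]])
      (use assms in \<open>auto simp: perm_mat_def bij_is_inj split: if_splits\<close>)
  then show ?thesis using assms by (simp add: perm_mat_def bij_is_surj surj_f_inv_f)
qed

lemma perm_mat_mult: "bij s \<Longrightarrow> perm_mat s *\<^sub>m perm_mat t = perm_mat (s \<circ> t)"
  by (simp add: fun_eq_iff perm_mat_right row_finite_perm) (simp add: perm_mat_def)

lemma perm_mat_id: "perm_mat id = mat_one"
  by (simp add: perm_mat_def mat_one_def fun_eq_iff)

lemma msupp_perm:
  assumes "inj s"
  shows "msupp (perm_mat s) \<subseteq> {x. s x \<noteq> x}"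
proof
  fix x assume x: "x \<in> msupp (perm_mat s)"
  have "x \<notin> msupp (perm_mat s)" if e: "s x = x"
  proof -
    have "x = s y \<longleftrightarrow> x = y" for y using injD[OF assms, of x y] e by auto
    then show ?thesis using e by (simp add: msupp_def perm_mat_def mat_one_def)
  qed
  then show "x \<in> {x. s x \<noteq> x}" using x by blast
qed

lemma perm_mat_heavy:
  assumes s: "bij s" "finite {x. s x \<noteq> x}"
  shows "perm_mat s \<in> carrier (irr_heavy_group h)"
proof -
  let ?i = "inv_into UNIV s"
  have i: "bij ?i" using s by (simp add: bij_imp_bij_inv)
  have comp: "?i \<circ> s = id" "s \<circ> ?i = id"
    using s by (simp_all add: bij_is_inj fun_eq_iff bij_is_surj surj_f_inv_f)
  have "?i x = x \<longleftrightarrow> s x = x" for x by (metis s(1) bij_inv_eq_iff)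
  then have fi: "finite {x. ?i x \<noteq> x}" using s by simp
  have fin: "perm_mat t \<in> finite_mats F" if "bij t" "finite {x. t x \<noteq> x}" for t F
    using finite_subset[OF msupp_perm[OF bij_is_inj[OF that(1)]] that(2)]
    by (simp add: finite_mats_iff) (simp add: perm_mat_def scalar_set_closed)
  have adj: "mat_adjoint (perm_mat s) = perm_mat ?i"
    using s(1) by (auto simp: fun_eq_iff mat_adjoint_def perm_mat_def bij_is_inj bij_is_surj surj_f_inv_f)
  show ?thesis
    unfolding irr_heavy_carrier general_linear_iff adj
    using fin[OF s] fin[OF i fi] by (auto simp: perm_mat_mult s i comp perm_mat_id intro!: bexI[of _ "perm_mat ?i"])
qed

text \<open>Permutations of the basis vectors of all the spaces at once: a point \<open>(j, x)\<close> is the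
  basis vector \<open>x\<close> of the \<open>j\<close>-th space, and \<open>points L \<Xi>\<close> are those not fixed by the stabilizer.\<close>

definition points :: "heavy list \<Rightarrow> (nat \<Rightarrow> nat set) \<Rightarrow> (nat \<times> nat) set" where
  "points L \<Xi> = {(j, x). j < length L \<and> x \<notin> \<Xi> j}"

definition comp_perm :: "(nat \<times> nat \<Rightarrow> nat \<times> nat) \<Rightarrow> nat \<Rightarrow> nat \<Rightarrow> nat" where
  "comp_perm s j x = snd (s (j, x))"

definition point_perm :: "heavy list \<Rightarrow> (nat \<times> nat \<Rightarrow> nat \<times> nat) \<Rightarrow> nat \<Rightarrow> mat" where
  "point_perm L s = (\<lambda>j\<in>{..<length L}. perm_mat (comp_perm s j))"

lemma comp_perm:
  assumes "s \<in> fin_perms fst X"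
  shows "s (j, x) = (j, comp_perm s j x)"
proof -
  have "fst (s (j, x)) = j" using assms by (simp add: fin_perms_def)
  then show ?thesis by (simp add: comp_perm_def prod_eq_iff)
qed

lemma comp_perm_bij:
  assumes s: "s \<in> fin_perms fst X"
  shows "bij (comp_perm s j)"
proof (rule bijI)
  have b: "bij s" using s by (simp add: fin_perms_def)
  show "inj (comp_perm s j)"
  proof (rule injI)
    fix x y assume "comp_perm s j x = comp_perm s j y"
    then have "s (j, x) = s (j, y)" by (simp add: comp_perm[OF s])
    then show "x = y" using b by (auto dest!: injD[OF bij_is_inj])
  qed
  show "surj (comp_perm s j)"
  proof (rule surjI)
    fix y
    let ?q = "inv_into UNIV s (j, y)"
    have q: "s ?q = (j, y)" using b by (simp add: bij_is_surj surj_f_inv_f)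
    have "s ?q = (fst ?q, comp_perm s (fst ?q) (snd ?q))"
      using comp_perm[OF s, of "fst ?q" "snd ?q"] unfolding prod.collapse .
    note p = trans[OF this[symmetric] q]
    have e: "fst ?q = j" "comp_perm s (fst ?q) (snd ?q) = y"
      using arg_cong[OF p, of fst] arg_cong[OF p, of snd] by (simp_all only: fst_conv snd_conv)
    show "comp_perm s j (snd ?q) = y" using e(2) unfolding e(1) .
  qed
qed

lemma comp_perm_finite:
  assumes s: "s \<in> fin_perms fst X"
  shows "finite {x. comp_perm s j x \<noteq> x}"
proof -
  have "{x. comp_perm s j x \<noteq> x} \<subseteq> snd ` {q. s q \<noteq> q}"
  proof
    fix x assume "x \<in> {x. comp_perm s j x \<noteq> x}"
    then have "s (j, x) \<noteq> (j, x)" using comp_perm[OF s, of j x] by simp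
    then show "x \<in> snd ` {q. s q \<noteq> q}" by (intro image_eqI[of _ _ "(j, x)"]) simp_all
  qed
  moreover have "finite (snd ` {q. s q \<noteq> q})" using s by (simp add: fin_perms_def)
  ultimately show ?thesis by (rule finite_subset)
qed

lemma comp_perm_comp:
  assumes "t \<in> fin_perms fst X"
  shows "comp_perm (s \<circ> t) j = comp_perm s j \<circ> comp_perm t j"
  using comp_perm[OF assms] by (simp add: fun_eq_iff comp_perm_def)

lemma comp_perm_inv:
  assumes s: "s \<in> fin_perms fst X"
  shows "inv_into UNIV (comp_perm s j) = comp_perm (inv_into UNIV s) j"
proof -
  let ?i = "inv_into UNIV s"
  have i: "?i \<in> fin_perms fst X" by (rule fin_perms_inv[OF s])
  have "s \<circ> ?i = id" "?i \<circ> s = id"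
    using s by (simp_all add: fin_perms_def bij_is_inj fun_eq_iff bij_is_surj surj_f_inv_f)
  then have "comp_perm s j \<circ> comp_perm ?i j = id" "comp_perm ?i j \<circ> comp_perm s j = id"
    using comp_perm_comp[OF i, of s j] comp_perm_comp[OF s, of ?i j]
    by (simp_all add: fun_eq_iff comp_perm_def)
  then show ?thesis by (rule inv_unique_comp)
qed

lemma point_perm_in: "s \<in> fin_perms fst X \<Longrightarrow> point_perm L s \<in> heavy_elems L"
  by (simp add: heavy_carrier point_perm_def perm_mat_heavy comp_perm_bij comp_perm_finite)

lemma heavy_eqI:
  assumes "l \<in> heavy_elems L" "l' \<in> heavy_elems L"
    "\<And>j. j < length L \<Longrightarrow> l j = l' j"
  shows "l = l'"
  by (rule extensionalityI[of _ "{..<length L}"]) (use assms in \<open>auto simp: heavy_carrier\<close>)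

lemma point_perm_mult:
  assumes "s \<in> fin_perms fst X" "t \<in> fin_perms fst X"
  shows "point_perm L (s \<circ> t) = point_perm L s \<otimes>\<^bsub>heavy_group L\<^esub> point_perm L t"
proof -
  interpret group "heavy_group L" by (rule group_heavy)
  note c = point_perm_in[OF assms(1)] point_perm_in[OF assms(2)]
  show ?thesis
    by (rule heavy_eqI[OF point_perm_in[OF fin_perms_comp[OF assms]] m_closed[OF c]])
      (simp add: heavy_mult, simp add: point_perm_def perm_mat_mult comp_perm_bij[OF assms(1)] comp_perm_comp[OF assms(2)])
qed

lemma point_perm_id: "point_perm L id = \<one>\<^bsub>heavy_group L\<^esub>"
proof -
  interpret group "heavy_group L" by (rule group_heavy)
  have "comp_perm id j = id" for j by (simp add: fun_eq_iff comp_perm_def)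
  then have "point_perm L id j = \<one>\<^bsub>heavy_group L\<^esub> j" if "j < length L" for j
    using that by (simp add: point_perm_def perm_mat_id heavy_one)
  then show ?thesis
    by (rule heavy_eqI[OF point_perm_in[OF fin_perms_id] one_closed])
qed

lemma point_perm_inv:
  assumes s: "s \<in> fin_perms fst X"
  shows "inv\<^bsub>heavy_group L\<^esub> (point_perm L s) = point_perm L (inv_into UNIV s)"
proof -
  interpret group "heavy_group L" by (rule group_heavy)
  have i: "inv_into UNIV s \<in> fin_perms fst X" by (rule fin_perms_inv[OF s])
  have "inv_into UNIV s \<circ> s = id" using s by (simp add: fin_perms_def bij_is_inj)
  then have "point_perm L (inv_into UNIV s) \<otimes>\<^bsub>heavy_group L\<^esub> point_perm L s = \<one>\<^bsub>heavy_group L\<^esub>"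
    using point_perm_mult[OF i s, of L] by (simp add: point_perm_id)
  then show ?thesis
    by (rule inv_equality[OF _ point_perm_in[OF s] point_perm_in[OF i]])
qed

definition point_conj :: "heavy list \<Rightarrow> (nat \<times> nat \<Rightarrow> nat \<times> nat) \<Rightarrow> (nat \<Rightarrow> mat) \<Rightarrow> nat \<Rightarrow> mat" where
  "point_conj L s l = point_perm L s \<otimes>\<^bsub>heavy_group L\<^esub> l \<otimes>\<^bsub>heavy_group L\<^esub> inv\<^bsub>heavy_group L\<^esub> (point_perm L s)"

lemma point_conj_carrier:
  assumes "s \<in> fin_perms fst X" "l \<in> heavy_elems L"
  shows "point_conj L s l \<in> heavy_elems L"
proof -
  interpret group "heavy_group L" by (rule group_heavy)
  show ?thesis using point_perm_in[OF assms(1)] assms(2) by (simp add: point_conj_def)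
qed

lemma point_conj_entry:
  assumes s: "s \<in> fin_perms fst X" and l: "l \<in> heavy_elems L" and j: "j < length L"
  shows "point_conj L s l j x y
    = l j (comp_perm (inv_into UNIV s) j x) (comp_perm (inv_into UNIV s) j y)"
proof -
  have "row_finite (perm_mat (comp_perm s j) *\<^sub>m l j)"
    by (intro row_finite_mult row_finite_perm comp_perm_bij[OF s] heavy_component(2)[OF l j])
  then show ?thesis
    unfolding point_conj_def point_perm_inv[OF s] heavy_mult[OF j]
    by (simp add: point_perm_def j perm_mat_right perm_mat_left comp_perm_bij[OF s] comp_perm_inv[OF s])
qed

lemma msupp_point_conj:
  assumes s: "s \<in> fin_perms fst X" and l: "l \<in> heavy_elems L" and j: "j < length L"
    and x: "x \<in> msupp (point_conj L s l j)"
  shows "\<exists>z\<in>msupp (l j). s (j, z) = (j, x)"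
proof -
  let ?c = "comp_perm (inv_into UNIV s) j"
  have i: "inv_into UNIV s \<in> fin_perms fst X" by (rule fin_perms_inv[OF s])
  have inj: "inj ?c" by (rule bij_is_inj[OF comp_perm_bij[OF i]])
  have "?c x \<in> msupp (l j)"
  proof (rule ccontr)
    assume "?c x \<notin> msupp (l j)"
    note off = off_msupp(1)[OF this] off_msupp(2)[OF this]
    have "point_conj L s l j x y = mat_one x y" "point_conj L s l j y x = mat_one y x" for y
      unfolding point_conj_entry[OF s l j] off by (simp_all add: mat_one_def inj_eq[OF inj])
    then show False using x by (simp add: msupp_def)
  qed
  moreover have "s (j, ?c x) = (j, x)"
    unfolding comp_perm[OF i, symmetric] using s by (simp add: fin_perms_def bij_is_surj surj_f_inv_f)
  ultimately show ?thesis by blast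
qed

section \<open>The swaps\<close>

lemma block_swap_cases:
  assumes \<omega>: "inj_on \<omega> {1..}"
  shows "i \<in> {1..m} \<Longrightarrow> block_swap \<omega> m (\<omega> i) = \<omega> (m + i)"
    "i \<in> {m+1..2*m} \<Longrightarrow> block_swap \<omega> m (\<omega> i) = \<omega> (i - m)"
    "x \<notin> \<omega> ` {1..2*m} \<Longrightarrow> block_swap \<omega> m x = x"
proof -
  have mem: "\<omega> i \<in> \<omega> ` A \<longleftrightarrow> i \<in> A" if "1 \<le> i" "A \<subseteq> {1..}" for i A
    using inj_on_image_mem_iff[OF \<omega>, of i A] that by simp
  have inv: "inv_into {1..} \<omega> (\<omega> i) = i" if "1 \<le> i" for i
    using inv_into_f_f[OF \<omega>, of i] that by simp
  show "block_swap \<omega> m (\<omega> i) = \<omega> (m + i)" if "i \<in> {1..m}"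
    using that mem[of i "{1..m}"] inv[of i] by (simp add: block_swap_def)
  show "block_swap \<omega> m (\<omega> i) = \<omega> (i - m)" if "i \<in> {m+1..2*m}"
  proof -
    have "\<omega> i \<notin> \<omega> ` {1..m}" "\<omega> i \<in> \<omega> ` {m+1..2*m}"
      using that mem[of i "{1..m}"] mem[of i "{m+1..2*m}"] by auto
    then show ?thesis using inv[of i] that by (simp add: block_swap_def)
  qed
  show "block_swap \<omega> m x = x" if "x \<notin> \<omega> ` {1..2*m}"
  proof -
    have "\<omega> ` {1..m} \<subseteq> \<omega> ` {1..2*m}" "\<omega> ` {m+1..2*m} \<subseteq> \<omega> ` {1..2*m}" by (auto intro!: imageI)
    then have "x \<notin> \<omega> ` {1..m}" "x \<notin> \<omega> ` {m+1..2*m}" using that by blast+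
    then show ?thesis unfolding block_swap_def by (simp only: if_False)
  qed
qed

lemma block_swap_twice:
  assumes \<omega>: "inj_on \<omega> {1..}"
  shows "block_swap \<omega> m (block_swap \<omega> m x) = x"
proof (cases "x \<in> \<omega> ` {1..2*m}")
  case True
  then obtain i where i: "i \<in> {1..2*m}" "x = \<omega> i" by blast
  show ?thesis
  proof (cases "i \<le> m")
    case True
    then have "i \<in> {1..m}" "m + i \<in> {m+1..2*m}" using i by auto
    then show ?thesis by (simp only: i(2) block_swap_cases(1,2)[OF \<omega>]) simp
  next
    case False
    then have "i \<in> {m+1..2*m}" "i - m \<in> {1..m}" using i by auto
    then show ?thesis using False by (simp only: i(2) block_swap_cases(1,2)[OF \<omega>]) simp
  qed
qed (simp add: block_swap_cases(3)[OF \<omega>])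

definition theta_pt :: "heavy list \<Rightarrow> (nat \<Rightarrow> nat \<Rightarrow> nat) \<Rightarrow> (nat \<Rightarrow> nat) \<Rightarrow> nat \<times> nat \<Rightarrow> nat \<times> nat" where
  "theta_pt L \<omega> m = (\<lambda>(j, x). (j, if j < length L then block_swap (\<omega> j) (m j) x else x))"

lemma Theta_eq: "Theta L \<omega> m = point_perm L (theta_pt L \<omega> m)"
proof -
  have "comp_perm (theta_pt L \<omega> m) j = block_swap (\<omega> j) (m j)" if "j < length L" for j
    using that by (simp add: fun_eq_iff comp_perm_def theta_pt_def)
  then show ?thesis unfolding Theta_def point_perm_def by (intro restrict_ext) simp
qed

lemma multi_at_top_component:
  assumes "j < p"
  shows "filterlim (\<lambda>m. m j) at_top (multi_at_top p)"
  unfolding multi_at_top_def using assms by (intro filterlim_INF'[of j]) auto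

lemma multi_at_top_nontrivial: "multi_at_top p \<noteq> bot"
proof -
  have "filtermap (\<lambda>n _. n) at_top \<le> multi_at_top p"
    unfolding multi_at_top_def
    by (intro INF_greatest) (simp add: filtermap_le_iff_le_filtercomap[symmetric] filtermap_filtermap)
  moreover have "filtermap (\<lambda>n _. n) (at_top :: nat filter) \<noteq> bot"
    by (simp add: filtermap_bot_iff)
  ultimately show ?thesis by (metis bot.extremum_uniqueI)
qed

context
  fixes L :: "heavy list" and \<Xi> :: "nat \<Rightarrow> nat set" and \<omega> :: "nat \<Rightarrow> nat \<Rightarrow> nat"
  assumes \<omega>: "\<And>j. j < length L \<Longrightarrow> bij_betw (\<omega> j) {1..} (- \<Xi> j)"
begin

lemma \<omega>_inj: "j < length L \<Longrightarrow> inj_on (\<omega> j) {1..}"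
  using \<omega> bij_betw_def by blast

lemma \<omega>_not_\<Xi>: "j < length L \<Longrightarrow> 1 \<le> i \<Longrightarrow> \<omega> j i \<notin> \<Xi> j"
  using \<omega> bij_betwE by fastforce

lemma theta_pt_involution: "theta_pt L \<omega> m (theta_pt L \<omega> m q) = q"
proof -
  obtain j x where q: "q = (j, x)" by (cases q)
  show ?thesis
  proof (cases "j < length L")
    case True
    show ?thesis
      using block_swap_twice[OF \<omega>_inj[OF True]] True by (simp add: q theta_pt_def)
  qed (simp add: q theta_pt_def)
qed

lemma theta_pt_moves:
  assumes "theta_pt L \<omega> m (j, x) \<noteq> (j, x)"
  shows "j < length L" "x \<in> \<omega> j ` {1..2 * m j}"
proof -
  show j: "j < length L" using assms by (simp add: theta_pt_def split: if_splits)
  show "x \<in> \<omega> j ` {1..2 * m j}"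
  proof (rule ccontr)
    assume "x \<notin> \<omega> j ` {1..2 * m j}"
    then have "block_swap (\<omega> j) (m j) x = x" by (rule block_swap_cases(3)[OF \<omega>_inj[OF j]])
    then show False using assms j by (simp add: theta_pt_def)
  qed
qed

lemma theta_pt_fin_perms: "theta_pt L \<omega> m \<in> fin_perms fst (points L \<Xi>)"
proof -
  let ?t = "theta_pt L \<omega> m"
  have "bij ?t" by (rule involuntory_imp_bij) (rule theta_pt_involution)
  moreover have "{q. ?t q \<noteq> q} \<subseteq> (\<Union>j<length L. Pair j ` \<omega> j ` {1..2 * m j})"
  proof
    fix q assume q: "q \<in> {q. ?t q \<noteq> q}"
    obtain j x where jx: "q = (j, x)" by (cases q)
    have "j < length L" "x \<in> \<omega> j ` {1..2 * m j}" using theta_pt_moves[of m j x] q jx by simp_all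
    then show "q \<in> (\<Union>j<length L. Pair j ` \<omega> j ` {1..2 * m j})" unfolding jx by blast
  qed
  then have "finite {q. ?t q \<noteq> q}" by (rule finite_subset) auto
  moreover have "?t q = q" if "q \<notin> points L \<Xi>" for q
  proof (rule ccontr)
    assume *: "?t q \<noteq> q"
    obtain j x where jx: "q = (j, x)" by (cases q)
    have "j < length L" "x \<in> \<omega> j ` {1..2 * m j}" using theta_pt_moves[of m j x] * jx by simp_all
    then have "q \<in> points L \<Xi>" using \<omega>_not_\<Xi> by (auto simp: jx points_def)
    then show False using that by blast
  qed
  moreover have "fst (?t q) = fst q" for q by (cases q) (simp add: theta_pt_def)
  ultimately show ?thesis by (simp add: fin_perms_def)
qed

lemma theta_pt_inv: "inv_into UNIV (theta_pt L \<omega> m) = theta_pt L \<omega> m"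
  by (rule inv_unique_comp) (simp_all add: fun_eq_iff theta_pt_involution)

lemma finite_enumerated:
  assumes "j < length L" "finite A" "A \<inter> \<Xi> j = {}"
  obtains I N where "finite I" "I \<subseteq> {1..N}" "A = \<omega> j ` I"
proof -
  have "A \<subseteq> \<omega> j ` {1..}" using assms \<omega>[OF assms(1)] by (auto simp: bij_betw_def)
  then obtain I where I: "finite I" "I \<subseteq> {1..}" "A = \<omega> j ` I"
    using finite_subset_image[OF assms(2)] by metis
  then have "I \<subseteq> {1..Max (insert 0 I)}" by auto
  with I that show ?thesis by blast
qed

lemma ev_theta_disjoint:
  assumes F: "finite F" "F \<subseteq> points L \<Xi>"
  shows "\<forall>\<^sub>F m in multi_at_top (length L). theta_pt L \<omega> m ` F \<inter> F = {}"
proof -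
  have "\<exists>N. {x. (j, x) \<in> F} \<subseteq> \<omega> j ` {1..N}" if j: "j < length L" for j
  proof -
    have "{x. (j, x) \<in> F} \<subseteq> snd ` F" by force
    then have "finite {x. (j, x) \<in> F}" using F(1) finite_subset by blast
    moreover have "{x. (j, x) \<in> F} \<inter> \<Xi> j = {}" using F(2) by (auto simp: points_def)
    ultimately obtain I N where "I \<subseteq> {1..N}" "{x. (j, x) \<in> F} = \<omega> j ` I"
      by (rule finite_enumerated[OF j])
    then show ?thesis by blast
  qed
  then obtain N where N: "\<And>j. j < length L \<Longrightarrow> {x. (j, x) \<in> F} \<subseteq> \<omega> j ` {1..N j}" by metis
  have "\<forall>\<^sub>F m in multi_at_top (length L). N j \<le> m j" if "j < length L" for j
    using multi_at_top_component[OF that] by (simp add: filterlim_at_top)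
  then have "\<forall>\<^sub>F m in multi_at_top (length L). \<forall>j\<in>{..<length L}. N j \<le> m j"
    by (intro eventually_ball_finite) auto
  then show ?thesis
  proof eventually_elim
    case (elim m)
    have "theta_pt L \<omega> m q \<notin> F" if q: "q \<in> F" for q
    proof
      assume t: "theta_pt L \<omega> m q \<in> F"
      obtain j x where jx: "q = (j, x)" by (cases q)
      have j: "j < length L" using q F(2) by (auto simp: jx points_def)
      obtain i where i: "i \<in> {1..N j}" "x = \<omega> j i" using N[OF j] q jx by blast
      have Nm: "N j \<le> m j" using elim j by simp
      then have "i \<in> {1..m j}" using i by simp
      then have "theta_pt L \<omega> m q = (j, \<omega> j (m j + i))"
        using j block_swap_cases(1)[OF \<omega>_inj[OF j]] by (simp add: jx theta_pt_def i(2))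
      then obtain k where k: "k \<in> {1..N j}" "\<omega> j (m j + i) = \<omega> j k" using t N[OF j] by auto
      then have "m j + i = k" using inj_onD[OF \<omega>_inj[OF j] k(2)] i by auto
      then show False using k(1) i(1) Nm by simp
    qed
    then show ?case by blast
  qed
qed

end

section \<open>Conjugates by the swaps tend to the identity\<close>

lemma norm_quat_mult: "norm (x * y) = norm x * norm y" for x y :: quat
proof -
  have "inner (x * y) (x * y) = inner x x * inner y y"
    by (simp add: inner_quat_def quat_sel_mult algebra_simps)
  then show ?thesis by (simp add: norm_quat_def real_sqrt_mult)
qed

lemma norm_qcnj [simp]: "norm (qcnj x) = norm x"
  by (simp add: norm_quat_def inner_quat_def)

lemma abs_qcoord_le:
  assumes "s < 4"
  shows "\<bar>qcoord s x\<bar> \<le> norm x"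
proof -
  have "(qcoord s x)\<^sup>2 \<le> inner x x"
  proof -
    have "\<forall>s<4. (qcoord s x)\<^sup>2 \<le> inner x x"
      unfolding all_less_4 qcoord_sel inner_quat_def by (simp add: power2_eq_square)
    then show ?thesis using assms by blast
  qed
  then have "sqrt ((qcoord s x)\<^sup>2) \<le> sqrt (inner x x)" by (rule real_sqrt_le_mono)
  then show ?thesis by (simp add: norm_quat_def)
qed

lemma summable_norm_quat:
  fixes f :: "nat \<Rightarrow> quat"
  assumes "summable (\<lambda>x. norm (f x))"
  shows "summable f"
proof -
  have "summable (\<lambda>x. qcoord s (f x))" if "s < 4" for s
    by (rule summable_comparison_test'[OF assms]) (simp add: abs_qcoord_le[OF that])
  then have "summable (\<lambda>x. qcoord s (f x) *\<^sub>R qbasis s)" if "s < 4" for s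
    using bounded_linear.summable[OF bounded_linear_scaleR_left, of "\<lambda>x. qcoord s (f x)" "qbasis s"] that by simp
  then have "summable (\<lambda>x. \<Sum>s<4. qcoord s (f x) *\<^sub>R qbasis s)" by (intro summable_sum) auto
  moreover have "(\<Sum>s<4. qcoord s q *\<^sub>R qbasis s) = q" for q
    by (simp add: sum_less_4 qcoord_sel qbasis_nth quat_eq_iff)
  ultimately show ?thesis by simp
qed

lemma ell2_summable_inner:
  assumes "v \<in> ell2 F" "w \<in> ell2 F"
  shows "summable (\<lambda>x. qcnj (w x) * v x)"
proof (rule summable_norm_quat, rule summable_comparison_test')
  show "summable (\<lambda>x. (norm (v x))\<^sup>2 + (norm (w x))\<^sup>2)"
    using assms by (auto simp: ell2_def intro: summable_add)
  have "b * a \<le> a\<^sup>2 + b\<^sup>2" for a b :: real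
  proof -
    have "0 \<le> (a - b)\<^sup>2 + a\<^sup>2 + b\<^sup>2" by simp
    then show ?thesis by (simp add: power2_eq_square algebra_simps)
  qed
  then show "norm (norm (qcnj (w x) * v x)) \<le> (norm (v x))\<^sup>2 + (norm (w x))\<^sup>2" for x
    by (simp add: norm_quat_mult)
qed

text \<open>The bound involves the coordinates of \<open>v\<close> and \<open>w\<close> in \<open>T\<close> only, hence becomes small when \<open>T\<close>
  moves off to infinity while the entries of \<open>B\<close> stay bounded.\<close>

lemma ell2_inner_mat_vec_bound:
  assumes v: "v \<in> ell2 F" and w: "w \<in> ell2 F" and B: "msupp B \<subseteq> T" "finite T"
  shows "norm (ell2_inner (mat_vec B v) w - ell2_inner v w)
    \<le> (\<Sum>x\<in>T. norm (w x) * ((\<Sum>y\<in>T. norm (B x y) * norm (v y)) + norm (v x)))"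
proof -
  let ?g = "\<lambda>x. qcnj (w x) * (mat_vec B v x - v x)"
  have off: "mat_vec B v x = v x" if "x \<notin> T" for x
  proof -
    have "x \<notin> msupp B" using that B by blast
    note e = off_msupp(1)[OF this]
    have "{k. B x k \<noteq> 0} = {x}" by (auto simp: e mat_one_def)
    then show ?thesis by (simp add: mat_vec_def e mat_one_def)
  qed
  have on: "mat_vec B v x = (\<Sum>y\<in>T. B x y * v y)" if "x \<in> T" for x
  proof -
    have "B x k = 0" if "k \<notin> T" for k
    proof -
      have "k \<notin> msupp B" using that B by blast
      then have "B x k = mat_one x k" by (rule off_msupp)
      then show ?thesis using that \<open>x \<in> T\<close> by (auto simp: mat_one_def)
    qed
    then show ?thesis unfolding mat_vec_def
      by (intro sum.mono_neutral_left B) auto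
  qed
  have g: "?g sums (\<Sum>x\<in>T. ?g x)" by (rule sums_finite[OF B(2)]) (simp add: off)
  have "(\<lambda>x. qcnj (w x) * v x + ?g x) sums (ell2_inner v w + (\<Sum>x\<in>T. ?g x))"
    unfolding ell2_inner_def
    by (rule sums_add[OF summable_sums[OF ell2_summable_inner[OF v w]] g])
  moreover have "qcnj (w x) * v x + ?g x = qcnj (w x) * mat_vec B v x" for x
    by (simp add: right_diff_distrib)
  ultimately have "ell2_inner (mat_vec B v) w = ell2_inner v w + (\<Sum>x\<in>T. ?g x)"
    unfolding ell2_inner_def by (simp add: sums_iff)
  then have "norm (ell2_inner (mat_vec B v) w - ell2_inner v w) = norm (\<Sum>x\<in>T. ?g x)" by simp
  also have "\<dots> \<le> (\<Sum>x\<in>T. norm (?g x))" by (rule norm_sum)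
  also have "\<dots> \<le> (\<Sum>x\<in>T. norm (w x) * ((\<Sum>y\<in>T. norm (B x y) * norm (v y)) + norm (v x)))"
  proof (rule sum_mono)
    fix x assume x: "x \<in> T"
    have "norm (mat_vec B v x - v x) \<le> norm (mat_vec B v x) + norm (v x)" by (rule norm_triangle_ineq4)
    also have "norm (mat_vec B v x) \<le> (\<Sum>y\<in>T. norm (B x y * v y))" unfolding on[OF x] by (rule norm_sum)
    finally have "norm (mat_vec B v x - v x) \<le> (\<Sum>y\<in>T. norm (B x y) * norm (v y)) + norm (v x)"
      by (simp add: norm_quat_mult)
    then show "norm (?g x) \<le> norm (w x) * ((\<Sum>y\<in>T. norm (B x y) * norm (v y)) + norm (v x))"
      unfolding norm_quat_mult norm_qcnj by (rule mult_left_mono) simp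
  qed
  finally show ?thesis .
qed

lemma ell2_tendsto_zero:
  assumes "v \<in> ell2 F" "inj_on \<omega> {1..}" "1 \<le> i"
  shows "(\<lambda>n. norm (v (\<omega> (n + i)))) \<longlonglongrightarrow> 0"
proof -
  have "summable (\<lambda>x. (norm (v x))\<^sup>2)" using assms by (simp add: ell2_def)
  then have "(\<lambda>x. sqrt ((norm (v x))\<^sup>2)) \<longlonglongrightarrow> sqrt 0"
    by (intro tendsto_real_sqrt summable_LIMSEQ_zero)
  then have lim: "(\<lambda>x. norm (v x)) \<longlonglongrightarrow> 0" by simp
  have "inj (\<lambda>n. \<omega> (n + i))"
    using assms(3) by (auto intro!: injI dest: inj_onD[OF assms(2)])
  then have "finite ((\<lambda>n. \<omega> (n + i)) -` {..<Z})" for Z by (intro finite_vimageI) simp_all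
  then have "\<forall>\<^sub>F n in cofinite. Z \<le> \<omega> (n + i)" for Z
    by (simp add: eventually_cofinite vimage_def not_le)
  then have "filterlim (\<lambda>n. \<omega> (n + i)) sequentially sequentially"
    by (simp add: filterlim_at_top cofinite_eq_sequentially)
  from filterlim_compose[OF lim this] show ?thesis .
qed

lemma limitin_pullback_topology:
  assumes "limitin T (\<lambda>x. \<phi> (f x)) (\<phi> l) F" "l \<in> A" "\<And>x. f x \<in> A"
  shows "limitin (pullback_topology A \<phi> T) f l F"
  unfolding limitin_def
proof (intro conjI allI impI)
  have "\<phi> l \<in> topspace T" using assms(1) by (simp add: limitin_def)
  then show "l \<in> topspace (pullback_topology A \<phi> T)"
    using assms(2) by (simp add: topspace_pullback_topology)
  fix U assume U: "openin (pullback_topology A \<phi> T) U \<and> l \<in> U"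
  then obtain W where W: "openin T W" "U = \<phi> -` W \<inter> A" by (auto simp: openin_pullback_topology)
  then have "\<phi> l \<in> W" using U by auto
  then have "\<forall>\<^sub>F x in F. \<phi> (f x) \<in> W" by (rule limitinD[OF assms(1) W(1)])
  then show "\<forall>\<^sub>F x in F. f x \<in> U" unfolding W(2) by eventually_elim (simp add: assms(3))
qed

lemma topspace_irr_heavy: "topspace (irr_heavy_topology h) = carrier (irr_heavy_group h)"
  by (auto simp: irr_heavy_topology_def Let_def topspace_pullback_topology)

lemma topspace_heavy: "topspace (heavy_topology L) = heavy_elems L"
  unfolding heavy_topology_def heavy_group_def
  by (simp add: topspace_irr_heavy)

text \<open>The nontrivial entries of the conjugate by a swap are those of \<open>l\<close>, moved
  to basis vectors whose indices tend to infinity; there the coordinates of square-summable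
  vectors tend to zero.\<close>

lemma theta_conj_limit:
  assumes \<omega>: "\<And>j. j < length L \<Longrightarrow> bij_betw (\<omega> j) {1..} (- \<Xi> j)"
    and l: "l \<in> heavy_stabilizer L \<Xi>"
  shows "limitin (heavy_topology L) (\<lambda>m. point_conj L (theta_pt L \<omega> m) l)
    \<one>\<^bsub>heavy_group L\<^esub> (multi_at_top (length L))"
proof -
  interpret group "heavy_group L" by (rule group_heavy)
  let ?Fl = "multi_at_top (length L)"
  let ?C = "\<lambda>m. point_conj L (theta_pt L \<omega> m) l"
  have l': "l \<in> heavy_elems L" using l by (simp add: heavy_stabilizer_iff)
  have \<theta>: "theta_pt L \<omega> m \<in> fin_perms fst (points L \<Xi>)" for m
    by (rule theta_pt_fin_perms[OF \<omega>])
  have \<theta>_inv: "inv_into UNIV (theta_pt L \<omega> m) = theta_pt L \<omega> m" for m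
    by (rule theta_pt_inv[OF \<omega>])
  have C: "?C m \<in> heavy_elems L" for m by (rule point_conj_carrier[OF \<theta> l'])
  have "limitin (irr_heavy_topology (L ! j)) (\<lambda>m. ?C m j) mat_one ?Fl" if j: "j < length L" for j
    unfolding irr_heavy_topology_def Let_def
  proof (rule limitin_pullback_topology)
    let ?E = "ell2 (heavy_scalars (L ! j))"
    show "?C m j \<in> carrier (irr_heavy_group (L ! j))" for m using C[of m] j by (simp add: heavy_carrier)
    show "mat_one \<in> carrier (irr_heavy_group (L ! j))"
      using one_closed j heavy_one[OF j] by (metis heavy_carrier)
    have lim: "((\<lambda>m. ell2_inner (mat_vec (?C m j) v) w) \<longlongrightarrow> ell2_inner (mat_vec mat_one v) w) ?Fl"
      if v: "v \<in> ?E" and w: "w \<in> ?E" for v w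
    proof -
      have dis: "msupp (l j) \<inter> \<Xi> j = {}" using l j by (simp add: heavy_stabilizer_iff)
      obtain I N where I: "finite I" "I \<subseteq> {1..N}" "msupp (l j) = \<omega> j ` I"
        by (rule finite_enumerated[of L \<omega> \<Xi>, OF \<omega> j heavy_component(3)[OF l' j] dis]) blast
      have inj: "inj_on (\<omega> j) {1..}" using \<omega>[OF j] by (simp add: bij_betw_def)
      let ?R = "\<lambda>n. \<Sum>i\<in>I. norm (w (\<omega> j (n + i))) *
         ((\<Sum>k\<in>I. norm (l j (\<omega> j i) (\<omega> j k)) * norm (v (\<omega> j (n + k)))) + norm (v (\<omega> j (n + i))))"
      have one: "mat_vec mat_one v = v"
      proof -
        have "{k. mat_one x k \<noteq> 0} = {x}" for x by (auto simp: mat_one_def)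
        then show ?thesis by (simp add: fun_eq_iff mat_vec_def) (simp add: mat_one_def)
      qed
      have "?R \<longlonglongrightarrow> (\<Sum>i\<in>I. 0 * ((\<Sum>k\<in>I. norm (l j (\<omega> j i) (\<omega> j k)) * 0) + 0))"
        using I(2) by (intro tendsto_intros ell2_tendsto_zero[OF v inj] ell2_tendsto_zero[OF w inj]) auto
      then have "?R \<longlonglongrightarrow> 0" by simp
      from filterlim_compose[OF this multi_at_top_component[OF j]]
      have R: "((\<lambda>m. ?R (m j)) \<longlongrightarrow> 0) ?Fl" .
      have "\<forall>\<^sub>F m in ?Fl. norm (ell2_inner (mat_vec (?C m j) v) w - ell2_inner v w) \<le> ?R (m j)"
      proof (rule eventually_mono)
        show "\<forall>\<^sub>F m in ?Fl. N \<le> m j"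
          using multi_at_top_component[OF j] by (simp add: filterlim_at_top)
        fix m :: "nat \<Rightarrow> nat" assume m: "N \<le> m j"
        let ?T = "(\<lambda>i. \<omega> j (m j + i)) ` I"
        have swap: "comp_perm (theta_pt L \<omega> m) j (\<omega> j (m j + i)) = \<omega> j i" if "i \<in> I" for i
        proof -
          have "m j + i \<in> {m j + 1..2 * m j}" using that I(2) m by auto
          then show ?thesis
            using block_swap_cases(2)[OF inj] j by (simp add: comp_perm_def theta_pt_def)
        qed
        have swap': "theta_pt L \<omega> m (j, \<omega> j i) = (j, \<omega> j (m j + i))" if "i \<in> I" for i
        proof -
          have "i \<in> {1..m j}" using that I(2) m by auto
          then show ?thesis using block_swap_cases(1)[OF inj] j by (simp add: theta_pt_def)
        qed
        have entry: "?C m j (\<omega> j (m j + i)) (\<omega> j (m j + k)) = l j (\<omega> j i) (\<omega> j k)"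
          if "i \<in> I" "k \<in> I" for i k
          unfolding point_conj_entry[OF \<theta> l' j] \<theta>_inv
          by (simp add: swap that)
        have sub: "msupp (?C m j) \<subseteq> ?T"
        proof
          fix x assume "x \<in> msupp (?C m j)"
          then obtain z where z: "z \<in> msupp (l j)" "theta_pt L \<omega> m (j, z) = (j, x)"
            using msupp_point_conj[OF \<theta> l' j] by blast
          then obtain i where "i \<in> I" "z = \<omega> j i" using I(3) by blast
          then show "x \<in> ?T" using z(2) swap' by auto
        qed
        have inj': "inj_on (\<lambda>i. \<omega> j (m j + i)) I"
          using I(2) by (auto intro!: inj_onI dest!: inj_onD[OF inj])
        have "norm (ell2_inner (mat_vec (?C m j) v) w - ell2_inner v w) \<le>
          (\<Sum>x\<in>?T. norm (w x) * ((\<Sum>y\<in>?T. norm (?C m j x y) * norm (v y)) + norm (v x)))"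
          by (rule ell2_inner_mat_vec_bound[OF v w sub]) (simp add: I(1))
        also have "\<dots> = ?R (m j)"
          by (simp add: sum.reindex[OF inj'] entry cong: sum.cong)
        finally show "norm (ell2_inner (mat_vec (?C m j) v) w - ell2_inner v w) \<le> ?R (m j)" .
      qed
      from Lim_null_comparison[OF this R] show ?thesis unfolding one by (rule LIM_zero_cancel)
    qed
    show "limitin (product_topology (\<lambda>_. euclidean) (?E \<times> ?E))
      (\<lambda>m. \<lambda>(v, w)\<in>?E \<times> ?E. ell2_inner (mat_vec (?C m j) v) w)
      (\<lambda>(v, w)\<in>?E \<times> ?E. ell2_inner (mat_vec mat_one v) w) ?Fl"
      unfolding limitin_componentwise using lim by auto
  qed
  then show ?thesis
    unfolding heavy_topology_def limitin_componentwise
    using one_closed C heavy_one topspace_heavy[of L]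
    by (auto simp: heavy_topology_def heavy_carrier)
qed

section \<open>The mantle\<close>

definition local_stabilizer :: "heavy list \<Rightarrow> (nat \<Rightarrow> nat set) \<Rightarrow> (nat \<times> nat) set \<Rightarrow> (nat \<Rightarrow> mat) set" where
  "local_stabilizer L \<Xi> F = {l \<in> heavy_stabilizer L \<Xi>. \<forall>j<length L. \<forall>x\<in>msupp (l j). (j, x) \<notin> F}"

lemma subgroup_heavy_stabilizer: "subgroup (heavy_stabilizer L \<Xi>) (heavy_group L)"
proof -
  interpret group "heavy_group L" by (rule group_heavy)
  show ?thesis
  proof (rule subgroupI)
    show "heavy_stabilizer L \<Xi> \<subseteq> heavy_elems L" by (auto simp: heavy_stabilizer_iff)
    have "\<one>\<^bsub>heavy_group L\<^esub> \<in> heavy_stabilizer L \<Xi>" by (simp add: heavy_stabilizer_iff heavy_one)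
    then show "heavy_stabilizer L \<Xi> \<noteq> {}" by blast
    fix l assume l: "l \<in> heavy_stabilizer L \<Xi>"
    then have lc: "l \<in> heavy_elems L" by (simp add: heavy_stabilizer_iff)
    let ?i = "inv\<^bsub>heavy_group L\<^esub> l"
    have "msupp (?i j) \<subseteq> msupp (l j)" if j: "j < length L" for j
    proof
      fix x assume x: "x \<in> msupp (?i j)"
      have 1: "?i j *\<^sub>m l j = mat_one" "l j *\<^sub>m ?i j = mat_one"
        using heavy_mult[OF j, of ?i l] heavy_mult[OF j, of l ?i] lc by (simp_all add: heavy_one[OF j])
      show "x \<in> msupp (l j)"
      proof (rule ccontr)
        assume nx: "x \<notin> msupp (l j)"
        have "?i j x y = mat_one x y" for y
          using mat_mult_left_off[OF nx, of "?i j" y] by (simp add: 1)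
        moreover have "?i j y x = mat_one y x" for y
          using mat_mult_right_off[OF nx heavy_component(2)[OF inv_closed[OF lc] j], of y] by (simp add: 1)
        ultimately show False using x by (simp add: msupp_def)
      qed
    qed
    then show "?i \<in> heavy_stabilizer L \<Xi>" using l lc by (auto simp: heavy_stabilizer_iff)
    fix l' assume l': "l' \<in> heavy_stabilizer L \<Xi>"
    have "msupp ((l \<otimes>\<^bsub>heavy_group L\<^esub> l') j) \<subseteq> msupp (l j) \<union> msupp (l' j)" if "j < length L" for j
      unfolding heavy_mult[OF that] by (rule msupp_mult[OF heavy_component(2)[OF lc that]])
    then have "msupp ((l \<otimes>\<^bsub>heavy_group L\<^esub> l') j) \<inter> \<Xi> j = {}" if "j < length L" for j
      using l l' that unfolding heavy_stabilizer_iff by blast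
    then show "l \<otimes>\<^bsub>heavy_group L\<^esub> l' \<in> heavy_stabilizer L \<Xi>"
      using l l' by (simp add: heavy_stabilizer_iff)
  qed
qed

lemma mantle_group_pair:
  assumes GL: "GL_pair G L \<sigma>"
    and \<omega>: "\<And>j. j < length L \<Longrightarrow> bij_betw (\<omega> j) {1..} (- \<Xi> j)"
  shows "mantle_group (classical_group G) (pair_incl G \<sigma> ` heavy_stabilizer L \<Xi>) fst (points L \<Xi>)
    (\<lambda>s. pair_incl G \<sigma> (point_perm L s)) (\<lambda>F. pair_incl G \<sigma> ` local_stabilizer L \<Xi> F)
    (theta_pt L \<omega>) (multi_at_top (length L))"
proof -
  let ?K = "local_stabilizer L \<Xi>" and ?H = "heavy_stabilizer L \<Xi>"
  let ?G = "classical_group G"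
  let ?\<iota> = "pair_incl G \<sigma>" and ?X = "points L \<Xi>"
  interpret group_hom "heavy_group L" "classical_group G" ?\<iota>
    by (intro group_hom.intro group_heavy group_classical group_hom_axioms.intro pair_incl_hom GL)
  have stab: "l \<in> heavy_elems L" if "l \<in> ?H" for l
    using that by (simp add: heavy_stabilizer_iff)
  have \<pi>_local: "point_perm L s \<in> ?K F"
    if s: "s \<in> fin_perms fst ?X" "\<And>q. q \<in> F \<Longrightarrow> s q = q" for s F
  proof -
    have moved: "(j, x) \<notin> F \<and> x \<notin> \<Xi> j" if j: "j < length L" and x: "x \<in> msupp (point_perm L s j)" for j x
    proof -
      have "x \<in> msupp (perm_mat (comp_perm s j))" using x j by (simp add: point_perm_def)
      then have "comp_perm s j x \<noteq> x" using msupp_perm[OF bij_is_inj[OF comp_perm_bij[OF s(1)]]] by blast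
      then have "s (j, x) \<noteq> (j, x)" by (simp add: comp_perm[OF s(1)])
      then have "(j, x) \<notin> F" "(j, x) \<in> ?X" using s by (auto simp: fin_perms_def)
      then show ?thesis by (simp add: points_def)
    qed
    then show ?thesis
      using point_perm_in[OF s(1)] by (auto simp: local_stabilizer_def heavy_stabilizer_iff)
  qed
  have conj_local: "point_conj L s l \<in> ?K (s ` F)"
    if s: "s \<in> fin_perms fst ?X" and l: "l \<in> ?K F" for s l F
  proof -
    have lc: "l \<in> heavy_elems L" using l stab by (simp add: local_stabilizer_def)
    have inj: "inj s" using s by (simp add: fin_perms_def bij_is_inj)
    have "(j, x) \<notin> s ` F \<and> x \<notin> \<Xi> j"
      if j: "j < length L" and x: "x \<in> msupp (point_conj L s l j)" for j x
    proof -
      obtain z where z: "z \<in> msupp (l j)" "s (j, z) = (j, x)"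
        using msupp_point_conj[OF s lc j x] by blast
      have zF: "(j, z) \<notin> F" "z \<notin> \<Xi> j"
        using l z(1) j by (auto simp: local_stabilizer_def heavy_stabilizer_iff)
      have "(j, x) \<notin> s ` F" unfolding z(2)[symmetric] using zF(1) by (simp add: inj_image_mem_iff[OF inj])
      moreover have "(j, z) \<in> ?X" using zF j by (simp add: points_def)
      then have "(j, x) \<in> ?X" unfolding z(2)[symmetric] by (rule fin_perms_maps[OF s])
      ultimately show ?thesis by (simp add: points_def)
    qed
    then show ?thesis
      using point_conj_carrier[OF s lc] by (auto simp: local_stabilizer_def heavy_stabilizer_iff)
  qed
  show ?thesis
  proof (intro mantle_group.intro mantle_group_axioms.intro group_classical)
    show "subgroup (?\<iota> ` ?H) (classical_group G)"
      by (rule subgroup_img_is_subgroup[OF subgroup_heavy_stabilizer])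
    show "multi_at_top (length L) \<noteq> bot" by (rule multi_at_top_nontrivial)
    show "?\<iota> ` ?K F \<subseteq> ?\<iota> ` ?H" for F
      by (auto simp: local_stabilizer_def)
    show "F \<subseteq> F' \<Longrightarrow> ?\<iota> ` ?K F' \<subseteq> ?\<iota> ` ?K F" for F F'
      by (rule image_mono) (auto simp: local_stabilizer_def)
    show "theta_pt L \<omega> m \<in> fin_perms fst ?X" for m by (rule theta_pt_fin_perms[OF \<omega>])
    show "\<forall>\<^sub>F m in multi_at_top (length L). theta_pt L \<omega> m ` F \<inter> F = {}"
      if "finite F" "F \<subseteq> ?X" for F
      by (rule ev_theta_disjoint[OF \<omega> that])
    fix s assume s: "s \<in> fin_perms fst ?X"
    show "?\<iota> (point_perm L s) \<in> ?\<iota> ` ?H"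
      using \<pi>_local[OF s, of "{}"] by (auto simp: local_stabilizer_def)
    show "?\<iota> (point_perm L s) \<in> ?\<iota> ` ?K F" if "\<And>q. q \<in> F \<Longrightarrow> s q = q" for F
      by (rule imageI[OF \<pi>_local[OF s that]])
    show "?\<iota> (point_perm L (s \<circ> t)) = ?\<iota> (point_perm L s) \<otimes>\<^bsub>?G\<^esub> ?\<iota> (point_perm L t)"
      if "t \<in> fin_perms fst ?X" for t
      by (simp add: point_perm_mult[OF s that] point_perm_in[OF s] point_perm_in[OF that])
    fix k F assume "k \<in> ?\<iota> ` ?K F"
    then obtain l where l: "l \<in> ?K F" "k = ?\<iota> l" by blast
    have lc: "l \<in> heavy_elems L" using l stab by (simp add: local_stabilizer_def)
    have "?\<iota> (point_perm L s) \<otimes>\<^bsub>?G\<^esub> k \<otimes>\<^bsub>?G\<^esub> inv\<^bsub>?G\<^esub> ?\<iota> (point_perm L s)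
        = ?\<iota> (point_conj L s l)" (is "?c = _")
      using point_perm_in[OF s] lc by (simp add: l(2) point_conj_def)
    then show "?c \<in> ?\<iota> ` ?K (s ` F)"
      using conj_local[OF s l(1)] by simp
  next
    fix k assume "k \<in> ?\<iota> ` ?H"
    then obtain l where l: "l \<in> ?H" "k = ?\<iota> l" by blast
    let ?E = "\<Union>j<length L. Pair j ` msupp (l j)"
    have "finite ?E" using heavy_component(3)[OF stab[OF l(1)]] by auto
    moreover have "?E \<subseteq> ?X" using l(1) by (auto simp: points_def heavy_stabilizer_iff)
    moreover have "k \<in> ?\<iota> ` ?K F" if "F \<inter> ?E = {}" for F
      unfolding l(2) by (rule imageI) (use that l(1) in \<open>auto simp: local_stabilizer_def\<close>)
    ultimately show "\<exists>E. finite E \<and> E \<subseteq> ?X \<and> (\<forall>F. F \<inter> E = {} \<longrightarrow> k \<in> ?\<iota> ` ?K F)"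
      by (intro exI[of _ ?E] conjI allI impI)
  next
    fix g assume g: "g \<in> carrier (classical_group G)"
    obtain E where E: "\<And>j. finite (E j)" "\<And>l. l \<in> heavy_elems L \<Longrightarrow>
        (\<And>j. j < length L \<Longrightarrow> msupp (l j) \<inter> E j = {}) \<Longrightarrow>
        ?\<iota> l \<otimes>\<^bsub>?G\<^esub> g = g \<otimes>\<^bsub>?G\<^esub> ?\<iota> l"
      by (rule pair_incl_commute[OF GL g]) blast
    let ?F = "(\<Union>j<length L. Pair j ` E j) \<inter> ?X"
    have "finite ?F" using E(1) by auto
    moreover have "?F \<subseteq> ?X" by (rule Int_lower2)
    moreover have "?\<iota> l \<otimes>\<^bsub>?G\<^esub> g = g \<otimes>\<^bsub>?G\<^esub> ?\<iota> l"
      if l: "l \<in> ?K ?F" for l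
    proof (rule E(2))
      have ls: "l \<in> ?H" using l by (simp add: local_stabilizer_def)
      then show "l \<in> heavy_elems L" by (rule stab)
      fix j assume j: "j < length L"
      have "(j, x) \<notin> ?F" "x \<notin> \<Xi> j" if "x \<in> msupp (l j)" for x
        using l ls j that by (auto simp: local_stabilizer_def heavy_stabilizer_iff)
      then show "msupp (l j) \<inter> E j = {}" using j by (auto simp: points_def)
    qed
    ultimately show "\<exists>F. finite F \<and> F \<subseteq> ?X \<and>
        (\<forall>k\<in>?\<iota> ` ?K F. k \<otimes>\<^bsub>?G\<^esub> g = g \<otimes>\<^bsub>?G\<^esub> k)"
      by (intro exI[of _ ?F] conjI ballI) (auto elim!: imageE)
  qed
qed

text \<open>Unitary operators that converge weakly to the identity converge strongly, which turns
  the continuity of the matrix elements into the asymptotic axiom.\<close>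

lemma mantle_rep_pair:
  fixes \<rho> :: "(nat \<Rightarrow> mat) \<Rightarrow> 'h::complex_hilbert_space \<Rightarrow> 'h"
  assumes GL: "GL_pair G L \<sigma>"
    and \<omega>: "\<And>j. j < length L \<Longrightarrow> bij_betw (\<omega> j) {1..} (- \<Xi> j)"
    and \<rho>: "pair_unitary_rep G L \<sigma> \<rho>"
  shows "mantle_rep (classical_group G) (pair_incl G \<sigma> ` heavy_stabilizer L \<Xi>) fst (points L \<Xi>)
    (\<lambda>s. pair_incl G \<sigma> (point_perm L s)) (\<lambda>F. pair_incl G \<sigma> ` local_stabilizer L \<Xi> F)
    (theta_pt L \<omega>) (multi_at_top (length L)) \<rho>"
proof -
  let ?\<iota> = "pair_incl G \<sigma>" and ?Fl = "multi_at_top (length L)"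
  have hom: "\<rho> \<in> hom (classical_group G) unitary_group" using \<rho> by (simp add: pair_unitary_rep_def)
  interpret group_hom "heavy_group L" "classical_group G" ?\<iota>
    by (intro group_hom.intro group_heavy group_classical group_hom_axioms.intro pair_incl_hom GL)
  interpret mantle_group "classical_group G" "?\<iota> ` heavy_stabilizer L \<Xi>" fst "points L \<Xi>"
    "\<lambda>s. ?\<iota> (point_perm L s)" "\<lambda>F. ?\<iota> ` local_stabilizer L \<Xi> F" "theta_pt L \<omega>" ?Fl
    by (rule mantle_group_pair[OF GL \<omega>])
  have unit: "\<rho> g \<in> carrier unitary_group" if "g \<in> carrier (classical_group G)" for g
    using hom that by (auto simp: hom_def)
  show ?thesis
  proof (intro mantle_rep.intro mantle_group_axioms mantle_rep_axioms.intro hom)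
    fix k and v :: 'h assume "k \<in> ?\<iota> ` heavy_stabilizer L \<Xi>"
    then obtain l where l: "l \<in> heavy_stabilizer L \<Xi>" "k = ?\<iota> l" by blast
    have lc: "l \<in> heavy_elems L" using l by (simp add: heavy_stabilizer_iff)
    let ?C = "\<lambda>m. point_conj L (theta_pt L \<omega> m) l"
    have C: "?C m \<in> heavy_elems L" for m by (rule point_conj_carrier[OF \<theta> lc])
    have eq: "cj (theta_pt L \<omega> m) k = ?\<iota> (?C m)" for m
      using point_perm_in[OF \<theta>] lc by (simp add: cj_def l(2) point_conj_def)
    have one: "\<rho> \<one>\<^bsub>classical_group G\<^esub> v = v"
    proof -
      have "\<rho> \<one>\<^bsub>classical_group G\<^esub> (\<rho> \<one>\<^bsub>classical_group G\<^esub> v) = \<rho> \<one>\<^bsub>classical_group G\<^esub> v"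
        using Group.hom_mult[OF hom, of "\<one>\<^bsub>classical_group G\<^esub>" "\<one>\<^bsub>classical_group G\<^esub>"]
        by (simp add: unitary_group_def comp_def fun_eq_iff)
      then have "norm (\<rho> \<one>\<^bsub>classical_group G\<^esub> (\<rho> \<one>\<^bsub>classical_group G\<^esub> v - v)) = 0"
        by (simp add: linear_diff[OF unitary_groupD(1)[OF unit]])
      then show ?thesis by (simp add: unitary_groupD(4)[OF unit])
    qed
    have "continuous_map (heavy_topology L) euclidean (\<lambda>l. cinner (\<rho> (?\<iota> l) v) v)"
      using \<rho> by (simp add: pair_unitary_rep_def)
    from continuous_map_limit[OF this theta_conj_limit[OF \<omega> l(1)]]
    have "((\<lambda>m. cinner (\<rho> (?\<iota> (?C m)) v) v) \<longlongrightarrow> cinner v v) ?Fl"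
      by (simp add: comp_def one)
    from tendsto_Re[OF this] have "((\<lambda>m. inner (\<rho> (?\<iota> (?C m)) v) v) \<longlongrightarrow> inner v v) ?Fl"
      by (simp add: Re_cinner)
    then have "((\<lambda>m. sqrt (2 * inner v v - 2 * inner (\<rho> (?\<iota> (?C m)) v) v)) \<longlongrightarrow> sqrt (2 * inner v v - 2 * inner v v)) ?Fl"
      by (intro tendsto_real_sqrt tendsto_diff tendsto_mult tendsto_const)
    moreover have "norm (\<rho> (?\<iota> (?C m)) v - v) = sqrt (2 * inner v v - 2 * inner (\<rho> (?\<iota> (?C m)) v) v)" for m
    proof -
      have i: "inner (\<rho> (?\<iota> (?C m)) v) (\<rho> (?\<iota> (?C m)) v) = inner v v"
        by (rule unitary_groupD(3)[OF unit]) (simp add: C)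
      have "inner (a - v) (a - v) = 2 * inner v v - 2 * inner a v" if "inner a a = inner v v" for a :: 'h
        using that by (simp add: inner_diff_left inner_diff_right inner_commute[of v a])
      from this[OF i] show ?thesis unfolding norm_eq_sqrt_inner by (simp only:)
    qed
    ultimately have "((\<lambda>m. norm (\<rho> (?\<iota> (?C m)) v - v)) \<longlongrightarrow> 0) ?Fl"
      by (simp only: diff_self real_sqrt_zero)
    then show "((\<lambda>m. \<rho> (cj (theta_pt L \<omega> m) k) v) \<longlongrightarrow> v) ?Fl"
      unfolding eq tendsto_norm_zero_iff by (rule LIM_zero_cancel)
  qed
qed

theorem mainTheorem6:
  fixes G :: "classical list" and L :: "heavy list"
    and \<sigma> :: "(nat \<Rightarrow> mat) \<Rightarrow> nat \<Rightarrow> mat"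
    and \<Xi> :: "nat \<Rightarrow> nat set" and \<omega> :: "nat \<Rightarrow> nat \<Rightarrow> nat"
  assumes "GL_pair G L \<sigma>"
    and "\<And>j. j < length L \<Longrightarrow> infinite (\<Xi> j) \<and> infinite (- \<Xi> j)"
    and "\<And>j. j < length L \<Longrightarrow> bij_betw (\<omega> j) {1..} (- \<Xi> j)"
  shows "(\<forall>\<gg>\<in>mantle G L \<sigma> \<Xi>. \<forall>\<hh>\<in>mantle G L \<sigma> \<Xi>. \<forall>g\<in>\<gg>. \<forall>h\<in>\<hh>.
            eventual_dcoset G L \<sigma> \<Xi> \<omega> g h (mantle_mult G L \<sigma> \<Xi> \<omega> \<gg> \<hh>)) \<and>
         is_semigroup (mantle G L \<sigma> \<Xi>) (mantle_mult G L \<sigma> \<Xi> \<omega>) \<and>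
         (\<forall>\<rho> :: (nat \<Rightarrow> mat) \<Rightarrow> 'h::complex_hilbert_space \<Rightarrow> 'h. pair_unitary_rep G L \<sigma> \<rho> \<longrightarrow>
            (\<forall>\<gg>\<in>mantle G L \<sigma> \<Xi>. \<forall>g\<in>\<gg>.
               rho_bar_dcoset G L \<sigma> \<Xi> \<rho> \<gg> = rho_bar G L \<sigma> \<Xi> \<rho> g) \<and>
            semigroup_rep (mantle G L \<sigma> \<Xi>) (mantle_mult G L \<sigma> \<Xi> \<omega>)
              (fixed_space G L \<sigma> \<Xi> \<rho>) (rho_bar_dcoset G L \<sigma> \<Xi> \<rho>))"
proof -
  note \<omega> = assms(3)
  let ?\<iota> = "pair_incl G \<sigma>" and ?Fl = "multi_at_top (length L)"
  let ?G = "classical_group G" and ?M = "mantle G L \<sigma> \<Xi>" and ?m = "mantle_mult G L \<sigma> \<Xi> \<omega>"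
  interpret mantle_group ?G "?\<iota> ` heavy_stabilizer L \<Xi>" fst "points L \<Xi>"
    "\<lambda>s. ?\<iota> (point_perm L s)" "\<lambda>F. ?\<iota> ` local_stabilizer L \<Xi> F" "theta_pt L \<omega>" ?Fl
    by (rule mantle_group_pair[OF assms(1) \<omega>])
  have dcoset: "mantle_dcoset G L \<sigma> \<Xi> = dc" by (simp add: mantle_dcoset_def fun_eq_iff)
  have M: "?M = dc ` carrier ?G" by (simp add: mantle_def dcoset)
  have m: "?m = mantle_prod"
    by (simp add: fun_eq_iff mantle_mult_def mantle_prod_def eventual_dcoset_def dcoset Theta_eq)
  have 1: "eventual_dcoset G L \<sigma> \<Xi> \<omega> g h (?m \<gg> \<hh>)"
    if "\<gg> \<in> ?M" "\<hh> \<in> ?M" "g \<in> \<gg>" "h \<in> \<hh>" for \<gg> \<hh> g h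
    using that mantle_prod_eventually unfolding M m eventual_dcoset_def dcoset Theta_eq by blast
  have 2: "is_semigroup ?M ?m" unfolding M m by (rule mantle_semigroup)
  have 3: "(\<forall>\<gg>\<in>?M. \<forall>g\<in>\<gg>. rho_bar_dcoset G L \<sigma> \<Xi> \<rho> \<gg> = rho_bar G L \<sigma> \<Xi> \<rho> g) \<and>
      semigroup_rep ?M ?m (fixed_space G L \<sigma> \<Xi> \<rho>) (rho_bar_dcoset G L \<sigma> \<Xi> \<rho>)"
    if \<rho>: "pair_unitary_rep G L \<sigma> \<rho>" for \<rho> :: "(nat \<Rightarrow> mat) \<Rightarrow> 'h \<Rightarrow> 'h"
  proof -
    let ?T = "rho_bar_dcoset G L \<sigma> \<Xi> \<rho>"
    interpret R: mantle_rep ?G "?\<iota> ` heavy_stabilizer L \<Xi>" fst "points L \<Xi>"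
      "\<lambda>s. ?\<iota> (point_perm L s)" "\<lambda>F. ?\<iota> ` local_stabilizer L \<Xi> F" "theta_pt L \<omega>" ?Fl \<rho>
      by (rule mantle_rep_pair[OF assms(1) \<omega> \<rho>])
    have V: "fixed_space G L \<sigma> \<Xi> \<rho> = R.fixed" by (auto simp: fixed_space_def R.fixed_def)
    have rb: "rho_bar G L \<sigma> \<Xi> \<rho> = R.compression" by (simp add: fun_eq_iff rho_bar_def R.compression_def V Let_def)
    have rd: "?T \<gg> = R.compression g" if \<gg>: "\<gg> = dc x" "x \<in> carrier ?G" "g \<in> \<gg>" for \<gg> x g
      unfolding rho_bar_dcoset_def rb
    proof (rule the_equality)
      have "R.compression g' = R.compression x" if "g' \<in> \<gg>" for g' using R.compression_dc[OF \<gg>(2)] that \<gg>(1) by simp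
      then show "\<forall>g'\<in>\<gg>. R.compression g' = R.compression g" using \<gg>(3) by simp
      show "T = R.compression g" if "\<forall>g'\<in>\<gg>. R.compression g' = T" for T by (rule bspec[OF that \<gg>(3), symmetric])
    qed
    have rd': "?T (dc x) = R.compression x" if "x \<in> carrier ?G" for x
      by (rule rd[OF refl that dc_self[OF that]])
    show ?thesis
    proof
      show "\<forall>\<gg>\<in>?M. \<forall>g\<in>\<gg>. ?T \<gg> = rho_bar G L \<sigma> \<Xi> \<rho> g"
        unfolding M rb using rd by blast
      show "semigroup_rep ?M ?m (fixed_space G L \<sigma> \<Xi> \<rho>) (?T)"
        unfolding semigroup_rep_def V M m
      proof (intro conjI ballI)
        fix \<gg> assume "\<gg> \<in> dc ` carrier ?G"
        then obtain g where g: "g \<in> carrier ?G" "\<gg> = dc g" by blast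
        then show "?T \<gg> \<in> bounded_operators R.fixed"
          by (simp add: rd' R.compression_bounded)
        fix \<hh> v assume "\<hh> \<in> dc ` carrier ?G" and v: "v \<in> R.fixed"
        then obtain h where h: "h \<in> carrier ?G" "\<hh> = dc h" by blast
        have "mantle_prod \<gg> \<hh> \<in> dc ` carrier ?G"
          using mantle_semigroup g h unfolding is_semigroup_def by blast
        then obtain x where x: "x \<in> carrier ?G" "mantle_prod \<gg> \<hh> = dc x" by blast
        have "R.compression x v = R.compression g (R.compression h v)"
          by (rule R.compression_mantle_prod[OF g(1) h(1) x(1) _ v]) (simp add: x(2)[symmetric] g(2) h(2))
        then show "?T (mantle_prod \<gg> \<hh>) v
            = ?T \<gg> (?T \<hh> v)"
          unfolding x(2) unfolding g(2) h(2) by (simp add: rd' g(1) h(1) x(1))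
      qed
    qed
  qed
  show ?thesis using 1 2 3 by blast
qed

end
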